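(* Let $\mathfrak{a}=(\mathfrak{a}_1,\dots,\mathfrak{a}_r)$, $\mathfrak{b}=(\mathfrak{b}_1,\dots,\mathfrak{b}_r)$ be balanced and totally interlaced hypergeometric parameters, and let $f(z)=f_{\mathfrak{a},\mathfrak{b}}(z)=\sum_{n\geq0}\prod_{j=1}^r\frac{[\mathfrak{a}_j]_n}{[\mathfrak{b}_j]_n}z^n$. Then for a suitable choice of the constant of integration, $F:=\exp\left(\int f\,\frac{dz}{z}\right)=c\,z\exp\left(\int_0^z\frac{f(w)-1}{w}\,dw\right)$ ($c\in\mathbb{C}^*$) is algebraic over $\mathbb{Q}(z)$; more precisely, $F\in\mathbb{Q}(f,z)$.
   Context: Hypergeometric parameters: $\mathfrak{a}_i,\mathfrak{b}_j$ are rational numbers in $(0,1]$ with $\mathfrak{b}_r=1$ and $\mathfrak{a}_i\ne\mathfrak{b}_j$ for all $i,j$. $[a]_n=a(a+1)\cdots(a+n-1)$. Balanced means $\prod_j(\lambda-e^{2\pi i\mathfrak{a}_j})$ and $\prod_j(\lambda-e^{-2\pi i\mathfrak{b}_j})$ both lie in $\mathbb{Q}[\lambda]$ (equivalently $f$ is factorial, i.e. of the form $\sum_n\frac{(a_1n)!\cdots(a_un)!}{(b_1n)!\cdots(b_vn)!}(cz)^n$). Totally interlaced means that, identifying $(0,1]$ with the circle $\mathbb{R}/\mathbb{Z}$ and counting multiplicities, between any two of the $\mathfrak{b}_j$ there lies some $\mathfrak{a}_i$ and vice versa. Under these hypotheses $f$ is algebraic over $\mathbb{Q}(z)$, and $\mathbb{Q}(f,z)$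 denotes the field generated by $f$ and $z$ (the function field over $\mathbb{Q}$ of the curve on which $f$ is single-valued). *)

theory Defs
  imports "HOL-Complex_Analysis.Complex_Analysis" "HOL-Computational_Algebra.Polynomial"
begin

definition hyp_params :: "rat list \<Rightarrow> rat list \<Rightarrow> bool" where
  "hyp_params a b \<longleftrightarrow> length a = length b \<and> b \<noteq> [] \<and>
     (\<forall>x\<in>set a. 0 < x \<and> x \<le> 1) \<and> (\<forall>x\<in>set b. 0 < x \<and> x \<le> 1) \<and>
     last b = 1 \<and> (\<forall>x\<in>set a. \<forall>y\<in>set b. x \<noteq> y)"

definition rat_poly :: "complex poly \<Rightarrow> bool" where
  "rat_poly p \<longleftrightarrow> (\<forall>k. coeff p k \<in> \<rat>)"

definition balanced :: "rat list \<Rightarrow> rat list \<Rightarrow> bool" where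
  "balanced a b \<longleftrightarrow>
     rat_poly (prod_list (map (\<lambda>x. [:- exp (2 * pi * \<i> * of_rat x), 1:]) a)) \<and>
     rat_poly (prod_list (map (\<lambda>y. [:- exp (- 2 * pi * \<i> * of_rat y), 1:]) b))"

text \<open>w lies on the open arc of the circle R/Z (represented by (0,1]) going
  counterclockwise from x to y.\<close>
definition in_arc :: "rat \<Rightarrow> rat \<Rightarrow> rat \<Rightarrow> bool" where
  "in_arc x y w \<longleftrightarrow> (x < y \<and> x < w \<and> w < y) \<or> (y < x \<and> (x < w \<or> w < y))"

text \<open>Between any two of the xs (counted with multiplicity, i.e. distinct) lies some y.\<close>
definition separated_by :: "rat list \<Rightarrow> rat list \<Rightarrow> bool" where
  "separated_by xs ys \<longleftrightarrow> distinct xs \<and>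
     (\<forall>x\<in>set xs. \<forall>x'\<in>set xs. x \<noteq> x' \<longrightarrow> (\<exists>y\<in>set ys. in_arc x x' y))"

definition totally_interlaced :: "rat list \<Rightarrow> rat list \<Rightarrow> bool" where
  "totally_interlaced a b \<longleftrightarrow> separated_by b a \<and> separated_by a b"

definition hyp_coeff :: "rat list \<Rightarrow> rat list \<Rightarrow> nat \<Rightarrow> complex" where
  "hyp_coeff a b n = (\<Prod>j<length a. pochhammer (of_rat (a ! j)) n / pochhammer (of_rat (b ! j)) n)"

definition hyp_f :: "rat list \<Rightarrow> rat list \<Rightarrow> complex \<Rightarrow> complex" where
  "hyp_f a b z = (\<Sum>n. hyp_coeff a b n * z ^ n)"

definition hyp_F :: "rat list \<Rightarrow> rat list \<Rightarrow> complex \<Rightarrow> complex \<Rightarrow> complex" where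
  "hyp_F a b c z = c * z * exp (contour_integral (linepath 0 z) (\<lambda>w. (hyp_f a b w - 1) / w))"

definition eval2 :: "rat poly poly \<Rightarrow> complex \<Rightarrow> complex \<Rightarrow> complex" where
  "eval2 P z y = poly (map_poly (\<lambda>q. poly (map_poly of_rat q) z) P) y"

end

theory Submission
  imports Defs "HOL-Computational_Algebra.Polynomial_Factorial"
    "HOL-Computational_Algebra.Fundamental_Theorem_Algebra"
begin

text \<open>
  The primitives \<open>g\<close> of \<open>f dz / z\<close> and its analytic continuations are Mellin-Barnes integrals
  indexed by polynomials \<open>P\<close> of degree less than \<open>r\<close>, normalized so as to vanish at infinity. Continuation
  around infinity is multiplication of \<open>P\<close> by \<open>t\<close> modulo \<open>\<Prod>(t - exp (-2\<pi>i\<aa>\<^sub>j))\<close>. Continuation around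
  zero is multiplication by \<open>t\<close> modulo \<open>\<Prod>(t - exp (-2\<pi>i\<bb>\<^sub>j))\<close>, up to an additive
  constant, which is \<open>2\<pi>i\<close> times the leading coefficient of \<open>P\<close>. By balancedness both moduli are integral,
  so on integral \<open>P\<close> the exponential of the integral is a function of \<open>P\<close> alone, without ambiguity in the
  constant of integration.

  Interlacing provides a positive definite form invariant under both multiplications. Hence the integral
  \<open>P\<close> on a sphere form a finite set stable under monodromy. It indexes finitely many branches
  \<open>f\<^sub>P\<close>, pairwise distinct, with corresponding exponentials \<open>F\<^sub>P\<close>. The Lagrange interpolation polynomial sending
  \<open>f\<^sub>P\<close> to \<open>F\<^sub>P\<close> has single-valued coefficients of moderate growth, that is, coefficients rational in
  \<open>z\<close>. So \<open>F\<close> lies in the field generated by \<open>f\<close> and \<open>z\<close> over the complex numbers; since both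
  have rational Taylor coefficients, a linear functional over the rationals makes the relation rational.
\<close>

section \<open>Ratios of Gamma functions\<close>

text \<open>The integrals rest on a balance of growth. With t = \<open>e2pi s\<close> and P of
  degree less than r, the quotient of P by the characteristic polynomial of B is O(1 / (1 + |t|)),
  which exactly absorbs \<open>exp (s * \<zeta>)\<close> for 0 \<le> Im \<zeta> \<le> 2 pi. On the
  boundary of that strip only the Gamma quotient is left to force convergence, and here interlacing
  enters a first time: pairing every a with a larger b gives the kernel a power decay with exponent
  -1 - \<delta>. Hence the integrals are continuous up to both sides of the cut along the positive
  axis, they stay bounded at z = 1 without a local study of that point, and monodromy becomes a
  comparison of the two sides of the cut on (0, 1) and on (1, \<infinity>). Interlacing enters a
  second time through signs, in the definite form. The branches are distinct for an algebraic
  reason: the P with zero branch are stable under both multiplications, hence multiples of a common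
  divisor of two coprime polynomials. Distinctness keeps the denominator of the interpolation from
  vanishing identically.\<close>

lemma ln_norm_ratio_convex:
  fixes x y d :: real
  assumes "x > 0" "d \<ge> 0"
  defines "h \<equiv> \<lambda>x::real. ln (x\<^sup>2 + y\<^sup>2) / 2 - ln x"
  shows "h (x + d) - h x \<le> d * (h (x + d + 1) - h (x + d))"
proof (cases "d = 0")
  case False
  with assms have d: "d > 0" by simp
  have der: "(h has_real_derivative - y\<^sup>2 / (t * (t\<^sup>2 + y\<^sup>2))) (at t)" if "t > 0" for t
  proof -
    have "t\<^sup>2 + y\<^sup>2 > 0" using that by (simp add: add_pos_nonneg)
    hence "(h has_real_derivative 2 * t / (t\<^sup>2 + y\<^sup>2) / 2 - 1 / t) (at t)" unfolding h_def using that
      by (auto intro!: derivative_eq_intros simp: divide_simps) (simp add: power2_eq_square algebra_simps)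
    also have "2 * t / (t\<^sup>2 + y\<^sup>2) / 2 - 1 / t = - y\<^sup>2 / (t * (t\<^sup>2 + y\<^sup>2))"
      using that \<open>t\<^sup>2 + y\<^sup>2 > 0\<close> by (simp add: divide_simps) (simp add: algebra_simps power2_eq_square)
    finally show ?thesis .
  qed
  \<comment> \<open>The derivative of \<open>h\<close> increases, so \<open>h\<close> is convex: its
    secant slope over [x, x + d] is at most the one over [x + d, x + d + 1]. The second interval has
    length 1 so that the right-hand sides telescope over x + k.\<close>
  obtain u where u: "u > x" "u < x + d" "h (x + d) - h x = (x + d - x) * (- y\<^sup>2 / (u * (u\<^sup>2 + y\<^sup>2)))"
    using MVT2[of x "x + d" h "\<lambda>t. - y\<^sup>2 / (t * (t\<^sup>2 + y\<^sup>2))"] der d assms by auto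
  obtain v where v: "v > x + d" "v < x + d + 1"
      "h (x + d + 1) - h (x + d) = (x + d + 1 - (x + d)) * (- y\<^sup>2 / (v * (v\<^sup>2 + y\<^sup>2)))"
    using MVT2[of "x + d" "x + d + 1" h "\<lambda>t. - y\<^sup>2 / (t * (t\<^sup>2 + y\<^sup>2))"] der d assms by auto
  have "u * (u\<^sup>2 + y\<^sup>2) \<le> v * (v\<^sup>2 + y\<^sup>2)"
    using u v assms power_mono[of u v 2] by (intro mult_mono) auto
  moreover have "u * (u\<^sup>2 + y\<^sup>2) > 0" using u assms by (simp add: add_pos_nonneg)
  ultimately have "y\<^sup>2 / (v * (v\<^sup>2 + y\<^sup>2)) \<le> y\<^sup>2 / (u * (u\<^sup>2 + y\<^sup>2))"
    by (intro divide_left_mono) (auto intro: mult_pos_pos)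
  hence "d * (y\<^sup>2 / (v * (v\<^sup>2 + y\<^sup>2))) \<le> d * (y\<^sup>2 / (u * (u\<^sup>2 + y\<^sup>2)))"
    using d by (intro mult_left_mono) auto
  thus ?thesis using u(3) v(3) by simp
qed auto

lemma not_nonpos_Int_Re: "Re s > 0 \<Longrightarrow> s \<notin> \<int>\<^sub>\<le>\<^sub>0"
  by (auto elim!: nonpos_Ints_cases)

text \<open>In the quotient of the Gamma series the variable enters only through the factors 1 + d /
  (x + k), which decrease in \<open>x\<close>.\<close>

lemma Gamma_ratio_antimono:
  fixes x y d :: real
  assumes "0 < x" "x \<le> y" "d \<ge> 0"
  shows "Gamma y / Gamma (y + d) \<le> Gamma x / Gamma (x + d)"
proof -
  have lim: "(\<lambda>n. Gamma_series x n / Gamma_series (x + d) n) \<longlonglongrightarrow> Gamma x / Gamma (x + d)"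
    if "x > 0" for x using that assms by (intro tendsto_intros) (auto simp: Gamma_eq_zero_iff elim!: nonpos_Ints_cases)
  show ?thesis
  proof (rule LIMSEQ_le[OF lim lim])
    show "\<exists>N. \<forall>n\<ge>N. Gamma_series y n / Gamma_series (y + d) n \<le> Gamma_series x n / Gamma_series (x + d) n"
    proof (intro exI allI impI)
      fix n :: nat assume "n \<ge> 1"
      have eq: "Gamma_series x n / Gamma_series (x + d) n =
         exp (- d * ln n) * (\<Prod>k=0..n. (x + d + k) / (x + k))" if "x > 0" for x :: real
      proof -
        have "pochhammer x (n+1) > 0" "pochhammer (x+d) (n+1) > 0"
          using that assms by (auto intro!: pochhammer_pos)
        thus ?thesis
          unfolding Gamma_series_def prod_dividef pochhammer_prod
          by (simp add: field_simps exp_diff exp_add exp_minus atLeast0LessThan lessThan_Suc_atMost atLeast0AtMost)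
      qed
      have "(\<Prod>k=0..n. (y + d + k) / (y + k)) \<le> (\<Prod>k=0..n. (x + d + k) / (x + k))"
      proof (intro prod_mono conjI)
        fix k show "0 \<le> (y + d + real k) / (y + real k)" using assms by simp
        have "d / (y + k) \<le> d / (x + k)" using assms by (intro divide_left_mono) auto
        moreover have "(t + d + real k) / (t + real k) = 1 + d / (t + k)" if "t > 0" for t
          using that by (simp add: field_simps)
        ultimately show "(y + d + real k) / (y + real k) \<le> (x + d + real k) / (x + real k)"
          using assms by simp
      qed
      thus "Gamma_series y n / Gamma_series (y + d) n \<le> Gamma_series x n / Gamma_series (x + d) n"
        using eq[of x] eq[of y] assms by (simp add: mult_left_mono)
    qed
  qed (use assms in auto)
qed

text \<open>The factors of the Gamma series are compared with their values on the real axis; convexity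
  bounds each quotient by a power of the quotient of two consecutive terms, so the product telescopes.\<close>
lemma norm_Gamma_ratio_le_line:
  fixes s :: complex and d :: real
  assumes x: "Re s > 0" and d: "d \<ge> 0"
  shows "norm (Gamma s / Gamma (s + of_real d)) \<le>
           Gamma (Re s) / Gamma (Re s + d) * ((Re s + d) / norm (s + of_real d)) powr d"
proof -
  define x y where "x = Re s" and "y = Im s"
  define h where "h = (\<lambda>x::real. ln (x\<^sup>2 + y\<^sup>2) / 2 - ln x)"
  have x0: "x > 0" using x by (simp add: x_def)
  have nrm: "norm (s + of_real t) = (x + t) * exp (h (x + t))" if "t \<ge> 0" for t
  proof -
    have pos: "(x + t)\<^sup>2 + y\<^sup>2 > 0" "x + t > 0" using that x0 by (simp_all add: add_pos_nonneg)
    have "norm (s + of_real t) = sqrt ((x + t)\<^sup>2 + y\<^sup>2)"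
      by (simp add: cmod_def x_def y_def)
    also have "\<dots> = exp (ln ((x + t)\<^sup>2 + y\<^sup>2) / 2)"
      using pos by (simp add: ln_sqrt [symmetric])
    also have "\<dots> = (x + t) * exp (h (x + t))"
      using pos by (simp add: h_def exp_diff)
    finally show ?thesis .
  qed
  have lim: "(\<lambda>n. norm (Gamma_series s n / Gamma_series (s + of_real d) n)) \<longlonglongrightarrow>
      norm (Gamma s / Gamma (s + of_real d))"
    using x d by (intro tendsto_intros) (auto simp: Gamma_eq_zero_iff not_nonpos_Int_Re)
  have limx: "(\<lambda>n. Gamma_series x n / Gamma_series (x + d) n) \<longlonglongrightarrow> Gamma x / Gamma (x + d)"
    using x0 d by (intro tendsto_intros) (auto simp: Gamma_eq_zero_iff elim!: nonpos_Ints_cases)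
  \<comment> \<open>The upper end of the telescoped sum disappears in the limit; the lower end
    leaves \<open>exp (- d * h (x + d))\<close>, which is the power in the claim.\<close>
  have "(h \<longlongrightarrow> 0) at_top"
  proof -
    have "((\<lambda>x. ln (1 + (y / x)\<^sup>2) / 2) \<longlongrightarrow> ln (1 + 0\<^sup>2) / 2) at_top"
      by (intro tendsto_intros tendsto_divide_0[OF tendsto_const] filterlim_at_top_imp_at_infinity filterlim_ident) auto
    moreover have "\<forall>\<^sub>F x in at_top. ln (1 + (y / x)\<^sup>2) / 2 = h x"
      using eventually_gt_at_top[of 0]
    proof eventually_elim
      case (elim x)
      have "1 + (y/x)\<^sup>2 = (x\<^sup>2 + y\<^sup>2) / x\<^sup>2" using elim by (simp add: field_simps)
      moreover have "x\<^sup>2 + y\<^sup>2 > 0" using elim by (simp add: add_pos_nonneg)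
      ultimately show ?case using elim by (simp add: h_def ln_div ln_realpow field_simps)
    qed
    ultimately show ?thesis by (simp add: tendsto_cong)
  qed
  hence limh: "(\<lambda>n. h (x + d + real n + 1)) \<longlonglongrightarrow> 0"
    by (rule filterlim_compose, intro filterlim_at_top_mono[OF filterlim_real_sequentially] always_eventually)
       (use x0 d in auto)
  have lim2: "(\<lambda>n. Gamma_series x n / Gamma_series (x + d) n * exp (d * (h (x + d + real n + 1) - h (x + d))))
     \<longlonglongrightarrow> Gamma x / Gamma (x + d) * exp (d * (0 - h (x + d)))"
    by (intro tendsto_intros limx limh)
  have le: "norm (Gamma_series s n / Gamma_series (s + of_real d) n) \<le>
     Gamma_series x n / Gamma_series (x + d) n * exp (d * (h (x + d + real n + 1) - h (x + d)))" if n: "n \<ge> 1" for n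
  proof -
    have pos: "pochhammer x (n+1) > 0" "pochhammer (x+d) (n+1) > 0"
      using x0 d by (auto intro!: pochhammer_pos)
    have p: "norm (pochhammer (s + of_real t) (n+1)) = pochhammer (x + t) (n+1) * exp (\<Sum>k=0..n. h (x + t + k))"
      if "t \<ge> 0" for t
    proof -
      have "norm (pochhammer (s + of_real t) (n+1)) = (\<Prod>k=0..n. norm (s + of_real (t + k)))"
        by (simp add: pochhammer_prod prod_norm atLeastLessThanSuc_atLeastAtMost add_ac)
      also have "\<dots> = (\<Prod>k=0..n. (x + (t + k)) * exp (h (x + (t + k))))"
        using that by (intro prod.cong refl nrm) auto
      also have "\<dots> = pochhammer (x + t) (n+1) * exp (\<Sum>k=0..n. h (x + t + k))"
        by (simp add: prod.distrib pochhammer_prod atLeastLessThanSuc_atLeastAtMost add_ac exp_sum)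
      finally show ?thesis .
    qed
    have S: "(\<Sum>k=0..n. h (x + d + k)) - (\<Sum>k=0..n. h (x + k)) \<le> d * (h (x + d + real n + 1) - h (x + d))"
    proof -
      have "(\<Sum>k=0..n. h (x + d + k) - h (x + k)) \<le> (\<Sum>k=0..n. d * (h (x + d + Suc k) - h (x + d + k)))"
      proof (intro sum_mono)
        fix k
        show "h (x + d + k) - h (x + k) \<le> d * (h (x + d + Suc k) - h (x + d + k))"
          using ln_norm_ratio_convex[of "x + k" d y] x0 d unfolding h_def by (simp add: add_ac)
      qed
      also have "\<dots> = d * (h (x + d + Suc n) - h (x + d))"
        unfolding sum_distrib_left[symmetric] using sum_Suc_diff[of 0 n "\<lambda>k. h (x + d + k)"] by simp
      finally show ?thesis by (simp add: sum_subtractf add_ac)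
    qed
    have nz: "norm (pochhammer s (n+1)) = pochhammer x (n+1) * exp (\<Sum>k=0..n. h (x + k))" using p[of 0] by simp
    have "norm (Gamma_series s n / Gamma_series (s + of_real d) n) =
       (norm (exp (s * of_real (ln n))) / norm (exp ((s + of_real d) * of_real (ln n)))) *
       (norm (pochhammer (s + of_real d) (n+1)) / norm (pochhammer s (n+1)))"
      by (simp add: Gamma_series_def norm_divide norm_mult)
    also have "norm (exp (s * of_real (ln n))) / norm (exp ((s + of_real d) * of_real (ln n))) = exp (x * ln n) / exp ((x + d) * ln n)"
      by (simp add: norm_exp_eq_Re x_def)
    also have "(norm (pochhammer (s + of_real d) (n+1)) / norm (pochhammer s (n+1))) =
       pochhammer (x + d) (n+1) / pochhammer x (n+1) * exp ((\<Sum>k=0..n. h (x + d + k)) - (\<Sum>k=0..n. h (x + k)))"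
      unfolding nz p[OF d] by (simp add: exp_diff)
    also have "exp (x * ln n) / exp ((x + d) * ln n) * \<dots> =
        Gamma_series x n / Gamma_series (x + d) n * exp ((\<Sum>k=0..n. h (x + d + k)) - (\<Sum>k=0..n. h (x + k)))"
      using pos by (simp add: Gamma_series_def field_simps)
    also have "\<dots> \<le> Gamma_series x n / Gamma_series (x + d) n * exp (d * (h (x + d + real n + 1) - h (x + d)))"
      using S pos by (intro mult_left_mono) (auto simp: Gamma_series_def)
    finally show ?thesis .
  qed
  have "norm (Gamma s / Gamma (s + of_real d)) \<le> Gamma x / Gamma (x + d) * exp (d * (0 - h (x + d)))"
    by (rule LIMSEQ_le[OF lim lim2]) (use le in blast)
  also have "exp (d * (0 - h (x + d))) = ((x + d) / norm (s + of_real d)) powr d"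
    using x0 d nrm[OF d] by (simp add: powr_def ln_div ln_mult)
  finally show ?thesis by (simp add: x_def)
qed

text \<open>Uniform on a half-plane: the power in the bound on a line is at most 1, and the real
  quotient decreases.\<close>

lemma norm_Gamma_ratio_le:
  fixes s :: complex and d x :: real
  assumes "0 < x" "x \<le> Re s" "d \<ge> 0"
  shows "norm (Gamma s / Gamma (s + of_real d)) \<le> Gamma x / Gamma (x + d)"
proof -
  have "(Re s + d) / norm (s + of_real d) \<le> 1"
    using complex_Re_le_cmod[of "s + of_real d"] assms by (simp add: divide_simps)
  hence "((Re s + d) / norm (s + of_real d)) powr d \<le> 1"
    using assms by (intro powr_le1) auto
  moreover have "Gamma (Re s) / Gamma (Re s + d) \<ge> 0" using assms
    by (intro divide_nonneg_nonneg less_imp_le[OF Gamma_real_pos]) auto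
  ultimately have "norm (Gamma s / Gamma (s + of_real d)) \<le> Gamma (Re s) / Gamma (Re s + d) * 1"
    using norm_Gamma_ratio_le_line[of s d] assms by (meson mult_left_mono order_trans less_le_trans)
  also have "\<dots> \<le> Gamma x / Gamma (x + d)" using Gamma_ratio_antimono[of x "Re s" d] assms by simp
  finally show ?thesis .
qed

section \<open>The invariant form\<close>

text \<open>The sign is chosen so that \<open>e2pi s = cis_pt x\<close> holds exactly when s + x is
  an integer, that is, at the zeros of sin (pi (s + x)).\<close>

definition cis_pt :: "real \<Rightarrow> complex" where
  "cis_pt x = exp (- (2 * pi * \<i> * of_real x))"

definition cis_poly :: "real set \<Rightarrow> complex poly" where
  "cis_poly X = (\<Prod>x\<in>X. [:- cis_pt x, 1:])"

lemma norm_cis_pt [simp]: "norm (cis_pt x) = 1"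
  by (simp add: cis_pt_def norm_exp_eq_Re)

lemma cis_pt_nz [simp]: "cis_pt x \<noteq> 0"
  by (simp add: cis_pt_def)

text \<open>The sine is the only factor that sees the order: for points of (0, 1] its sign tells
  which of \<open>x\<close> and \<open>y\<close> is larger.\<close>

lemma cis_pt_diff: "cis_pt x - cis_pt y = exp (- (pi * \<i> * of_real (x + y))) * (- (2 * \<i>)) * of_real (sin (pi * (x - y)))"
proof -
  have s: "of_real (sin (pi * (x - y))) = (exp (\<i> * of_real (pi * (x - y))) - exp (- (\<i> * of_real (pi * (x - y))))) / (2 * \<i>)"
    unfolding sin_of_real[symmetric] sin_exp_eq by simp
  have 1: "exp (- (pi * \<i> * of_real (x + y))) * exp (\<i> * of_real (pi * (x - y))) = cis_pt y"
    unfolding exp_add[symmetric] cis_pt_def by (simp add: algebra_simps)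
  have 2: "exp (- (pi * \<i> * of_real (x + y))) * exp (- (\<i> * of_real (pi * (x - y)))) = cis_pt x"
    unfolding exp_add[symmetric] cis_pt_def by (simp add: algebra_simps)
  show ?thesis unfolding s 1[symmetric] 2[symmetric] by (simp add: field_simps)
qed

lemma poly_cis_poly: "finite X \<Longrightarrow> poly (cis_poly X) t = (\<Prod>x\<in>X. t - cis_pt x)"
  by (simp add: cis_poly_def poly_prod)

lemma degree_cis_poly: "finite X \<Longrightarrow> degree (cis_poly X) = card X"
  unfolding cis_poly_def by (subst degree_prod_sum_eq) auto

lemma lead_coeff_cis_poly: "lead_coeff (cis_poly X) = 1"
  unfolding cis_poly_def by (subst lead_coeff_prod) auto

lemma sin_pi_diff_pos: "0 < x - y \<Longrightarrow> x - y < 1 \<Longrightarrow> sin (pi * (x - y)) > 0"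
  by (rule sin_gt_zero) (auto simp: mult_less_cancel_left)

lemma sgn_sin_pi_diff:
  assumes "x \<noteq> y" "\<bar>x - y\<bar> < 1"
  shows "sin (pi * (x - y)) = (if x < y then -1 else 1) * \<bar>sin (pi * (x - y))\<bar>"
    and "sin (pi * (x - y)) \<noteq> 0"
proof -
  have "x < y \<Longrightarrow> sin (pi * (x - y)) < 0"
  proof -
    assume "x < y"
    hence "sin (pi * (y - x)) > 0" using assms by (intro sin_pi_diff_pos) auto
    thus ?thesis by (metis minus_diff_eq mult_minus_right neg_0_less_iff_less sin_minus)
  qed
  moreover have "\<not> x < y \<Longrightarrow> sin (pi * (x - y)) > 0"
    using assms by (intro sin_pi_diff_pos) auto
  ultimately show "sin (pi * (x - y)) = (if x < y then -1 else 1) * \<bar>sin (pi * (x - y))\<bar>"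
    "sin (pi * (x - y)) \<noteq> 0" by (cases "x < y"; simp)+
qed

lemma inj_on_cis_pt: "inj_on cis_pt {0<..1}"
proof (rule inj_onI)
  fix x y assume *: "x \<in> {0<..1}" "y \<in> {0<..1}" "cis_pt x = cis_pt y"
  show "x = y"
  proof (rule ccontr)
    assume "x \<noteq> y"
    with * have "sin (pi * (x - y)) \<noteq> 0" by (intro sgn_sin_pi_diff(2)) auto
    with *(3) cis_pt_diff[of x y] show False by simp
  qed
qed

text \<open>The sum is the coefficient of degree \<open>card X - 1\<close> of the Lagrange interpolant of \<open>R\<close>, that is, of \<open>R\<close>.\<close>
lemma sum_lagrange_eq_0:
  fixes R :: "'a::field poly"
  assumes fin: "finite X" and deg: "degree R + 2 \<le> card X"
  shows "(\<Sum>x\<in>X. poly R x / (\<Prod>y\<in>X - {x}. x - y)) = 0"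
proof -
  define L where "L = (\<Sum>x\<in>X. smult (poly R x / (\<Prod>y\<in>X - {x}. x - y)) (\<Prod>y\<in>X - {x}. [:-y, 1:]))"
  have degp: "degree (\<Prod>y\<in>X - {x}. [:-y, 1:]) = card X - 1" if "x \<in> X" for x
    using that fin by (subst degree_prod_sum_eq) auto
  have "poly L x = poly R x" if x: "x \<in> X" for x
  proof -
    have "poly L x = (\<Sum>x'\<in>X. poly R x' / (\<Prod>y\<in>X - {x'}. x' - y) * (\<Prod>y\<in>X - {x'}. x - y))"
      by (simp add: L_def poly_sum poly_prod)
    also have "\<dots> = (\<Sum>x'\<in>{x}. poly R x' / (\<Prod>y\<in>X - {x'}. x' - y) * (\<Prod>y\<in>X - {x'}. x - y))"
      using x fin by (intro sum.mono_neutral_right) auto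
    also have "\<dots> = poly R x" using fin by simp
    finally show ?thesis .
  qed
  moreover have "degree L < card X"
  proof -
    have "degree L \<le> card X - 1" unfolding L_def
      by (intro degree_sum_le fin order_trans[OF degree_smult_le]) (simp add: degp)
    thus ?thesis using deg by simp
  qed
  ultimately have "L = R" using deg by (intro poly_eqI_degree[of X]) auto
  hence "coeff L (card X - 1) = 0" using deg by (simp add: coeff_eq_0)
  moreover have "coeff (\<Prod>y\<in>X - {x}. [:-y, 1:]) (card X - 1) = 1" if "x \<in> X" for x
    using lead_coeff_prod[of "\<lambda>y. [:-y, 1:]" "X - {x}"] degp[OF that] by simp
  ultimately show ?thesis by (simp add: L_def coeff_sum)
qed

text \<open>The circle is cut open at 1, a point of \<open>B\<close>, so that interlacing becomes
  alternation in the linear order, with the largest point in \<open>B\<close>.\<close>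

locale interlacing =
  fixes A B :: "real set"
  assumes fin: "finite A" "finite B" and card_eq: "card A = card B" and disj: "A \<inter> B = {}"
    and sub: "A \<subseteq> {0<..1}" "B \<subseteq> {0<..1}" and one_B: "1 \<in> B"
    and sepA: "\<And>x x'. x \<in> A \<Longrightarrow> x' \<in> A \<Longrightarrow> x < x' \<Longrightarrow> \<exists>y\<in>B. x < y \<and> y < x'"
    and sepB: "\<And>x x'. x \<in> B \<Longrightarrow> x' \<in> B \<Longrightarrow> x < x' \<Longrightarrow> \<exists>y\<in>A. x < y \<and> y < x'"
begin

text \<open>Each point of \<open>A\<close> is sent to the next larger point of \<open>B\<close>.
  Separation makes the map injective, equality of cardinalities makes it onto. The gaps
  \<open>\<phi> x - x\<close> will be the exponents of decay of the Gamma quotients.\<close>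

lemma ex_next: "\<exists>\<phi>. bij_betw \<phi> A B \<and> (\<forall>x\<in>A. x < \<phi> x)"
proof -
  define \<phi> where "\<phi> x = Min {y\<in>B. x < y}" for x
  have *: "\<phi> x \<in> B \<and> x < \<phi> x" if "x \<in> A" for x
  proof -
    have "1 \<in> {y\<in>B. x < y}" using that one_B sub disj by force
    hence "{y\<in>B. x < y} \<noteq> {}" by blast
    thus ?thesis using Min_in[of "{y\<in>B. x < y}"] fin by (auto simp: \<phi>_def)
  qed
  have lt: "\<phi> x < \<phi> x'" if x: "x \<in> A" "x' \<in> A" "x < x'" for x x'
  proof -
    obtain y where y: "y \<in> B" "x < y" "y < x'" using sepA[OF x] by blast
    hence "\<phi> x \<le> y" using fin by (auto simp: \<phi>_def)
    thus ?thesis using y *[OF x(2)] by linarith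
  qed
  have "inj_on \<phi> A" by (rule linorder_inj_onI') (use lt in force)
  moreover from this have "\<phi> ` A = B"
    using * fin card_eq by (intro card_subset_eq) (auto simp: card_image)
  ultimately show ?thesis using * by (auto simp: bij_betw_def)
qed

text \<open>Descent from 1, the largest point, which lies in \<open>B\<close>: the next larger point
  always belongs to the other set.\<close>

lemma parity:
  "x \<in> A \<union> B \<Longrightarrow> x \<in> A \<longleftrightarrow> odd (card {y\<in>A \<union> B. x < y})"
proof (induction "card {y\<in>A \<union> B. x < y}" arbitrary: x rule: less_induct)
  case (less x)
  define G where "G = {y\<in>A \<union> B. x < y}"
  have finG: "finite G" using fin by (simp add: G_def)
  show ?case
  proof (cases "G = {}")
    case True
    have "x = 1"
    proof (rule ccontr)
      assume "x \<noteq> 1"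
      hence "1 \<in> G" using less.prems one_B sub by (force simp: G_def)
      thus False using True by blast
    qed
    moreover have "card {y\<in>A \<union> B. x < y} = 0" using True by (metis G_def card.empty)
    ultimately show ?thesis using one_B disj by (metis disjoint_iff even_zero)
  next
    case False
    define m where "m = Min G"
    have m: "m \<in> G" "\<And>y. y \<in> G \<Longrightarrow> m \<le> y" using False finG by (auto simp: m_def)
    have G: "G = insert m {y\<in>A \<union> B. m < y}" using m by (force simp: G_def)
    have c: "card G = Suc (card {y\<in>A \<union> B. m < y})"
      unfolding G using fin by (subst card_insert_disjoint) auto
    have "m \<in> A \<longleftrightarrow> odd (card {y\<in>A \<union> B. m < y})"
      using c m by (intro less.hyps) (auto simp: G_def)
    moreover have "x \<in> A \<longleftrightarrow> m \<notin> A"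
    proof -
      have "\<not> (x \<in> A \<and> m \<in> A)"
      proof
        assume "x \<in> A \<and> m \<in> A"
        then obtain y where "y \<in> B" "x < y" "y < m" using sepA[of x m] m by (auto simp: G_def)
        thus False using m(2)[of y] by (auto simp: G_def)
      qed
      moreover have "\<not> (x \<in> B \<and> m \<in> B)"
      proof
        assume "x \<in> B \<and> m \<in> B"
        then obtain y where "y \<in> A" "x < y" "y < m" using sepB[of x m] m by (auto simp: G_def)
        thus False using m(2)[of y] by (auto simp: G_def)
      qed
      ultimately show ?thesis using less.prems m(1) disj by (auto simp: G_def)
    qed
    ultimately show ?thesis using c by (simp add: G_def)
  qed
qed

text \<open>Up to a phase and a factor common to all points, the Lagrange weight of
  \<open>cis_pt x\<close> among the points of \<open>A\<close> and \<open>B\<close>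
  together.\<close>

definition weight :: "real \<Rightarrow> real" where
  "weight x = 1 / (\<Prod>y\<in>A \<union> B - {x}. \<bar>sin (pi * (x - y))\<bar>)"

lemma abs_diff_lt_1: "x \<in> A \<union> B \<Longrightarrow> y \<in> A \<union> B \<Longrightarrow> \<bar>x - y\<bar> < 1"
proof -
  assume "x \<in> A \<union> B" "y \<in> A \<union> B"
  hence "x \<in> {0<..1}" "y \<in> {0<..1}" using sub by blast+
  thus ?thesis by auto
qed

lemma weight_pos: "x \<in> A \<union> B \<Longrightarrow> weight x > 0"
  unfolding weight_def using sgn_sin_pi_diff(2)[of x] abs_diff_lt_1[of x]
  by (intro divide_pos_pos prod_pos) auto

definition hnorm :: "real set \<Rightarrow> complex poly \<Rightarrow> real" where
  "hnorm X P = (\<Sum>x\<in>X. weight x * (norm (poly P (cis_pt x)))\<^sup>2)"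

text \<open>The form invariant under both local monodromies is definite because the
  weights of the Lagrange identity alternate in sign along the interlacing points.\<close>
lemma hnorm_eq:
  assumes deg: "degree P < card A"
  shows "hnorm A P = hnorm B P"
proof -
  define X where "X = A \<union> B"
  define r where "r = card A"
  have finX: "finite X" and cX: "card X = 2 * r"
    using fin disj card_eq by (auto simp: X_def r_def card_Un_disjoint)
  have r0: "r > 0" using deg by (simp add: r_def)
  have inj: "inj_on cis_pt X" using inj_on_cis_pt sub by (auto simp: X_def intro: inj_on_subset)
  \<comment> \<open>The reversed conjugate polynomial. On the unit circle \<open>P * Q\<close>
    equals t^(r - 1) |P t|^2, and its degree is at most 2 r - 2, just small enough for the Lagrange
    sum over 2 r points to vanish.\<close>
  define Q where "Q = (\<Sum>i\<le>r - 1. monom (cnj (coeff P i)) (r - 1 - i))"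
  have Q: "poly Q t = t ^ (r - 1) * cnj (poly P t)" if "norm t = 1" for t
  proof -
    have ct: "cnj t * t = 1" using that by (simp add: complex_norm_square[symmetric] mult.commute)
    have "P = (\<Sum>i\<le>r - 1. monom (coeff P i) i)"
      using deg r0 by (subst poly_as_sum_of_monoms') (auto simp: r_def)
    hence "poly P t = (\<Sum>i\<le>r - 1. coeff P i * t ^ i)"
      by (metis (no_types, lifting) poly_monom poly_sum sum.cong)
    hence "t ^ (r - 1) * cnj (poly P t) = (\<Sum>i\<le>r - 1. t ^ (r - 1) * (cnj (coeff P i) * cnj t ^ i))"
      by (simp add: sum_distrib_left)
    also have "\<dots> = (\<Sum>i\<le>r - 1. cnj (coeff P i) * t ^ (r - 1 - i))"
    proof (intro sum.cong refl)
      fix i assume i: "i \<in> {..r-1}"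
      have "r - 1 = (r - 1 - i) + i" using i by simp
      hence "t ^ (r - 1) = t ^ (r - 1 - i) * t ^ i" by (metis power_add)
      hence "t ^ (r - 1) * (cnj (coeff P i) * cnj t ^ i) = cnj (coeff P i) * t ^ (r - 1 - i) * (cnj t * t) ^ i"
        by (simp add: power_mult_distrib mult_ac)
      thus "t ^ (r - 1) * (cnj (coeff P i) * cnj t ^ i) = cnj (coeff P i) * t ^ (r - 1 - i)"
        by (simp add: ct)
    qed
    finally show ?thesis by (simp add: Q_def poly_sum poly_monom)
  qed
  have degQ: "degree Q \<le> r - 1" unfolding Q_def
    by (intro degree_sum_le order_trans[OF degree_monom_le]) auto
  have "(\<Sum>t\<in>cis_pt ` X. poly (P * Q) t / (\<Prod>y\<in>cis_pt ` X - {t}. t - y)) = 0"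
    using degree_mult_le[of P Q] degQ deg finX cX r0
    by (intro sum_lagrange_eq_0) (auto simp: card_image[OF inj] r_def)
  also have "(\<Sum>t\<in>cis_pt ` X. poly (P * Q) t / (\<Prod>y\<in>cis_pt ` X - {t}. t - y)) =
     (\<Sum>x\<in>X. poly (P * Q) (cis_pt x) / (\<Prod>y\<in>X - {x}. cis_pt x - cis_pt y))"
  proof (subst sum.reindex[OF inj], unfold o_def, intro sum.cong refl arg_cong2[where f = "(/)"])
    fix x assume x: "x \<in> X"
    have "cis_pt ` X - {cis_pt x} = cis_pt ` (X - {x})"
      using inj x by (auto simp: inj_on_def)
    thus "(\<Prod>y\<in>cis_pt ` X - {cis_pt x}. cis_pt x - y) = (\<Prod>y\<in>X - {x}. cis_pt x - cis_pt y)"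
      by (simp add: prod.reindex[OF inj_on_subset[OF inj]])
  qed
  finally have sum0: "(\<Sum>x\<in>X. poly (P * Q) (cis_pt x) / (\<Prod>y\<in>X - {x}. cis_pt x - cis_pt y)) = 0" .
  define C where "C = exp (- (pi * \<i> * of_real (\<Sum>X))) * (- (2 * \<i>)) ^ (2 * r - 1)"
  have C0: "C \<noteq> 0" by (simp add: C_def)
  define sg :: "real \<Rightarrow> real" where "sg x = (if x \<in> A then -1 else 1)" for x
  \<comment> \<open>The phase \<open>cis_pt x ^ (r - 1)\<close> comes both from \<open>P * Q\<close>
    and from the product of differences and cancels; beyond the real term only \<open>C\<close>
    remains, which does not depend on \<open>x\<close>.\<close>
  have termeq: "poly (P * Q) (cis_pt x) / (\<Prod>y\<in>X - {x}. cis_pt x - cis_pt y) =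
      of_real (sg x * weight x * (norm (poly P (cis_pt x)))\<^sup>2) / C" if x: "x \<in> X" for x
  proof -
    have "(\<Prod>y\<in>X - {x}. cis_pt x - cis_pt y) =
        exp (\<Sum>y\<in>X - {x}. - (pi * \<i> * of_real (x + y))) * (- (2 * \<i>)) ^ (2 * r - 1) * of_real (\<Prod>y\<in>X - {x}. sin (pi * (x - y)))"
      using finX x cX unfolding cis_pt_diff prod.distrib by (simp add: exp_sum)
    also have "(\<Sum>y\<in>X - {x}. - (pi * \<i> * of_real (x + y))) = (-pi * \<i>) * of_real (\<Sum>y\<in>X - {x}. x + y)"
      by (simp add: sum_distrib_left sum_negf)
    also have "(\<Sum>y\<in>X - {x}. x + y) = \<Sum>X + (2 * r - 2) * x"
    proof -
      have "(\<Sum>y\<in>X - {x}. x + y) = (2 * r - 1) * x + (\<Sum>X - x)"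
        using finX x cX by (simp add: sum.distrib sum_diff1)
      moreover have "real (2 * r - 1) = real (2 * r - 2) + 1" using r0 by linarith
      ultimately show ?thesis by (simp add: algebra_simps)
    qed
    also have "exp ((-pi * \<i>) * of_real (\<Sum>X + (2 * r - 2) * x)) =
        exp (- (pi * \<i> * of_real (\<Sum>X))) * cis_pt x ^ (r - 1)"
    proof -
      have "real (2 * r - 2) = 2 * real (r - 1)" using r0 by linarith
      hence "(-pi * \<i>) * of_real (\<Sum>X + (2 * r - 2) * x) = - (pi * \<i> * of_real (\<Sum>X)) + of_nat (r - 1) * (- (2 * pi * \<i> * of_real x))"
        by (simp add: algebra_simps)
      thus ?thesis by (simp only: exp_add exp_of_nat_mult cis_pt_def)
    qed
    also have "(\<Prod>y\<in>X - {x}. sin (pi * (x - y))) = (\<Prod>y\<in>X - {x}. (if x < y then -1 else 1)) * (\<Prod>y\<in>X - {x}. \<bar>sin (pi * (x - y))\<bar>)"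
      unfolding prod.distrib[symmetric] using abs_diff_lt_1[of x] x
      by (intro prod.cong refl sgn_sin_pi_diff(1)) (auto simp: X_def)
    \<comment> \<open>One sine is negative for each point larger than \<open>x\<close>, so the total
      sign is governed by \<open>parity\<close>.\<close>
    also have "(\<Prod>y\<in>X - {x}. (if x < y then -1 else 1)) = (-1 :: real) ^ card {y\<in>X. x < y}"
    proof -
      have "(\<Prod>y\<in>X - {x}. (if x < y then -1 else 1)) = (\<Prod>y\<in>{y\<in>X. x < y}. (-1::real))"
        using finX by (intro prod.mono_neutral_cong_right) auto
      thus ?thesis by simp
    qed
    also have "\<dots> = sg x"
      using parity[of x] x by (auto simp: sg_def X_def)
    also have "(\<Prod>y\<in>X - {x}. \<bar>sin (pi * (x - y))\<bar>) = 1 / weight x" by (simp add: weight_def X_def)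
    finally have *: "(\<Prod>y\<in>X - {x}. cis_pt x - cis_pt y) = C * cis_pt x ^ (r - 1) * of_real (sg x / weight x)"
      by (simp add: C_def mult_ac)
    have "poly (P * Q) (cis_pt x) = cis_pt x ^ (r - 1) * of_real ((norm (poly P (cis_pt x)))\<^sup>2)"
      unfolding complex_norm_square by (simp add: Q mult_ac)
    moreover have "sg x = 1 \<or> sg x = -1" by (simp add: sg_def)
    moreover have "weight x \<noteq> 0" using weight_pos[of x] x by (auto simp: X_def)
    ultimately show ?thesis unfolding * using C0
      by (auto simp: field_simps)
  qed
  have "of_real (\<Sum>x\<in>X. sg x * weight x * (norm (poly P (cis_pt x)))\<^sup>2) = C * (\<Sum>x\<in>X. poly (P * Q) (cis_pt x) / (\<Prod>y\<in>X - {x}. cis_pt x - cis_pt y))"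
  proof -
    have *: "(\<Sum>x\<in>X. poly (P * Q) (cis_pt x) / (\<Prod>y\<in>X - {x}. cis_pt x - cis_pt y)) =
      (\<Sum>x\<in>X. of_real (sg x * weight x * (norm (poly P (cis_pt x)))\<^sup>2) / C)"
      by (intro sum.cong refl termeq)
    show ?thesis unfolding * using C0 by (simp add: sum_divide_distrib[symmetric])
  qed
  also have "\<dots> = of_real 0" unfolding sum0 by simp
  finally have "(\<Sum>x\<in>X. sg x * weight x * (norm (poly P (cis_pt x)))\<^sup>2) = 0"
    unfolding of_real_eq_iff .
  moreover have "(\<Sum>x\<in>X. sg x * weight x * (norm (poly P (cis_pt x)))\<^sup>2) = - hnorm A P + hnorm B P"
  proof -
    have "(\<Sum>x\<in>B. sg x * weight x * (norm (poly P (cis_pt x)))\<^sup>2) = hnorm B P"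
      unfolding hnorm_def using disj by (intro sum.cong) (auto simp: sg_def)
    moreover have "(\<Sum>x\<in>A. sg x * weight x * (norm (poly P (cis_pt x)))\<^sup>2) = - hnorm A P"
      unfolding hnorm_def sum_negf[symmetric] using disj by (intro sum.cong) (auto simp: sg_def)
    ultimately show ?thesis unfolding X_def by (subst sum.union_disjoint) (use fin disj in auto)
  qed
  ultimately show ?thesis by simp
qed

end

section \<open>Integrals along vertical lines\<close>

abbreviation closed_strip :: "complex set" where
  "closed_strip \<equiv> {\<zeta>. 0 \<le> Im \<zeta> \<and> Im \<zeta> \<le> 2 * pi}"

abbreviation open_strip :: "complex set" where
  "open_strip \<equiv> {\<zeta>. 0 < Im \<zeta> \<and> Im \<zeta> < 2 * pi}"

definition vint :: "real \<Rightarrow> real \<Rightarrow> (complex \<Rightarrow> complex) \<Rightarrow> complex" where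
  "vint c T g = contour_integral (linepath (Complex c (- T)) (Complex c T)) g"

lemma vint_conv_integral: "T > 0 \<Longrightarrow> vint c T g = \<i> * integral {-T..T} (\<lambda>y. g (Complex c y))"
  unfolding vint_def by (rule contour_integral_linepath_same_Re) auto

lemma closed_segment_vline:
  "s \<in> closed_segment (Complex c a) (Complex c b) \<Longrightarrow> Re s = c"
  by (auto simp: closed_segment_same_Re)

lemma norm_vint_le:
  assumes "T > 0" "continuous_on {s. Re s = b} g" "\<gamma> \<ge> 0"
    "\<And>s. Re s = b \<Longrightarrow> \<bar>Im s\<bar> \<le> T \<Longrightarrow> norm (g s) \<le> \<gamma>"
  shows "norm (vint b T g) \<le> 2 * T * \<gamma>"
proof -
  have "norm (vint b T g) \<le> \<gamma> * norm (Complex b T - Complex b (-T))"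
    unfolding vint_def
  proof (rule contour_integral_bound_linepath)
    show "g contour_integrable_on linepath (Complex b (- T)) (Complex b T)"
      by (intro contour_integrable_continuous_linepath continuous_on_subset[OF assms(2)])
         (auto dest: closed_segment_vline)
    fix s assume "s \<in> closed_segment (Complex b (- T)) (Complex b T)"
    hence "Re s = b" "\<bar>Im s\<bar> \<le> T" using assms(1) by (auto simp: closed_segment_same_Re closed_segment_eq_real_ivl)
    thus "norm (g s) \<le> \<gamma>" by (rule assms)
  qed (use assms in auto)
  also have "Complex b T - Complex b (-T) = 2 * of_real T * \<i>" by (simp add: complex_eq_iff)
  finally show ?thesis using assms by (simp add: norm_mult mult_ac)
qed

text \<open>The vertical sides enter the residue theorem with opposite orientations; the two
  horizontal sides make up the error.\<close>

lemma rectangle_residues: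
  assumes ab: "a < b" "T > 0" and S: "open S" "connected S" and pts: "finite pts"
    and hol: "g holomorphic_on S - pts"
    and sub: "cbox (Complex a (-T)) (Complex b T) \<subseteq> S"
    and inside: "\<And>p. p \<in> pts \<Longrightarrow> a < Re p \<and> Re p < b \<and> \<bar>Im p\<bar> < T"
    and bd: "\<And>s. a \<le> Re s \<Longrightarrow> Re s \<le> b \<Longrightarrow> \<bar>Im s\<bar> = T \<Longrightarrow> norm (g s) \<le> \<beta>"
  shows "norm (vint a T g - vint b T g + 2 * pi * \<i> * (\<Sum>p\<in>pts. residue g p)) \<le> 2 * (b - a) * \<beta>"
proof -
  define a1 a2 a3 a4 where "a1 = Complex a (-T)" and "a2 = Complex b (-T)"
    and "a3 = Complex b T" and "a4 = Complex a T"
  have pi: "path_image (rectpath a1 a3) \<subseteq> S - pts"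
    using sub inside ab path_image_rectpath_subset_cbox[of a1 a3]
    by (fastforce simp: path_image_rectpath a1_def a3_def in_cbox_complex_iff)
  have img: "path_image (rectpath a1 a3) = closed_segment a1 a2 \<union> closed_segment a2 a3 \<union> closed_segment a3 a4 \<union> closed_segment a4 a1"
    by (simp add: rectpath_def Let_def path_image_join a1_def a2_def a3_def a4_def Un_assoc)
  have int: "g contour_integrable_on linepath p q" if "closed_segment p q \<subseteq> path_image (rectpath a1 a3)" for p q
    using that pi by (intro contour_integrable_continuous_linepath holomorphic_on_imp_continuous_on holomorphic_on_subset[OF hol]) auto
  have ints: "g contour_integrable_on linepath a1 a2" "g contour_integrable_on linepath a2 a3"
     "g contour_integrable_on linepath a3 a4" "g contour_integrable_on linepath a4 a1"
    by (intro int, auto simp: img)+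
  have "contour_integral (rectpath a1 a3) g = 2 * pi * \<i> * (\<Sum>p\<in>pts. winding_number (rectpath a1 a3) p * residue g p)"
  proof (rule Residue_theorem[OF S pts hol])
    show "\<forall>z. z \<notin> S \<longrightarrow> winding_number (rectpath a1 a3) z = 0"
      using sub ab by (auto intro!: winding_number_rectpath_outside simp: a1_def a3_def)
  qed (use pi in auto)
  also have "(\<Sum>p\<in>pts. winding_number (rectpath a1 a3) p * residue g p) = (\<Sum>p\<in>pts. residue g p)"
    using inside ab by (intro sum.cong refl) (subst winding_number_rectpath; force simp: a1_def a3_def in_box_complex_iff)
  also have "contour_integral (rectpath a1 a3) g = contour_integral (linepath a1 a2) g + contour_integral (linepath a2 a3) g
      + contour_integral (linepath a3 a4) g + contour_integral (linepath a4 a1) g"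
    using ints unfolding rectpath_def Let_def a1_def[symmetric] a3_def[symmetric]
    by (simp add: a2_def[symmetric] a4_def[symmetric] a1_def a3_def contour_integrable_join)
  also have "contour_integral (linepath a2 a3) g = vint b T g" by (simp add: vint_def a2_def a3_def)
  also have "contour_integral (linepath a4 a1) g = - vint a T g"
    using contour_integral_reversepath[of "linepath a1 a4" g] by (simp add: vint_def a1_def a4_def)
  finally have eq: "vint a T g - vint b T g + 2 * pi * \<i> * (\<Sum>p\<in>pts. residue g p) =
     contour_integral (linepath a1 a2) g + contour_integral (linepath a3 a4) g"
    by (simp add: algebra_simps)
  have \<beta>: "\<beta> \<ge> 0" using order_trans[OF norm_ge_zero bd[of a4]] ab by (simp add: a4_def)
  have "norm (contour_integral (linepath a1 a2) g) \<le> \<beta> * norm (a2 - a1)"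
    using ints \<beta> ab by (intro contour_integral_bound_linepath bd)
       (auto simp: a1_def a2_def closed_segment_same_Im closed_segment_eq_real_ivl)
  also have "a2 - a1 = of_real (b - a)" by (simp add: a1_def a2_def complex_eq_iff)
  finally have 1: "norm (contour_integral (linepath a1 a2) g) \<le> \<beta> * (b - a)" unfolding norm_of_real using ab by simp
  have "norm (contour_integral (linepath a3 a4) g) \<le> \<beta> * norm (a4 - a3)"
    using ints \<beta> ab by (intro contour_integral_bound_linepath bd)
       (auto simp: a3_def a4_def closed_segment_same_Im closed_segment_eq_real_ivl)
  also have "a4 - a3 = - of_real (b - a)" by (simp add: a3_def a4_def complex_eq_iff)
  finally have 2: "norm (contour_integral (linepath a3 a4) g) \<le> \<beta> * (b - a)" unfolding norm_minus_cancel norm_of_real using ab by simp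
  show ?thesis unfolding eq using norm_triangle_mono[OF 1 2] by (simp add: algebra_simps)
qed

lemma norm_integral_le_antiderivative:
  fixes f :: "real \<Rightarrow> complex"
  assumes "a \<le> b" "continuous_on {a..b} f"
    and "\<And>x. x \<in> {a..b} \<Longrightarrow> (\<Psi> has_real_derivative \<psi> x) (at x within {a..b})"
    and "\<And>x. x \<in> {a..b} \<Longrightarrow> norm (f x) \<le> \<psi> x"
  shows "norm (integral {a..b} f) \<le> \<Psi> b - \<Psi> a"
proof -
  have I: "(\<psi> has_integral (\<Psi> b - \<Psi> a)) {a..b}"
    by (rule fundamental_theorem_of_calculus)
       (use assms in \<open>auto simp: has_real_derivative_iff_has_vector_derivative\<close>)
  hence "norm (integral {a..b} f) \<le> integral {a..b} \<psi>"
    using assms by (intro integral_norm_bound_integral has_integral_integrable[OF I] integrable_continuous_interval) auto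
  thus ?thesis using I by (simp add: integral_unique)
qed

text \<open>The bound is uniform in \<zeta> apart from its natural factor
  \<open>exp (c * Re \<zeta>)\<close>, and integrable along the line even for Im \<zeta> = 0 and Im
  \<zeta> = 2 pi, the two sides of the cut.\<close>

locale vline_kernel =
  fixes G :: "complex \<Rightarrow> complex" and c K \<delta> :: real
  assumes contG: "continuous_on {s. Re s = c} G" and \<delta>: "\<delta> > 0"
    and bnd: "\<And>s \<zeta>. Re s = c \<Longrightarrow> 0 \<le> Im \<zeta> \<Longrightarrow> Im \<zeta> \<le> 2 * pi \<Longrightarrow>
       norm (G s * exp (s * \<zeta>)) \<le> K * exp (c * Re \<zeta>) * (1 + \<bar>Im s\<bar>) powr (-1 - \<delta>)"
begin

definition partial :: "nat \<Rightarrow> complex \<Rightarrow> complex" where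
  "partial n \<zeta> = vint c (real n) (\<lambda>s. G s * exp (s * \<zeta>))"

definition full :: "complex \<Rightarrow> complex" where
  "full \<zeta> = lim (\<lambda>n. partial n \<zeta>)"

lemma partial_0: "partial 0 \<zeta> = 0" by (simp add: partial_def vint_def contour_integral_trivial)

lemma partial_eq: "partial n \<zeta> = \<i> * integral {-real n..real n} (\<lambda>y. G (Complex c y) * exp (Complex c y * \<zeta>))"
proof (cases "n = 0")
  case True
  thus ?thesis by (simp add: partial_0)
next
  case False
  thus ?thesis unfolding partial_def by (subst vint_conv_integral) auto
qed

lemma cont_line: "continuous_on X (\<lambda>y. G (Complex c y))"
  by (rule continuous_on_compose2[OF contG]) (auto simp: Complex_eq intro!: continuous_intros)

lemma partial_diff:
  assumes "n \<le> m" "0 \<le> Im \<zeta>" "Im \<zeta> \<le> 2 * pi"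
  shows "norm (partial m \<zeta> - partial n \<zeta>) \<le> 2 * K / \<delta> * exp (c * Re \<zeta>) * (1 + real n) powr (-\<delta>)"
proof -
  define f where "f = (\<lambda>y. G (Complex c y) * exp (Complex c y * \<zeta>))"
  define k where "k = K * exp (c * Re \<zeta>)"
  have e: "-1 - \<delta> = - \<delta> - 1" by simp
  have K: "K \<ge> 0"
  proof -
    have "0 \<le> norm (G (Complex c 0) * exp (Complex c 0 * 0))" by simp
    also have "\<dots> \<le> K * exp (c * Re 0) * (1 + \<bar>Im (Complex c 0)\<bar>) powr (-1 - \<delta>)"
      by (rule bnd) auto
    finally show ?thesis by simp
  qed
  have contf: "continuous_on X f" for X unfolding f_def
    by (intro continuous_intros cont_line)
  have int: "f integrable_on {a..b}" for a b by (intro integrable_continuous_interval contf)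
  have fb: "norm (f y) \<le> k * (1 + \<bar>y\<bar>) powr (-1 - \<delta>)" for y
    using bnd[of "Complex c y" \<zeta>] assms by (simp add: f_def k_def)
  have 1: "norm (integral {real n..real m} f) \<le> - (k / \<delta>) * (1 + real m) powr (-\<delta>) - - (k / \<delta>) * (1 + real n) powr (-\<delta>)"
  proof (rule norm_integral_le_antiderivative[where \<Psi> = "\<lambda>y. - (k / \<delta>) * (1 + y) powr (-\<delta>)"])
    fix y assume y: "y \<in> {real n..real m}"
    show "((\<lambda>y. - (k / \<delta>) * (1 + y) powr (-\<delta>)) has_real_derivative k * (1 + y) powr (-1 - \<delta>)) (at y within {real n..real m})"
      unfolding e using y \<delta> by (auto intro!: derivative_eq_intros)
    show "norm (f y) \<le> k * (1 + y) powr (-1 - \<delta>)" using fb[of y] y by simp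
  qed (use assms contf in auto)
  have 2: "norm (integral {-real m..-real n} f) \<le> (k / \<delta>) * (1 - (-real n)) powr (-\<delta>) - (k / \<delta>) * (1 - (- real m)) powr (-\<delta>)"
  proof (rule norm_integral_le_antiderivative[where \<Psi> = "\<lambda>y. (k / \<delta>) * (1 - y) powr (-\<delta>)"])
    fix y assume y: "y \<in> {-real m..-real n}"
    show "((\<lambda>y. (k / \<delta>) * (1 - y) powr (-\<delta>)) has_real_derivative k * (1 - y) powr (-1 - \<delta>)) (at y within {-real m..-real n})"
      unfolding e using y \<delta> by (auto intro!: derivative_eq_intros)
    show "norm (f y) \<le> k * (1 - y) powr (-1 - \<delta>)" using fb[of y] y by simp
  qed (use assms contf in auto)
  have "integral {-real m..real m} f = integral {-real m..-real n} f + integral {-real n..real m} f"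
    using assms by (intro Henstock_Kurzweil_Integration.integral_combine[symmetric] int) auto
  also have "integral {-real n..real m} f = integral {-real n..real n} f + integral {real n..real m} f"
    using assms by (intro Henstock_Kurzweil_Integration.integral_combine[symmetric] int) auto
  finally have "partial m \<zeta> - partial n \<zeta> = \<i> * (integral {-real m..-real n} f + integral {real n..real m} f)"
    by (simp add: partial_eq f_def algebra_simps)
  hence "norm (partial m \<zeta> - partial n \<zeta>) \<le> norm (integral {-real m..-real n} f) + norm (integral {real n..real m} f)"
    by (simp add: norm_mult norm_triangle_ineq)
  also have "\<dots> \<le> 2 * (k / \<delta> * (1 + real n) powr (-\<delta>)) - 2 * (k / \<delta> * (1 + real m) powr (-\<delta>))"
  proof -
    define p q where "p = k / \<delta> * (1 + real n) powr (-\<delta>)" and "q = k / \<delta> * (1 + real m) powr (-\<delta>)"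
    have "norm (integral {real n..real m} f) \<le> p - q" using 1 by (simp add: p_def q_def)
    moreover have "norm (integral {-real m..-real n} f) \<le> p - q" using 2 by (simp add: p_def q_def)
    ultimately show ?thesis unfolding p_def[symmetric] q_def[symmetric] by linarith
  qed
  also have "\<dots> \<le> 2 * (k / \<delta> * (1 + real n) powr (-\<delta>))" using K \<delta> by (simp add: k_def)
  finally show ?thesis by (simp add: k_def mult_ac)
qed

lemma powr_tail: "(\<lambda>n. C * (1 + real n) powr (-\<delta>)) \<longlonglongrightarrow> 0"
proof -
  have "(\<lambda>n. (1 + real n) powr (-\<delta>)) \<longlonglongrightarrow> 0"
    using \<delta> by (intro tendsto_neg_powr filterlim_tendsto_add_at_top[OF tendsto_const] filterlim_real_sequentially) auto
  thus ?thesis by (rule tendsto_mult_right_zero)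
qed

lemma partial_tendsto:
  assumes "0 \<le> Im \<zeta>" "Im \<zeta> \<le> 2 * pi"
  shows "(\<lambda>n. partial n \<zeta>) \<longlonglongrightarrow> full \<zeta>"
proof -
  define C where "C = 2 * K / \<delta> * exp (c * Re \<zeta>)"
  have "Cauchy (\<lambda>n. partial n \<zeta>)"
  proof (rule CauchyI')
    fix e :: real assume "e > 0"
    hence "\<forall>\<^sub>F n in sequentially. norm (C * (1 + real n) powr (-\<delta>)) < e"
      using powr_tail[of C] by (simp add: tendsto_iff)
    then obtain N where N: "\<And>n. n \<ge> N \<Longrightarrow> norm (C * (1 + real n) powr (-\<delta>)) < e"
      by (auto simp: eventually_sequentially)
    show "\<exists>M. \<forall>m\<ge>M. \<forall>n>m. dist (partial m \<zeta>) (partial n \<zeta>) < e"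
    proof (intro exI[of _ N] allI impI)
      fix m n assume "m \<ge> N" "m < n"
      thus "dist (partial m \<zeta>) (partial n \<zeta>) < e"
        using le_less_trans[OF abs_ge_self N[of m, unfolded real_norm_def]] partial_diff[of m n \<zeta>] assms
        unfolding C_def by (simp add: norm_minus_commute dist_norm)
    qed
  qed
  thus ?thesis unfolding full_def by (simp add: Cauchy_convergent_iff convergent_LIMSEQ_iff)
qed

lemma full_diff:
  assumes "0 \<le> Im \<zeta>" "Im \<zeta> \<le> 2 * pi"
  shows "norm (full \<zeta> - partial n \<zeta>) \<le> 2 * K / \<delta> * exp (c * Re \<zeta>) * (1 + real n) powr (-\<delta>)"
  by (rule Lim_norm_ubound[OF _ tendsto_diff[OF partial_tendsto[OF assms] tendsto_const]])
     (use partial_diff assms in \<open>auto simp: eventually_sequentially\<close>)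

lemma norm_full_le:
  assumes "0 \<le> Im \<zeta>" "Im \<zeta> \<le> 2 * pi"
  shows "norm (full \<zeta>) \<le> 2 * K / \<delta> * exp (c * Re \<zeta>)"
  using full_diff[OF assms, of 0] by (simp add: partial_0)

lemma partial_holomorphic: "partial n holomorphic_on UNIV"
proof -
  have "(\<lambda>\<zeta>. integral (cbox (-real n) (real n)) (\<lambda>y. G (Complex c y) * exp (Complex c y * \<zeta>))) holomorphic_on UNIV"
  proof (rule leibniz_rule_holomorphic[where fx = "\<lambda>\<zeta> y. G (Complex c y) * (exp (Complex c y * \<zeta>) * Complex c y)"])
    show "((\<lambda>\<zeta>. G (Complex c t) * exp (Complex c t * \<zeta>)) has_field_derivative G (Complex c t) * (exp (Complex c t * x) * Complex c t)) (at x within UNIV)" for x t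
      by (auto intro!: derivative_eq_intros)
    show "(\<lambda>y. G (Complex c y) * exp (Complex c y * x)) integrable_on cbox (- real n) (real n)" for x
      by (intro integrable_continuous continuous_intros cont_line)
    have "continuous_on (UNIV \<times> cbox (- real n) (real n)) (\<lambda>p. G (Complex c (snd p)))"
      by (rule continuous_on_compose2[OF contG]) (auto simp: Complex_eq intro!: continuous_intros)
    thus "continuous_on (UNIV \<times> cbox (- real n) (real n)) (\<lambda>(\<zeta>, y). G (Complex c y) * (exp (Complex c y * \<zeta>) * Complex c y))"
      unfolding split_def by (intro continuous_intros) (auto simp: Complex_eq intro!: continuous_intros)
  qed auto
  hence "(\<lambda>\<zeta>. \<i> * integral (cbox (-real n) (real n)) (\<lambda>y. G (Complex c y) * exp (Complex c y * \<zeta>))) holomorphic_on UNIV"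
    by (intro holomorphic_intros)
  moreover have "partial n = (\<lambda>\<zeta>. \<i> * integral (cbox (-real n) (real n)) (\<lambda>y. G (Complex c y) * exp (Complex c y * \<zeta>)))"
    by (rule ext) (simp add: partial_eq)
  ultimately show ?thesis by simp
qed

text \<open>Multiplying by \<open>exp (- c * \<zeta>)\<close> removes the one factor of the tail
  bound that is not uniform on the unbounded strip.\<close>

lemma uniform_limit_strip:
  "uniform_limit closed_strip (\<lambda>n \<zeta>. exp (- of_real c * \<zeta>) * partial n \<zeta>) (\<lambda>\<zeta>. exp (- of_real c * \<zeta>) * full \<zeta>) sequentially"
proof (rule uniform_limitI)
  fix e :: real assume "e > 0"
  hence "\<forall>\<^sub>F n in sequentially. norm (2 * K / \<delta> * (1 + real n) powr (-\<delta>)) < e"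
    using powr_tail[of "2 * K / \<delta>"] by (simp add: tendsto_iff)
  thus "\<forall>\<^sub>F n in sequentially. \<forall>\<zeta>\<in>closed_strip.
          dist (exp (- of_real c * \<zeta>) * partial n \<zeta>) (exp (- of_real c * \<zeta>) * full \<zeta>) < e"
  proof eventually_elim
    case (elim n)
    show ?case
    proof
      fix \<zeta> assume \<zeta>: "\<zeta> \<in> closed_strip"
      have "dist (exp (- of_real c * \<zeta>) * partial n \<zeta>) (exp (- of_real c * \<zeta>) * full \<zeta>) =
         exp (- c * Re \<zeta>) * norm (full \<zeta> - partial n \<zeta>)"
        by (simp add: dist_norm norm_exp_eq_Re norm_mult[symmetric] right_diff_distrib[symmetric] norm_minus_commute flip: norm_exp_eq_Re)
           (simp add: norm_mult norm_exp_eq_Re norm_minus_commute)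
      also have "\<dots> \<le> exp (- c * Re \<zeta>) * (2 * K / \<delta> * exp (c * Re \<zeta>) * (1 + real n) powr (-\<delta>))"
        using \<zeta> by (intro mult_left_mono full_diff) auto
      also have "\<dots> = 2 * K / \<delta> * (1 + real n) powr (-\<delta>)" by (simp add: exp_minus)
      finally show "dist (exp (- of_real c * \<zeta>) * partial n \<zeta>) (exp (- of_real c * \<zeta>) * full \<zeta>) < e"
        using le_less_trans[OF abs_ge_self elim[unfolded real_norm_def]] by linarith
    qed
  qed
qed

lemma full_continuous: "continuous_on closed_strip full"
proof -
  have "continuous_on closed_strip (\<lambda>\<zeta>. exp (- of_real c * \<zeta>) * full \<zeta>)"
    using partial_holomorphic[THEN holomorphic_on_imp_continuous_on]
    by (intro uniform_limit_theorem[OF _ uniform_limit_strip] always_eventually allI continuous_intros)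
       (auto intro: continuous_on_subset)
  hence "continuous_on closed_strip (\<lambda>\<zeta>. exp (of_real c * \<zeta>) * (exp (- of_real c * \<zeta>) * full \<zeta>))"
    by (rule continuous_on_mult[rotated]) (intro continuous_intros)
  moreover have "(\<lambda>\<zeta>. exp (of_real c * \<zeta>) * (exp (- of_real c * \<zeta>) * full \<zeta>)) = full"
    by (rule ext) (simp add: exp_minus)
  ultimately show ?thesis by (simp only:)
qed

lemma full_holomorphic: "full holomorphic_on open_strip"
proof -
  have "open open_strip"
    by (intro open_Collect_conj open_halfspace_Im_gt open_halfspace_Im_lt)
  hence "(\<lambda>\<zeta>. exp (- of_real c * \<zeta>) * full \<zeta>) holomorphic_on open_strip"
  proof (rule holomorphic_uniform_sequence)
    fix n show "(\<lambda>\<zeta>. exp (- of_real c * \<zeta>) * partial n \<zeta>) holomorphic_on open_strip"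
      by (intro holomorphic_intros holomorphic_on_subset[OF partial_holomorphic]) auto
  next
    fix x assume "x \<in> open_strip"
    then obtain d where "d > 0" "cball x d \<subseteq> open_strip"
      using \<open>open _\<close> open_contains_cball by blast
    moreover from this have "uniform_limit (cball x d) (\<lambda>n \<zeta>. exp (- of_real c * \<zeta>) * partial n \<zeta>) (\<lambda>\<zeta>. exp (- of_real c * \<zeta>) * full \<zeta>) sequentially"
      by (intro uniform_limit_on_subset[OF uniform_limit_strip]) force
    ultimately show "\<exists>d>0. cball x d \<subseteq> open_strip \<and>
           uniform_limit (cball x d) (\<lambda>n \<zeta>. exp (- of_real c * \<zeta>) * partial n \<zeta>) (\<lambda>\<zeta>. exp (- of_real c * \<zeta>) * full \<zeta>) sequentially"
      by blast
  qed
  hence "(\<lambda>\<zeta>. exp (of_real c * \<zeta>) * (exp (- of_real c * \<zeta>) * full \<zeta>)) holomorphic_on open_strip"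
    by (rule holomorphic_on_mult[rotated]) (intro holomorphic_intros)
  moreover have "(\<lambda>\<zeta>. exp (of_real c * \<zeta>) * (exp (- of_real c * \<zeta>) * full \<zeta>)) = full"
    by (rule ext) (simp add: exp_minus)
  ultimately show ?thesis by (simp only:)
qed

end

section \<open>The Mellin-Barnes kernel\<close>

abbreviation e2pi :: "complex \<Rightarrow> complex" where
  "e2pi s \<equiv> exp (2 * pi * \<i> * s)"

lemma norm_exp_2pi_i: "norm (e2pi s) = exp (- 2 * pi * Im s)"
  by (simp add: norm_exp_eq_Re)

text \<open>On the line Re s = c0 the values \<open>e2pi s\<close> form a ray from the origin, and
  the hypothesis says that this ray misses \<open>cis_pt y\<close>.\<close>

lemma dist_cis_pt_line:
  assumes "c0 + y \<notin> \<int>"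
  shows "\<exists>\<kappa>>0. \<forall>s. Re s = c0 \<longrightarrow> \<kappa> * (1 + norm (e2pi s)) \<le> norm (e2pi s - cis_pt y)"
proof -
  define w where "w = exp (- (2 * pi * \<i> * of_real (c0 + y)))"
  have nw: "norm w = 1" by (simp add: w_def norm_exp_eq_Re)
  have w1: "w \<noteq> 1"
  proof
    assume "w = 1"
    then obtain n :: int where "- (2 * pi * (c0 + y)) = of_int (2 * n) * pi"
      unfolding w_def by (subst (asm) exp_eq_1) auto
    hence "pi * (c0 + y) = pi * of_int (- n)" by (simp add: algebra_simps)
    hence "c0 + y = of_int (- n)" using pi_gt_zero by (metis mult_cancel_left less_irrefl)
    thus False using assms Ints_of_int by metis
  qed
  have w2: "(Re w)\<^sup>2 + (Im w)\<^sup>2 = 1" using nw cmod_power2[of w] by simp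
  have "Re w \<noteq> 1"
  proof
    assume "Re w = 1"
    hence "w = 1" using w2 by (simp add: complex_eq_iff)
    thus False using w1 by simp
  qed
  moreover have "Re w \<le> 1" "Re w \<ge> -1" using nw abs_Re_le_cmod[of w] by auto
  ultimately have q: "Re w < 1" "Re w \<ge> -1" by auto
  \<comment> \<open>The sine of half the angle between \<open>cis_pt y\<close> and the ray;
    \<open>w\<close> is \<open>cis_pt y\<close> turned so that the ray becomes the positive
    axis.\<close>
  define \<kappa> where "\<kappa> = sqrt ((1 - Re w) / 2)"
  show ?thesis
  proof (intro exI[of _ \<kappa>] conjI allI impI)
    show "\<kappa> > 0" using q by (simp add: \<kappa>_def)
    fix s assume s: "Re s = c0"
    define \<rho> where "\<rho> = exp (- 2 * pi * Im s)"
    define e where "e = exp (2 * pi * \<i> * of_real c0)"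
    have "2 * pi * \<i> * s = of_real (- 2 * pi * Im s) + 2 * pi * \<i> * of_real c0"
      using s by (simp add: complex_eq_iff)
    hence t: "e2pi s = of_real \<rho> * e"
      unfolding \<rho>_def e_def by (simp only: exp_add exp_of_real)
    have "cis_pt y = w * e"
      unfolding w_def e_def cis_pt_def exp_add[symmetric] by (simp add: algebra_simps)
    hence "norm (e2pi s - cis_pt y) = norm ((of_real \<rho> - w) * e)"
      unfolding t by (simp add: algebra_simps)
    also have "\<dots> = norm (of_real \<rho> - w)" by (simp add: norm_mult e_def norm_exp_eq_Re)
    finally have n1: "norm (e2pi s - cis_pt y) = norm (of_real \<rho> - w)" .
    have "(norm (of_real \<rho> - w))\<^sup>2 = (\<rho> - Re w)\<^sup>2 + (Im w)\<^sup>2"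
      by (simp add: cmod_power2)
    also have "\<dots> = (1 - Re w) / 2 * (1 + \<rho>)\<^sup>2 + (1 + Re w) / 2 * (\<rho> - 1)\<^sup>2"
      using w2 by (simp add: power2_eq_square field_simps)
    finally have "(norm (of_real \<rho> - w))\<^sup>2 \<ge> (1 - Re w) / 2 * (1 + \<rho>)\<^sup>2" using q by simp
    also have "(1 - Re w) / 2 * (1 + \<rho>)\<^sup>2 = (\<kappa> * (1 + \<rho>))\<^sup>2" using q by (simp add: \<kappa>_def power_mult_distrib)
    finally have "\<kappa> * (1 + \<rho>) \<le> norm (of_real \<rho> - w)" by (rule power2_le_imp_le) simp
    thus "\<kappa> * (1 + norm (e2pi s)) \<le> norm (e2pi s - cis_pt y)"
      by (simp only: n1 norm_exp_2pi_i \<rho>_def)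
  qed
qed

text \<open>Here \<open>e2pi s\<close> has modulus at least 2 or at most 1/2; at these two values
  the difference of the moduli is exactly a third of 1 + |t|.\<close>

lemma dist_cis_pt_far:
  assumes "\<bar>Im s\<bar> \<ge> 1"
  shows "1/3 * (1 + norm (e2pi s)) \<le> norm (e2pi s - cis_pt y)"
proof -
  define n N where "n = norm (e2pi s)" and "N = norm (e2pi s - cis_pt y)"
  have n: "n = exp (- 2 * pi * Im s)" by (simp only: n_def norm_exp_2pi_i)
  have p: "exp (2 * pi) \<ge> (2::real)" using exp_ge_add_one_self[of "2 * pi"] pi_gt3 by linarith
  have *: "n - 1 \<le> N" "1 - n \<le> N"
    unfolding n_def N_def using norm_triangle_ineq2[of "e2pi s" "cis_pt y"]
      norm_triangle_ineq2[of "cis_pt y" "e2pi s"] by (simp_all add: norm_minus_commute)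
  show ?thesis
  proof (cases "Im s \<ge> 1")
    case True
    hence "n \<le> exp (- (2 * pi))" unfolding n by (subst exp_le_cancel_iff) simp
    also have "\<dots> \<le> 1 / 2" using p by (simp add: exp_minus field_simps)
    finally show ?thesis using * unfolding n_def[symmetric] N_def[symmetric] by argo
  next
    case False
    hence "Im s \<le> -1" using assms by linarith
    hence "exp (2 * pi) \<le> n" unfolding n using mult_left_mono[of 1 "- Im s" "2 * pi"] by (subst exp_le_cancel_iff) simp
    thus ?thesis using p * unfolding n_def[symmetric] N_def[symmetric] by argo
  qed
qed

lemma norm_poly_le:
  fixes P :: "complex poly"
  assumes "degree P \<le> d"
  shows "norm (poly P t) \<le> (\<Sum>i\<le>degree P. norm (coeff P i)) * (1 + norm t) ^ d"
proof -
  have "norm (poly P t) \<le> (\<Sum>i\<le>degree P. norm (coeff P i) * norm t ^ i)"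
    unfolding poly_altdef by (rule order_trans[OF norm_sum]) (simp add: norm_mult norm_power)
  also have "\<dots> \<le> (\<Sum>i\<le>degree P. norm (coeff P i) * (1 + norm t) ^ d)"
  proof (intro sum_mono mult_left_mono)
    fix i assume "i \<in> {..degree P}"
    hence "norm t ^ i \<le> (1 + norm t) ^ i" "(1 + norm t) ^ i \<le> (1 + norm t) ^ d"
      using assms by (auto intro!: power_mono power_increasing)
    thus "norm t ^ i \<le> (1 + norm t) ^ d" by linarith
  qed auto
  finally show ?thesis by (simp add: sum_distrib_right)
qed

text \<open>The exponent - Im s * Im \<zeta> lies between 0 and -2 pi Im s, so the exponential lies
  between 1 and |t|, up to the factor depending on real parts.\<close>

lemma norm_exp_strip_le:
  assumes "0 \<le> Im \<zeta>" "Im \<zeta> \<le> 2 * pi"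
  shows "norm (exp (s * \<zeta>)) \<le> exp (Re s * Re \<zeta>) * (1 + norm (e2pi s))"
proof -
  have "exp (- Im s * Im \<zeta>) \<le> 1 + exp (- 2 * pi * Im s)"
  proof (cases "Im s \<ge> 0")
    case True
    hence "exp (- Im s * Im \<zeta>) \<le> 1" using assms by simp
    thus ?thesis using exp_gt_zero[of "- 2 * pi * Im s"] by linarith
  next
    case False
    hence "- Im s * Im \<zeta> \<le> - Im s * (2 * pi)" using assms by (intro mult_left_mono) auto
    hence "exp (- Im s * Im \<zeta>) \<le> exp (- 2 * pi * Im s)" by (simp add: mult_ac)
    thus ?thesis by linarith
  qed
  moreover have "norm (exp (s * \<zeta>)) = exp (Re s * Re \<zeta>) * exp (- Im s * Im \<zeta>)"
    by (simp add: norm_exp_eq_Re exp_add[symmetric])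
  ultimately show ?thesis by (simp add: norm_exp_2pi_i)
qed

section \<open>Bounds for the Gamma quotients and the kernel\<close>

context interlacing
begin

lemma nonempty: "A \<noteq> {}" "B \<noteq> {}" and card_pos: "card A > 0"
  using one_B card_eq fin by (auto simp: card_gt_0_iff)

definition amin :: real where "amin = Min A"

text \<open>By \<open>ex_next\<close> every point of \<open>B\<close> exceeds some point of
  \<open>A\<close>, so the least parameter lies in \<open>A\<close>. This leaves the strip -
  \<open>amin\<close> < Re s < 0 free of poles of \<open>u\<close> and of zeros of the later
  denominator.\<close>

lemma amin: "amin \<in> A" "\<And>x. x \<in> A \<Longrightarrow> amin \<le> x" "0 < amin" "amin < 1" "\<And>y. y \<in> B \<Longrightarrow> amin < y"
proof -
  show 1: "amin \<in> A" and 2: "\<And>x. x \<in> A \<Longrightarrow> amin \<le> x" using nonempty fin by (auto simp: amin_def)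
  show "0 < amin" using 1 sub by auto
  obtain \<phi> where \<phi>: "bij_betw \<phi> A B" "\<forall>x\<in>A. x < \<phi> x" using ex_next by blast
  show "amin < y" if y: "y \<in> B" for y
  proof -
    obtain x where "x \<in> A" "y = \<phi> x" using \<phi>(1) y by (auto simp: bij_betw_def)
    thus ?thesis using \<phi>(2) 2[of x] by force
  qed
  from this[OF one_B] show "amin < 1" .
qed

text \<open>\<open>u n / u 0\<close> is the \<open>n\<close>-th hypergeometric coefficient; \<open>v\<close> is what the reflection formula
  makes of \<open>u\<close> in the left half-plane.\<close>
definition u :: "complex \<Rightarrow> complex" where
  "u s = (\<Prod>x\<in>A. Gamma (s + of_real x)) * (\<Prod>y\<in>B. rGamma (s + of_real y))"

definition v :: "complex \<Rightarrow> complex" where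
  "v s = (\<Prod>y\<in>B. Gamma (1 - of_real y - s)) * (\<Prod>x\<in>A. rGamma (1 - of_real x - s))"

lemma u_holomorphic: "u holomorphic_on {s. - amin < Re s}"
  unfolding u_def
proof (intro holomorphic_intros)
  fix x s assume "x \<in> A" "s \<in> {s. - amin < Re s}"
  thus "s + of_real x \<notin> \<int>\<^sub>\<le>\<^sub>0" using amin(2)[of x] by (intro not_nonpos_Int_Re) auto
qed

lemma v_holomorphic: "v holomorphic_on {s. Re s < 0}"
  unfolding v_def
proof (intro holomorphic_intros)
  fix y s assume "y \<in> B" "s \<in> {s. Re s < 0}"
  thus "1 - of_real y - s \<notin> \<int>\<^sub>\<le>\<^sub>0" using sub by (intro not_nonpos_Int_Re) force
qed

lemma u_0: "u 0 \<noteq> 0"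
proof -
  have "complex_of_real x \<notin> \<int>\<^sub>\<le>\<^sub>0" if "x \<in> A \<union> B" for x
    using that sub by (intro not_nonpos_Int_Re) auto
  thus ?thesis using fin by (auto simp: u_def Gamma_eq_zero_iff rGamma_eq_zero_iff)
qed

lemma u_nat: "u (of_nat n) / u 0 = (\<Prod>x\<in>A. pochhammer (of_real x) n) / (\<Prod>y\<in>B. pochhammer (of_real y) n)"
proof -
  have nz: "complex_of_real x \<notin> \<int>\<^sub>\<le>\<^sub>0" if "x \<in> A \<union> B" for x
    using that sub by (intro not_nonpos_Int_Re) auto
  have "(\<Prod>x\<in>A. pochhammer (complex_of_real x) n) = (\<Prod>x\<in>A. Gamma (of_nat n + of_real x)) / (\<Prod>x\<in>A. Gamma (of_real x))"
    unfolding prod_dividef[symmetric] using nz by (intro prod.cong) (auto simp: pochhammer_Gamma add_ac)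
  moreover have "(\<Prod>y\<in>B. pochhammer (complex_of_real y) n) = (\<Prod>y\<in>B. rGamma (of_real y)) / (\<Prod>y\<in>B. rGamma (of_nat n + of_real y))"
    unfolding prod_dividef[symmetric] using nz by (intro prod.cong) (auto simp: pochhammer_Gamma add_ac rGamma_inverse_Gamma field_simps)
  ultimately show ?thesis by (simp add: u_def)
qed

lemma u_conv_ratio:
  assumes "bij_betw \<phi> A B"
  shows "u s = (\<Prod>x\<in>A. Gamma (s + of_real x) / Gamma (s + of_real x + of_real (\<phi> x - x)))"
proof -
  have "(\<Prod>y\<in>B. rGamma (s + of_real y)) = (\<Prod>x\<in>A. rGamma (s + of_real (\<phi> x)))"
    using prod.reindex_bij_betw[OF assms, of "\<lambda>y. rGamma (s + of_real y)"] by simp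
  moreover have "s + of_real x + of_real (\<phi> x - x) = s + of_real (\<phi> x)" for x by simp
  ultimately show ?thesis unfolding u_def by (simp only: prod.distrib rGamma_inverse_Gamma divide_inverse)
qed

lemma v_conv_ratio:
  assumes "bij_betw \<phi> A B"
  shows "v s = (\<Prod>x\<in>A. Gamma (1 - of_real (\<phi> x) - s) / Gamma (1 - of_real (\<phi> x) - s + of_real (\<phi> x - x)))"
proof -
  have "(\<Prod>y\<in>B. Gamma (1 - of_real y - s)) = (\<Prod>x\<in>A. Gamma (1 - of_real (\<phi> x) - s))"
    using prod.reindex_bij_betw[OF assms, of "\<lambda>y. Gamma (1 - of_real y - s)"] by simp
  moreover have "1 - of_real (\<phi> x) - s + of_real (\<phi> x - x) = 1 - of_real x - s" for x by simp
  ultimately show ?thesis unfolding v_def by (simp only: prod.distrib rGamma_inverse_Gamma divide_inverse)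
qed

lemma u_bound:
  assumes "- amin < c0"
  shows "\<exists>C\<ge>0. \<forall>s. Re s \<ge> c0 \<longrightarrow> norm (u s) \<le> C"
proof -
  obtain \<phi> where \<phi>: "bij_betw \<phi> A B" "\<forall>x\<in>A. x < \<phi> x" using ex_next by blast
  define C where "C = (\<Prod>x\<in>A. Gamma (c0 + x) / Gamma (c0 + x + (\<phi> x - x)))"
  have "norm (u s) \<le> C" if "Re s \<ge> c0" for s
    unfolding u_conv_ratio[OF \<phi>(1)] prod_norm[symmetric] C_def
  proof (intro prod_mono conjI norm_Gamma_ratio_le norm_ge_zero)
    fix x assume "x \<in> A"
    thus "0 < c0 + x" "c0 + x \<le> Re (s + of_real x)" "0 \<le> \<phi> x - x"
      using assms that \<phi> amin(2)[of x] by auto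
  qed
  moreover have "C \<ge> 0" using order_trans[OF norm_ge_zero calculation[of "of_real c0"]] by simp
  ultimately show ?thesis by blast
qed

lemma v_bound:
  assumes "c0 < 0"
  shows "\<exists>C\<ge>0. \<forall>s. Re s \<le> c0 \<longrightarrow> norm (v s) \<le> C"
proof -
  obtain \<phi> where \<phi>: "bij_betw \<phi> A B" "\<forall>x\<in>A. x < \<phi> x" using ex_next by blast
  define C where "C = (\<Prod>x\<in>A. Gamma (- c0) / Gamma (- c0 + (\<phi> x - x)))"
  have "norm (v s) \<le> C" if "Re s \<le> c0" for s
    unfolding v_conv_ratio[OF \<phi>(1)] prod_norm[symmetric] C_def
  proof (intro prod_mono conjI norm_Gamma_ratio_le norm_ge_zero)
    fix x assume "x \<in> A"
    hence "\<phi> x \<in> B" using \<phi>(1) by (auto simp: bij_betw_def)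
    hence "\<phi> x \<le> 1" using sub by auto
    thus "0 < - c0" "- c0 \<le> Re (1 - of_real (\<phi> x) - s)" "0 \<le> \<phi> x - x"
      using assms that \<phi> \<open>x \<in> A\<close> by auto
  qed
  moreover have "C \<ge> 0" using order_trans[OF norm_ge_zero calculation[of "of_real c0"]] by simp
  ultimately show ?thesis by blast
qed

text \<open>One positive gap is enough: the factor of \<open>amin\<close> is estimated with its
  power decay, which gives \<open>\<delta>\<close>, and all other factors by constants.\<close>

lemma u_decay:
  assumes "- amin < c0"
  shows "\<exists>C \<delta>. C \<ge> 0 \<and> \<delta> > 0 \<and> (\<forall>s. Re s = c0 \<longrightarrow> norm (u s) \<le> C * (1 + \<bar>Im s\<bar>) powr (-\<delta>))"
proof -
  obtain \<phi> where \<phi>: "bij_betw \<phi> A B" "\<forall>x\<in>A. x < \<phi> x" using ex_next by blast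
  define R where "R x = Gamma (c0 + x) / Gamma (c0 + x + (\<phi> x - x))" for x
  define C where "C = (\<Prod>x\<in>A-{amin}. R x)"
  define \<delta> q where "\<delta> = \<phi> amin - amin" and "q = c0 + amin + \<delta>"
  have \<delta>: "\<delta> > 0" using \<phi> amin(1) by (auto simp: \<delta>_def)
  have q: "q > 0" using \<delta> assms by (simp add: q_def)
  have R: "R x \<ge> 0" if "x \<in> A" for x
    using amin(2)[OF that] assms \<phi> that unfolding R_def by (intro divide_nonneg_nonneg less_imp_le[OF Gamma_real_pos]) force+
  have C: "C \<ge> 0" unfolding C_def by (intro prod_nonneg R) auto
  have "norm (u s) \<le> C * R amin * (1 + q) powr \<delta> * (1 + \<bar>Im s\<bar>) powr (-\<delta>)" if s: "Re s = c0" for s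
  proof -
    define g where "g x = Gamma (s + of_real x) / Gamma (s + of_real x + of_real (\<phi> x - x))" for x
    have 1: "norm (u s) = norm (g amin) * (\<Prod>x\<in>A-{amin}. norm (g x))"
      unfolding u_conv_ratio[OF \<phi>(1)] prod_norm[symmetric] g_def using fin amin(1) by (simp add: prod.remove)
    have 2: "(\<Prod>x\<in>A-{amin}. norm (g x)) \<le> C" unfolding C_def R_def g_def
    proof (intro prod_mono conjI norm_Gamma_ratio_le norm_ge_zero)
      fix x assume "x \<in> A - {amin}"
      thus "0 < c0 + x" "c0 + x \<le> Re (s + of_real x)" "0 \<le> \<phi> x - x"
        using assms s \<phi> amin(2)[of x] by auto
    qed
    have "norm (g amin) \<le> R amin * (q / norm (s + of_real amin + of_real \<delta>)) powr \<delta>"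
      using norm_Gamma_ratio_le_line[of "s + of_real amin" \<delta>] s assms \<delta> by (simp add: g_def R_def \<delta>_def q_def)
    also have "R amin * (q / norm (s + of_real amin + of_real \<delta>)) powr \<delta> \<le> R amin * ((1 + q) / (1 + \<bar>Im s\<bar>)) powr \<delta>"
    proof (intro mult_left_mono powr_mono2 R amin(1))
      define \<sigma> where "\<sigma> = s + of_real amin + of_real \<delta>"
      have "q \<le> norm \<sigma>" "\<bar>Im s\<bar> \<le> norm \<sigma>"
        using complex_Re_le_cmod[of \<sigma>] abs_Im_le_cmod[of \<sigma>] s by (simp_all add: \<sigma>_def q_def)
      moreover from this have "q * (1 + \<bar>Im s\<bar>) \<le> norm \<sigma> + q * norm \<sigma>"
        using q by (simp add: distrib_left mult_left_mono add_mono)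
      moreover have "norm \<sigma> > 0" using calculation(1) q by linarith
      ultimately have "q \<le> (1 + q) * norm \<sigma> / (1 + \<bar>Im s\<bar>)"
        by (intro mult_imp_le_div_pos) (simp_all add: algebra_simps)
      hence "q \<le> (1 + q) / (1 + \<bar>Im s\<bar>) * norm \<sigma>" by (simp only: times_divide_eq_left)
      thus "q / norm (s + of_real amin + of_real \<delta>) \<le> (1 + q) / (1 + \<bar>Im s\<bar>)"
        unfolding \<sigma>_def[symmetric] using \<open>norm \<sigma> > 0\<close> by (simp only: pos_divide_le_eq)
    qed (use q \<delta> in auto)
    also have "((1 + q) / (1 + \<bar>Im s\<bar>)) powr \<delta> = (1 + q) powr \<delta> * (1 + \<bar>Im s\<bar>) powr (-\<delta>)"
      using q by (subst powr_divide) (auto simp: powr_minus divide_inverse)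
    finally have "norm (g amin) \<le> R amin * ((1 + q) powr \<delta> * (1 + \<bar>Im s\<bar>) powr (-\<delta>))" .
    hence "norm (u s) \<le> R amin * ((1 + q) powr \<delta> * (1 + \<bar>Im s\<bar>) powr (-\<delta>)) * C"
      unfolding 1 using 2 R[OF amin(1)] by (intro mult_mono prod_nonneg) auto
    thus ?thesis by (simp only: mult_ac)
  qed
  moreover have "C * R amin * (1 + q) powr \<delta> \<ge> 0" using C R[OF amin(1)] by simp
  ultimately show ?thesis using \<delta> by blast
qed

text \<open>Without the factor \<open>1 / s\<close> the integrals of these kernels against \<open>exp (s * \<zeta>)\<close> would be
  the branches of \<open>f\<close> in the coordinate \<open>\<zeta> = log z\<close>. That factor turns them into primitives with
  respect to \<open>dz / z\<close> and makes the integrals converge up to the boundary of the strip.\<close>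
definition kernel :: "complex poly \<Rightarrow> complex \<Rightarrow> complex" where
  "kernel P s = u s / (u 0 * s) * (poly P (e2pi s) / poly (cis_poly B) (e2pi s))"

text \<open>Each of the r factors of the denominator is at least \<open>\<kappa>\<close> (1 + |t|),
  while the numerator has degree at most r - 1. The spare power of 1 + |t| is what
  \<open>norm_exp_strip_le\<close> consumes.\<close>

lemma norm_poly_ratio_le:
  assumes "\<kappa> > 0" "degree P < card A"
  shows "\<exists>K\<ge>0. \<forall>t. (\<forall>y\<in>B. \<kappa> * (1 + norm t) \<le> norm (t - cis_pt y)) \<longrightarrow>
           norm (poly P t / poly (cis_poly B) t) \<le> K / (1 + norm t)"
proof -
  define K0 where "K0 = (\<Sum>i\<le>degree P. norm (coeff P i))"
  define r where "r = card B"
  have K0: "K0 \<ge> 0" by (simp add: K0_def sum_nonneg)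
  have r: "r > 0" "degree P \<le> r - 1" using assms card_eq by (auto simp: r_def)
  have "norm (poly P t / poly (cis_poly B) t) \<le> K0 / \<kappa> ^ r / (1 + norm t)"
    if t: "\<forall>y\<in>B. \<kappa> * (1 + norm t) \<le> norm (t - cis_pt y)" for t
  proof -
    have pos: "1 + norm t > 0" using norm_ge_zero[of t] by linarith
    have "(\<kappa> * (1 + norm t)) ^ r \<le> norm (poly (cis_poly B) t)"
      unfolding poly_cis_poly[OF fin(2)] prod_norm[symmetric] r_def using t pos assms
      by (subst prod_constant[symmetric]) (intro prod_mono, auto)
    moreover have "norm (poly P t) \<le> K0 * (1 + norm t) ^ (r - 1)"
      unfolding K0_def using r by (intro norm_poly_le)
    moreover have "(\<kappa> * (1 + norm t)) ^ r > 0" using assms pos by simp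
    ultimately have "norm (poly P t) / norm (poly (cis_poly B) t) \<le> K0 * (1 + norm t) ^ (r - 1) / (\<kappa> * (1 + norm t)) ^ r"
      using K0 pos by (intro frac_le) auto
    also have "(\<kappa> * (1 + norm t)) ^ r = \<kappa> ^ r * (1 + norm t) * (1 + norm t) ^ (r - 1)"
      using r(1) by (cases r) (simp_all add: power_mult_distrib)
    also have "K0 * (1 + norm t) ^ (r - 1) / (\<kappa> ^ r * (1 + norm t) * (1 + norm t) ^ (r - 1)) = K0 / \<kappa> ^ r / (1 + norm t)"
      using pos assms(1) by (simp add: divide_simps)
    finally show ?thesis by (simp add: norm_divide)
  qed
  moreover have "K0 / \<kappa> ^ r \<ge> 0" using K0 assms by simp
  ultimately show ?thesis by blast
qed

text \<open>The abscissas of the vertical lines that are free of poles of all the kernels: to the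
  right of the poles of \<open>u\<close>, off the pole at 0, off the zeros of the
  denominator.\<close>

definition good :: "real \<Rightarrow> bool" where
  "good c0 \<longleftrightarrow> - amin < c0 \<and> c0 \<noteq> 0 \<and> (\<forall>y\<in>B. c0 + y \<notin> \<int>)"

lemma good_dist:
  assumes "good c0"
  shows "\<exists>\<kappa>>0. \<forall>s. Re s = c0 \<longrightarrow> (\<forall>y\<in>B. \<kappa> * (1 + norm (e2pi s)) \<le> norm (e2pi s - cis_pt y))"
proof -
  have "\<forall>y\<in>B. \<exists>\<kappa>>0. \<forall>s. Re s = c0 \<longrightarrow> \<kappa> * (1 + norm (e2pi s)) \<le> norm (e2pi s - cis_pt y)"
    by (intro ballI dist_cis_pt_line) (use assms in \<open>simp add: good_def\<close>)
  then obtain k where k: "\<And>y. y \<in> B \<Longrightarrow> k y > 0"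
     "\<And>y s. y \<in> B \<Longrightarrow> Re s = c0 \<Longrightarrow> k y * (1 + norm (e2pi s)) \<le> norm (e2pi s - cis_pt y)"
    by metis
  show ?thesis
  proof (intro exI[of _ "Min (k ` B)"] conjI allI impI ballI)
    show "Min (k ` B) > 0" using k fin nonempty by (subst Min_gr_iff) auto
    fix s y assume s: "Re s = c0" "y \<in> B"
    have "Min (k ` B) \<le> k y" using fin s by auto
    hence "Min (k ` B) * (1 + norm (e2pi s)) \<le> k y * (1 + norm (e2pi s))"
      by (intro mult_right_mono) (auto intro: add_nonneg_nonneg)
    also note k(2)[OF s(2,1)]
    finally show "Min (k ` B) * (1 + norm (e2pi s)) \<le> norm (e2pi s - cis_pt y)" .
  qed
qed

lemma norm_ratio_exp_le:
  assumes "\<kappa> > 0" "degree P < card A"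
  shows "\<exists>K\<ge>0. \<forall>s \<zeta>. (\<forall>y\<in>B. \<kappa> * (1 + norm (e2pi s)) \<le> norm (e2pi s - cis_pt y)) \<longrightarrow>
      0 \<le> Im \<zeta> \<longrightarrow> Im \<zeta> \<le> 2 * pi \<longrightarrow>
      norm (poly P (e2pi s) / poly (cis_poly B) (e2pi s) * exp (s * \<zeta>)) \<le> K * exp (Re s * Re \<zeta>)"
proof -
  obtain K where K: "K \<ge> 0" "\<And>t. (\<forall>y\<in>B. \<kappa> * (1 + norm t) \<le> norm (t - cis_pt y)) \<Longrightarrow>
      norm (poly P t / poly (cis_poly B) t) \<le> K / (1 + norm t)"
    using norm_poly_ratio_le[OF assms] by blast
  show ?thesis
  proof (intro exI[of _ K] conjI allI impI K)
    fix s \<zeta> :: complex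
    define t where "t = e2pi s"
    assume s: "\<forall>y\<in>B. \<kappa> * (1 + norm (e2pi s)) \<le> norm (e2pi s - cis_pt y)"
      "0 \<le> Im \<zeta>" "Im \<zeta> \<le> 2 * pi"
    have pos: "1 + norm t > 0" using norm_ge_zero[of t] by linarith
    have "norm (poly P t / poly (cis_poly B) t * exp (s * \<zeta>)) \<le> K / (1 + norm t) * (exp (Re s * Re \<zeta>) * (1 + norm t))"
      unfolding norm_mult
      by (intro mult_mono norm_exp_strip_le[OF s(2,3), of s, folded t_def] K(2)[OF s(1)[folded t_def]]
            divide_nonneg_pos pos K(1) norm_ge_zero)
    thus "norm (poly P (e2pi s) / poly (cis_poly B) (e2pi s) * exp (s * \<zeta>)) \<le> K * exp (Re s * Re \<zeta>)"
      unfolding t_def[symmetric] using pos by simp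
  qed
qed

lemma kernel_line:
  assumes c0: "good c0" and P: "degree P < card A"
  shows "\<exists>K \<delta>. vline_kernel (kernel P) c0 K \<delta>"
proof -
  obtain \<kappa> where \<kappa>: "\<kappa> > 0" "\<And>s y. Re s = c0 \<Longrightarrow> y \<in> B \<Longrightarrow> \<kappa> * (1 + norm (e2pi s)) \<le> norm (e2pi s - cis_pt y)"
    using good_dist[OF c0] by blast
  obtain K where K: "K \<ge> 0" "\<And>s \<zeta>. Re s = c0 \<Longrightarrow> 0 \<le> Im \<zeta> \<Longrightarrow> Im \<zeta> \<le> 2 * pi \<Longrightarrow>
      norm (poly P (e2pi s) / poly (cis_poly B) (e2pi s) * exp (s * \<zeta>)) \<le> K * exp (c0 * Re \<zeta>)"
    using norm_ratio_exp_le[OF \<kappa>(1) P] \<kappa>(2) by blast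
  obtain C \<delta> where C: "C \<ge> 0" "\<delta> > 0" "\<And>s. Re s = c0 \<Longrightarrow> norm (u s) \<le> C * (1 + \<bar>Im s\<bar>) powr (-\<delta>)"
    using u_decay[of c0] c0 by (auto simp: good_def)
  have c00: "c0 \<noteq> 0" using c0 by (simp add: good_def)
  \<comment> \<open>Chosen so that 1 + |Im s| \<le> \<open>q\<close> |s| on the line; thus 1 / s
    supplies the exponent -1 and \<open>u\<close> supplies - \<open>\<delta>\<close>.\<close>
  define q where "q = 1 + 1 / \<bar>c0\<bar>"
  have "vline_kernel (kernel P) c0 (C * q / norm (u 0) * K) \<delta>"
  proof
    show "continuous_on {s. Re s = c0} (kernel P)"
      unfolding kernel_def
    proof -
      have "continuous_on {s. Re s = c0} u"
        using u_holomorphic[THEN holomorphic_on_imp_continuous_on]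
        by (rule continuous_on_subset) (use c0 in \<open>auto simp: good_def\<close>)
      moreover have "u 0 * s \<noteq> 0" if "Re s = c0" for s
        using c00 u_0 that by auto
      moreover have "poly (cis_poly B) (e2pi s) \<noteq> 0" if s: "Re s = c0" for s
      proof -
        have "e2pi s - cis_pt y \<noteq> 0" if "y \<in> B" for y
        proof -
          have "0 < \<kappa> * (1 + norm (e2pi s))" using \<kappa>(1) by (intro mult_pos_pos add_pos_nonneg) auto
          also have "\<dots> \<le> norm (e2pi s - cis_pt y)" using \<kappa>(2)[of s y] s that by simp
          finally show ?thesis by simp
        qed
        thus ?thesis using fin by (simp add: poly_cis_poly)
      qed
      ultimately show "continuous_on {s. Re s = c0} (\<lambda>s. u s / (u 0 * s) * (poly P (e2pi s) / poly (cis_poly B) (e2pi s)))"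
        by (intro continuous_on_mult continuous_on_divide continuous_on_poly continuous_intros) auto
    qed
    show "\<delta> > 0" by fact
    fix s \<zeta> :: complex assume s: "Re s = c0" "0 \<le> Im \<zeta>" "Im \<zeta> \<le> 2 * pi"
    have "1 + \<bar>Im s\<bar> \<le> norm s / \<bar>c0\<bar> + norm s"
      using abs_Re_le_cmod[of s] abs_Im_le_cmod[of s] s c00 by (intro add_mono) (auto simp: field_simps)
    also have "\<dots> = q * norm s" by (simp add: q_def algebra_simps)
    finally have 1: "1 + \<bar>Im s\<bar> \<le> q * norm s" .
    have s0: "norm s > 0" using s c00 by auto
    have "1 / norm s \<le> q / (1 + \<bar>Im s\<bar>)" using 1 s0 by (simp add: field_simps)
    have "norm (u s / (u 0 * s)) = norm (u s) / norm (u 0) * (1 / norm s)"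
      by (simp add: norm_divide norm_mult)
    also have "\<dots> \<le> C * (1 + \<bar>Im s\<bar>) powr (-\<delta>) / norm (u 0) * (q / (1 + \<bar>Im s\<bar>))"
      using C(3)[OF s(1)] C(1) \<open>1 / norm s \<le> _\<close>
      by (intro mult_mono divide_right_mono divide_nonneg_nonneg mult_nonneg_nonneg) auto
    also have "\<dots> = C * q / norm (u 0) * (1 + \<bar>Im s\<bar>) powr (-1 - \<delta>)"
      by (simp add: powr_diff powr_minus field_simps)
    finally have 2: "norm (u s / (u 0 * s)) \<le> C * q / norm (u 0) * (1 + \<bar>Im s\<bar>) powr (-1 - \<delta>)" .
    have "norm (kernel P s * exp (s * \<zeta>)) = norm (u s / (u 0 * s)) * norm (poly P (e2pi s) / poly (cis_poly B) (e2pi s) * exp (s * \<zeta>))"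
      unfolding kernel_def norm_mult[symmetric] by (simp only: mult.assoc)
    also have "\<dots> \<le> C * q / norm (u 0) * (1 + \<bar>Im s\<bar>) powr (-1 - \<delta>) * (K * exp (c0 * Re \<zeta>))"
      using 2 K(2)[OF s] by (intro mult_mono order_trans[OF norm_ge_zero 2]) auto
    finally show "norm (kernel P s * exp (s * \<zeta>)) \<le> C * q / norm (u 0) * K * exp (c0 * Re \<zeta>) * (1 + \<bar>Im s\<bar>) powr (- 1 - \<delta>)"
      by (simp add: mult_ac)
  qed
  thus ?thesis by blast
qed

section \<open>Branches as integrals along one vertical line\<close>

definition cc :: real where "cc = - amin / 2"

lemma cc: "- amin < cc" "cc < 0" "-1 < cc"
  using amin by (auto simp: cc_def)

lemma good_cc: "good cc"
proof -
  have "cc + y \<notin> \<int>" if "y \<in> B" for y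
  proof
    assume "cc + y \<in> \<int>"
    then obtain n :: int where n: "cc + y = of_int n" by (auto elim: Ints_cases)
    have "0 < cc + y" "cc + y < 1" using amin(3) amin(5)[OF that] sub that by (auto simp: cc_def)
    thus False unfolding n by auto
  qed
  thus ?thesis using cc by (auto simp: good_def)
qed

text \<open>The line Re s = \<open>cc\<close> lies between the poles of \<open>u\<close> and the
  pole at 0. As \<open>cc\<close> is negative, \<open>X P\<close> tends to 0 for Re \<zeta>
  \<rightarrow> \<infinity>, which fixes the constant of integration. The sign is opposite to that
  of a primitive: closing the contour of \<open>P0\<close> to the right gives minus the sum of
  residues.\<close>

definition X :: "complex poly \<Rightarrow> complex \<Rightarrow> complex" where
  "X P = vline_kernel.full (kernel P) cc"

lemma X_facts:
  assumes "degree P < card A"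
  shows X_tendsto: "\<And>\<zeta>. 0 \<le> Im \<zeta> \<Longrightarrow> Im \<zeta> \<le> 2 * pi \<Longrightarrow> (\<lambda>n. vint cc (real n) (\<lambda>s. kernel P s * exp (s * \<zeta>))) \<longlonglongrightarrow> X P \<zeta>"
    and X_continuous: "continuous_on closed_strip (X P)"
    and X_holomorphic: "X P holomorphic_on open_strip"
    and X_bound: "\<exists>K. \<forall>\<zeta>. 0 \<le> Im \<zeta> \<longrightarrow> Im \<zeta> \<le> 2 * pi \<longrightarrow> norm (X P \<zeta>) \<le> K * exp (cc * Re \<zeta>)"
proof -
  obtain K \<delta> where "vline_kernel (kernel P) cc K \<delta>" using kernel_line[OF good_cc assms] by blast
  then interpret vline_kernel "kernel P" cc K \<delta> .
  show "\<And>\<zeta>. 0 \<le> Im \<zeta> \<Longrightarrow> Im \<zeta> \<le> 2 * pi \<Longrightarrow> (\<lambda>n. vint cc (real n) (\<lambda>s. kernel P s * exp (s * \<zeta>))) \<longlonglongrightarrow> X P \<zeta>"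
    unfolding X_def partial_def[symmetric] by (rule partial_tendsto)
  show "continuous_on closed_strip (X P)" unfolding X_def by (rule full_continuous)
  show "X P holomorphic_on open_strip" unfolding X_def by (rule full_holomorphic)
  show "\<exists>K. \<forall>\<zeta>. 0 \<le> Im \<zeta> \<longrightarrow> Im \<zeta> \<le> 2 * pi \<longrightarrow> norm (X P \<zeta>) \<le> K * exp (cc * Re \<zeta>)"
    unfolding X_def using norm_full_le by blast
qed

end

section \<open>Monodromy around zero and infinity\<close>

lemma cis_pt_1 [simp]: "cis_pt 1 = 1"
  by (simp add: cis_pt_def exp_minus)

lemma exp_2pi_i_minus_cis_pt:
  fixes s :: complex
  shows "e2pi s - cis_pt x = exp (pi * \<i> * s) * exp (- (pi * \<i> * of_real x)) * (2 * \<i>) * sin (of_real pi * (s + of_real x))"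
proof -
  have 1: "e2pi s = exp (pi * \<i> * s) * exp (- (pi * \<i> * of_real x)) * exp (\<i> * (pi * (s + of_real x)))"
    unfolding exp_add[symmetric] by (simp add: algebra_simps)
  have 2: "cis_pt x = exp (pi * \<i> * s) * exp (- (pi * \<i> * of_real x)) * exp (- (\<i> * (pi * (s + of_real x))))"
    unfolding exp_add[symmetric] cis_pt_def by (simp add: algebra_simps)
  show ?thesis unfolding 1 2 sin_exp_eq by (simp add: field_simps)
qed

lemma exp_2pi_i_eq_cis_pt_iff:
  fixes s :: complex
  shows "e2pi s = cis_pt x \<longleftrightarrow> (\<exists>n::int. s = of_int n - of_real x)"
proof
  assume "e2pi s = cis_pt x"
  hence "sin (pi * (s + of_real x)) = 0" using exp_2pi_i_minus_cis_pt[of s x] by simp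
  then obtain n :: int where "of_real pi * (s + of_real x) = of_real (of_int n * pi)"
    by (auto simp: sin_eq_0)
  hence "of_real pi * (s + of_real x) = of_real pi * of_int n" by (simp add: mult_ac)
  hence "s + of_real x = of_int n" by (simp only: mult_cancel_left) simp
  thus "\<exists>n::int. s = of_int n - of_real x" by (intro exI[of _ n]) (simp add: algebra_simps)
next
  assume "\<exists>n::int. s = of_int n - of_real x"
  then obtain n :: int where n: "s = of_int n - of_real x" by blast
  have "e2pi s = exp (of_int (2 * n) * pi * \<i>) * cis_pt x"
    unfolding n cis_pt_def exp_add[symmetric] by (simp add: algebra_simps)
  also have "exp (of_int (2 * n) * pi * \<i>) = 1" by (subst exp_eq_1) (auto intro!: exI[of _ n])
  finally show "e2pi s = cis_pt x" by simp
qed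

text \<open>The reciprocal of the difference quotient of \<open>e2pi\<close> at 0, with the
  removable singularity filled in. It isolates the pole of 1 / (e2pi s - 1) at an integer.\<close>

definition qfun :: "complex \<Rightarrow> complex" where
  "qfun w = (if w = 0 then 1 / (2 * pi * \<i>) else w / (exp (2 * pi * \<i> * w) - 1))"

lemma qfun_holomorphic: "qfun holomorphic_on ball 0 1"
proof -
  define e where "e w = exp (2 * pi * \<i> * w)" for w :: complex
  define D where "D w = (if w = 0 then deriv e 0 else (e w - e 0) / (w - 0))" for w
  have "(e has_field_derivative 2 * pi * \<i>) (at 0)" unfolding e_def
    by (auto intro!: derivative_eq_intros)
  hence d: "deriv e 0 = 2 * pi * \<i>" by (rule DERIV_imp_deriv)
  have "e holomorphic_on ball 0 1" unfolding e_def by (intro holomorphic_intros)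
  hence "D holomorphic_on ball 0 1" unfolding D_def by (rule pole_lemma_open) auto
  moreover have "D w \<noteq> 0" if w: "w \<in> ball 0 1" for w
  proof (cases "w = 0")
    case False
    have "e w \<noteq> cis_pt 1"
    proof
      assume "e w = cis_pt 1"
      then obtain n :: int where n: "w = of_int n - 1"
        unfolding e_def exp_2pi_i_eq_cis_pt_iff by auto
      hence "w = of_int (n - 1)" by simp
      hence "norm w = \<bar>of_int (n - 1)\<bar>" by (metis norm_of_int)
      with w False \<open>w = of_int (n - 1)\<close> show False by auto
    qed
    thus ?thesis using False by (simp add: D_def e_def)
  qed (simp add: D_def d)
  ultimately have "(\<lambda>w. 1 / D w) holomorphic_on ball 0 1" by (intro holomorphic_intros) auto
  moreover have "(\<lambda>w. 1 / D w) = qfun"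
    by (rule ext) (simp add: D_def d qfun_def e_def)
  ultimately show ?thesis by simp
qed

text \<open>The double pole is the source of the logarithm: differentiating the exponential brings
  down \<zeta>.\<close>

lemma residue_exp_over_square:
  assumes "open U" "0 \<in> U" "h holomorphic_on U"
  shows "residue (\<lambda>s. h s * exp (s * \<zeta>) / s\<^sup>2) 0 = deriv h 0 + \<zeta> * h 0"
proof -
  have "residue (\<lambda>s. (h s * exp (s * \<zeta>)) / s ^ Suc 1) 0 = (deriv ^^ 1) (\<lambda>s. h s * exp (s * \<zeta>)) 0 / fact 1"
    using assms by (intro residue_holomorphic_over_power'[of U] holomorphic_intros) auto
  also have "(deriv ^^ 1) (\<lambda>s. h s * exp (s * \<zeta>)) 0 = deriv h 0 + \<zeta> * h 0"
  proof -
    have "(h has_field_derivative deriv h 0) (at 0)" using assms by (intro holomorphic_derivI)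
    hence "((\<lambda>s. h s * exp (s * \<zeta>)) has_field_derivative deriv h 0 + \<zeta> * h 0) (at 0)"
      by (auto intro!: derivative_eq_intros)
    thus ?thesis by (simp add: DERIV_imp_deriv)
  qed
  finally show ?thesis by (simp add: power2_eq_square)
qed

lemma exp_tail_tendsto:
  assumes "\<xi> < (0::real)"
  shows "(\<lambda>M. C * real M * exp (real M * \<xi>)) \<longlonglongrightarrow> 0"
proof -
  have "norm (exp \<xi>) < 1" using assms by simp
  hence "(\<lambda>M. real M * exp \<xi> ^ M) \<longlonglongrightarrow> 0" by (rule powser_times_n_limit_0)
  hence "(\<lambda>M. C * (real M * exp \<xi> ^ M)) \<longlonglongrightarrow> 0" by (rule tendsto_mult_right_zero)
  thus ?thesis by (simp add: exp_of_nat_mult mult.assoc)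
qed

lemma inverse_tail_tendsto: "(\<lambda>M. C / real M) \<longlonglongrightarrow> 0"
  using lim_const_over_n[of C] by simp

lemma strip_open_connected:
  "open {s. a < Re s}" "connected {s. a < Re s}" "open {s. Re s < b}" "connected {s. Re s < b}"
  "open {s. a < Re s \<and> Re s < b}" "connected {s. a < Re s \<and> Re s < b}"
proof -
  show "open {s. a < Re s}" "open {s. Re s < b}" by (auto intro: open_halfspace_Re_gt open_halfspace_Re_lt)
  thus "open {s. a < Re s \<and> Re s < b}" by (intro open_Collect_conj)
  show "connected {s. a < Re s}" "connected {s. Re s < b}"
    by (intro convex_connected convex_halfspace_Re_gt convex_halfspace_Re_lt)+
  have "convex ({s. a < Re s} \<inter> {s. Re s < b})"
    by (intro convex_Int convex_halfspace_Re_gt convex_halfspace_Re_lt)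
  thus "connected {s. a < Re s \<and> Re s < b}" by (intro convex_connected) (simp add: Int_def conj_commute)
qed

text \<open>The integrand only decays like \<open>1 / \<bar>s\<bar>\<close>, hence rectangles of width \<open>M\<close> and height \<open>M\<^sup>2\<close>.\<close>
lemma close_left:
  assumes h: "h holomorphic_on {s. Re s < 0}" and C: "\<And>s. Re s \<le> c \<Longrightarrow> norm (h s) \<le> C"
    and c: "c < 0" and \<xi>: "\<xi> > 0"
  shows "(\<lambda>M. vint c (real (M\<^sup>2)) (\<lambda>s. h s / s * exp (s * of_real \<xi>))) \<longlonglongrightarrow> 0"
proof (rule Lim_null_comparison)
  show "\<forall>\<^sub>F M in sequentially. norm (vint c (real (M\<^sup>2)) (\<lambda>s. h s / s * exp (s * of_real \<xi>))) \<le>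
     2 * C / real M + 2 * C * real M * exp (real M * - \<xi>)"
  proof (rule eventually_mono[OF eventually_gt_at_top[of 0]])
    fix M :: nat assume M: "M > 0"
    define T where "T = real (M\<^sup>2)"
    define g where "g = (\<lambda>s. h s / s * exp (s * of_real \<xi>))"
    have C0: "C \<ge> 0" using order_trans[OF norm_ge_zero C[of "of_real c"]] by simp
    have T: "T > 0" using M by (simp add: T_def)
    have g: "g holomorphic_on {s. Re s < 0}" unfolding g_def using h by (intro holomorphic_intros) auto
    have gb: "norm (g s) \<le> C / d * exp (Re s * \<xi>)" if "norm s \<ge> d" "d > 0" "Re s \<le> c" for s d
      unfolding g_def norm_mult norm_divide norm_exp_eq_Re using that C0 C[OF that(3)]
      by (auto intro!: mult_mono frac_le)
    have 1: "norm (vint (c - M) T g - vint c T g + 2 * pi * \<i> * (\<Sum>p\<in>{}. residue g p)) \<le> 2 * (c - (c - M)) * (C / T)"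
    proof (rule rectangle_residues[where S = "{s. Re s < 0}"])
      show "cbox (Complex (c - real M) (- T)) (Complex c T) \<subseteq> {s. Re s < 0}"
        using c by (auto simp: in_cbox_complex_iff)
      fix s assume s: "c - real M \<le> Re s" "Re s \<le> c" "\<bar>Im s\<bar> = T"
      have "norm (g s) \<le> C / T * exp (Re s * \<xi>)"
        using gb[of T s] abs_Im_le_cmod[of s] s T by simp
      also have "\<dots> \<le> C / T * 1" using s c \<xi> C0 T by (intro mult_left_mono) (auto simp: mult_nonpos_nonneg)
      finally show "norm (g s) \<le> C / T" by simp
    qed (use M T g in \<open>auto simp: strip_open_connected\<close>)
    have 2: "norm (vint (c - M) T g) \<le> 2 * T * (C / M * exp (- M * \<xi>))"
    proof (rule norm_vint_le)
      show "continuous_on {s. Re s = c - M} g"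
        using g by (intro holomorphic_on_imp_continuous_on) (rule holomorphic_on_subset, use c in auto)
      fix s assume s: "Re s = c - M"
      have "norm (g s) \<le> C / M * exp (Re s * \<xi>)"
        using gb[of M s] abs_Re_le_cmod[of s] s c M by simp
      also have "C / M * exp (Re s * \<xi>) \<le> C / M * exp (- M * \<xi>)"
      proof -
        have "Re s * \<xi> \<le> - M * \<xi>" using s c \<xi> by (intro mult_right_mono) auto
        thus ?thesis using C0 by (intro mult_left_mono) auto
      qed
      finally show "norm (g s) \<le> C / M * exp (- M * \<xi>)" .
    qed (use T C0 in auto)
    have "norm (vint c T g) \<le> norm (vint (c - M) T g) + norm (vint (c - M) T g - vint c T g)"
      by (metis norm_minus_commute norm_triangle_sub add.commute)
    also have "\<dots> \<le> 2 * T * (C / M * exp (- M * \<xi>)) + 2 * M * (C / T)" using 1 2 by simp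
    also have "\<dots> = 2 * C / real M + 2 * C * real M * exp (real M * - \<xi>)"
      using M by (simp add: T_def power2_eq_square field_simps)
    finally show "norm (vint c (real (M\<^sup>2)) (\<lambda>s. h s / s * exp (s * of_real \<xi>))) \<le>
       2 * C / real M + 2 * C * real M * exp (real M * - \<xi>)" by (simp only: g_def T_def)
  qed
  show "(\<lambda>M. 2 * C / real M + 2 * C * real M * exp (real M * - \<xi>)) \<longlonglongrightarrow> 0"
    using tendsto_add[OF inverse_tail_tendsto[of "2 * C"] exp_tail_tendsto[of "-\<xi>" "2 * C"]] \<xi> by simp
qed

text \<open>The counterpart of \<open>close_left\<close>: for \<xi> < 0 the integrand decays to the
  right, and on the way the line crosses the simple pole at 0, whose residue is the limit up to the
  factor -2 pi i.\<close>

lemma close_right: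
  assumes h: "h holomorphic_on {s. c' < Re s}" and C: "\<And>s. Re s \<ge> c \<Longrightarrow> norm (h s) \<le> C"
    and c: "c' < c" "c < 0" and \<xi>: "\<xi> < 0"
  shows "(\<lambda>M. vint c (real (M\<^sup>2)) (\<lambda>s. h s / s * exp (s * of_real \<xi>))) \<longlonglongrightarrow> - (2 * pi * \<i>) * h 0"
proof (rule Lim_transform2)
  define g where "g = (\<lambda>s. h s / s * exp (s * of_real \<xi>))"
  define E where "E = exp (c * \<xi>)"
  show "(\<lambda>M. - (2 * pi * \<i>) * h 0) \<longlonglongrightarrow> - (2 * pi * \<i>) * h 0" by simp
  show "(\<lambda>M. - (2 * pi * \<i>) * h 0 - vint c (real (M\<^sup>2)) (\<lambda>s. h s / s * exp (s * of_real \<xi>))) \<longlonglongrightarrow> 0"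
  proof (rule Lim_null_comparison)
    show "\<forall>\<^sub>F M in sequentially. norm (- (2 * pi * \<i>) * h 0 - vint c (real (M\<^sup>2)) (\<lambda>s. h s / s * exp (s * of_real \<xi>))) \<le>
       2 * (1 - c) * C * E / real M + 2 * C * real M * exp (real M * \<xi>)"
    proof (rule eventually_mono[OF eventually_gt_at_top[of 0]])
      fix M :: nat assume M: "M > 0"
      define T where "T = real (M\<^sup>2)"
      have C0: "C \<ge> 0" using order_trans[OF norm_ge_zero C[of "of_real c"]] by simp
      have T: "T > 0" using M by (simp add: T_def)
      have g: "g holomorphic_on {s. c' < Re s} - {0}" unfolding g_def using holomorphic_on_subset[OF h] by (intro holomorphic_intros) auto
      have res: "residue g 0 = h 0"
      proof -
        have "residue (\<lambda>s. (h s * exp (s * of_real \<xi>)) / (s - 0)) 0 = h 0 * exp (0 * of_real \<xi>)"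
          using h c by (intro residue_simple[of "{s. c' < Re s}"] holomorphic_intros strip_open_connected) auto
        thus ?thesis by (simp add: g_def)
      qed
      have gb: "norm (g s) \<le> C / d * exp (Re s * \<xi>)" if "norm s \<ge> d" "d > 0" "Re s \<ge> c" for s d
        unfolding g_def norm_mult norm_divide norm_exp_eq_Re using that C0 C[OF that(3)]
        by (auto intro!: mult_mono frac_le)
      have 1: "norm (vint c T g - vint M T g + 2 * pi * \<i> * (\<Sum>p\<in>{0}. residue g p)) \<le> 2 * (M - c) * (C / T * E)"
      proof (rule rectangle_residues[where S = "{s. c' < Re s}"])
        show "cbox (Complex c (- T)) (Complex M T) \<subseteq> {s. c' < Re s}"
          using c by (auto simp: in_cbox_complex_iff)
        fix s assume s: "c \<le> Re s" "Re s \<le> M" "\<bar>Im s\<bar> = T"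
        have "norm (g s) \<le> C / T * exp (Re s * \<xi>)"
          using gb[of T s] abs_Im_le_cmod[of s] s T by simp
        also have "\<dots> \<le> C / T * E" unfolding E_def using s \<xi> C0 T by (intro mult_left_mono) (auto simp: mult_right_mono_neg)
        finally show "norm (g s) \<le> C / T * E" by simp
      qed (use M T g c in \<open>auto simp: strip_open_connected\<close>)
      have 2: "norm (vint M T g) \<le> 2 * T * (C / M * exp (M * \<xi>))"
      proof (rule norm_vint_le)
        show "continuous_on {s. Re s = M} g"
          using g by (intro holomorphic_on_imp_continuous_on) (rule holomorphic_on_subset, use c M in auto)
        fix s assume s: "Re s = M"
        show "norm (g s) \<le> C / M * exp (M * \<xi>)"
          using gb[of M s] abs_Re_le_cmod[of s] s c M by simp
      qed (use T C0 in auto)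
      have "norm (- (2 * pi * \<i>) * h 0 - vint c T g) \<le> norm (vint M T g) + norm (vint c T g - vint M T g + 2 * pi * \<i> * h 0)"
      proof -
        have "norm (- (2 * pi * \<i>) * h 0 - vint c T g) = norm (vint M T g + (vint c T g - vint M T g + 2 * pi * \<i> * h 0))"
          by (subst norm_minus_cancel[symmetric]) (simp add: algebra_simps)
        thus ?thesis using norm_triangle_ineq by metis
      qed
      also have "\<dots> \<le> 2 * T * (C / M * exp (M * \<xi>)) + 2 * (M - c) * (C / T * E)" using 1 2 by (simp add: res)
      also have "2 * (M - c) * (C / T * E) \<le> 2 * ((1 - c) * M) * (C / T * E)"
        using M c C0 T by (intro mult_right_mono mult_left_mono) (auto simp: E_def algebra_simps mult_le_cancel_left1)
      also have "2 * T * (C / M * exp (M * \<xi>)) + 2 * ((1 - c) * M) * (C / T * E) = 2 * (1 - c) * C * E / real M + 2 * C * real M * exp (real M * \<xi>)"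
        using M by (simp add: T_def power2_eq_square field_simps)
      finally show "norm (- (2 * pi * \<i>) * h 0 - vint c (real (M\<^sup>2)) (\<lambda>s. h s / s * exp (s * of_real \<xi>))) \<le>
         2 * (1 - c) * C * E / real M + 2 * C * real M * exp (real M * \<xi>)" by (simp add: g_def T_def)
    qed
    show "(\<lambda>M. 2 * (1 - c) * C * E / real M + 2 * C * real M * exp (real M * \<xi>)) \<longlonglongrightarrow> 0"
      using tendsto_add[OF inverse_tail_tendsto[of "2 * (1 - c) * C * E"] exp_tail_tendsto[of \<xi> "2 * C"]] \<xi> by simp
  qed
qed

lemma strict_mono_square: "strict_mono (\<lambda>M::nat. M\<^sup>2)"
  by (intro strict_monoI) (simp add: power_strict_mono)

context interlacing
begin

text \<open>Multiplication by \<open>t\<close> modulo a characteristic polynomial: analytic continuation once around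
  infinity (\<open>Y = A\<close>) or around zero (\<open>Y = B\<close>).\<close>
definition mono_step :: "real set \<Rightarrow> complex poly \<Rightarrow> complex poly" where
  "mono_step Y P = pCons 0 P - smult (coeff P (card A - 1)) (cis_poly Y)"

lemma degree_mono_step:
  assumes "Y = A \<or> Y = B" "degree P < card A"
  shows "degree (mono_step Y P) < card A"
proof (rule degree_lessI)
  show "mono_step Y P \<noteq> 0 \<or> card A > 0" using card_pos by simp
  have finY: "finite Y" and cY: "card Y = card A" using assms fin card_eq by auto
  have lc: "coeff (cis_poly Y) (card A) = 1"
    using lead_coeff_cis_poly[of Y] degree_cis_poly[OF finY] cY by simp
  show "\<forall>k\<ge>card A. coeff (mono_step Y P) k = 0"
  proof (intro allI impI)
    fix k assume k: "k \<ge> card A"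
    show "coeff (mono_step Y P) k = 0"
    proof (cases "k = card A")
      case True
      thus ?thesis using card_pos lc by (cases "card A") (auto simp: mono_step_def)
    next
      case False
      hence "coeff (cis_poly Y) k = 0" using k cY degree_cis_poly[OF finY] by (intro coeff_eq_0) simp
      moreover have "coeff (pCons 0 P) k = 0" using k False assms(2) by (cases k) (auto intro: coeff_eq_0)
      ultimately show ?thesis by (simp add: mono_step_def)
    qed
  qed
qed

lemma poly_mono_step: "poly (mono_step Y P) t = t * poly P t - coeff P (card A - 1) * poly (cis_poly Y) t"
  by (simp add: mono_step_def)

definition kap :: complex where
  "kap = (\<Prod>x\<in>A. exp (- (pi * \<i> * of_real x))) / (\<Prod>y\<in>B. exp (- (pi * \<i> * of_real y)))"

text \<open>Each t - \<open>cis_pt x\<close> is a sine up to a phase, and the reflection formula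
  moves its Gamma factor to the argument 1 - x - s. As \<open>A\<close> and \<open>B\<close> have
  equally many points, the powers of \<open>w\<close> agree. The right-hand side trades
  \<open>u\<close> for \<open>v\<close>, which is bounded to the left.\<close>

lemma u_reflect:
  assumes "- amin < Re s" "Re s < 0"
  shows "u s * poly (cis_poly A) (e2pi s) = kap * v s * poly (cis_poly B) (e2pi s)"
proof -
  define t where "t = e2pi s"
  define w where "w = exp (pi * \<i> * s) * (2 * \<i>) * pi"
  define eA where "eA = (\<Prod>x\<in>A. exp (- (pi * \<i> * of_real x)))"
  define eB where "eB = (\<Prod>y\<in>B. exp (- (pi * \<i> * of_real y)))"
  have sn: "sin (of_real pi * z) = pi * rGamma z * rGamma (1 - z)" for z :: complex
    using rGamma_reflection_complex[of z] by (simp add: field_simps)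
  have "(\<Prod>x\<in>A. Gamma (s + of_real x)) * poly (cis_poly A) t = (\<Prod>x\<in>A. w * exp (- (pi * \<i> * of_real x)) * rGamma (1 - of_real x - s))"
    unfolding poly_cis_poly[OF fin(1)] prod.distrib[symmetric]
  proof (intro prod.cong refl)
    fix x assume x: "x \<in> A"
    have "s + of_real x \<notin> \<int>\<^sub>\<le>\<^sub>0" using amin(2)[OF x] assms by (intro not_nonpos_Int_Re) auto
    hence "Gamma (s + of_real x) * rGamma (s + of_real x) = 1" by (simp add: rGamma_inverse_Gamma Gamma_eq_zero_iff)
    moreover have "Gamma (s + of_real x) * (t - cis_pt x) = (Gamma (s + of_real x) * rGamma (s + of_real x)) *
        (w * exp (- (pi * \<i> * of_real x)) * rGamma (1 - (s + of_real x)))"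
      unfolding t_def exp_2pi_i_minus_cis_pt sn w_def by (simp only: mult_ac)
    moreover have "1 - (s + of_real x) = 1 - of_real x - s" by simp
    ultimately show "Gamma (s + of_real x) * (t - cis_pt x) = w * exp (- (pi * \<i> * of_real x)) * rGamma (1 - of_real x - s)"
      by (simp only: mult_1_left)
  qed
  also have "\<dots> = w ^ card A * eA * (\<Prod>x\<in>A. rGamma (1 - of_real x - s))"
    by (simp add: prod.distrib eA_def)
  finally have 1: "(\<Prod>x\<in>A. Gamma (s + of_real x)) * poly (cis_poly A) t = w ^ card A * eA * (\<Prod>x\<in>A. rGamma (1 - of_real x - s))" .
  have "(\<Prod>y\<in>B. Gamma (1 - of_real y - s)) * poly (cis_poly B) t = (\<Prod>y\<in>B. w * exp (- (pi * \<i> * of_real y)) * rGamma (s + of_real y))"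
    unfolding poly_cis_poly[OF fin(2)] prod.distrib[symmetric]
  proof (intro prod.cong refl)
    fix y assume y: "y \<in> B"
    have "1 - of_real y - s \<notin> \<int>\<^sub>\<le>\<^sub>0" using sub y assms by (intro not_nonpos_Int_Re) force
    hence "Gamma (1 - of_real y - s) * rGamma (1 - of_real y - s) = 1" by (simp add: rGamma_inverse_Gamma Gamma_eq_zero_iff)
    moreover have eq: "1 - (s + of_real y) = 1 - of_real y - s" by simp
    moreover have "Gamma (1 - of_real y - s) * (t - cis_pt y) = (Gamma (1 - of_real y - s) * rGamma (1 - of_real y - s)) *
        (w * exp (- (pi * \<i> * of_real y)) * rGamma (s + of_real y))"
      unfolding t_def exp_2pi_i_minus_cis_pt sn w_def eq by (simp only: mult_ac)
    ultimately show "Gamma (1 - of_real y - s) * (t - cis_pt y) = w * exp (- (pi * \<i> * of_real y)) * rGamma (s + of_real y)"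
      by (simp only: mult_1_left)
  qed
  also have "\<dots> = w ^ card A * eB * (\<Prod>y\<in>B. rGamma (s + of_real y))"
    by (simp add: prod.distrib eB_def card_eq)
  finally have 2: "(\<Prod>y\<in>B. Gamma (1 - of_real y - s)) * poly (cis_poly B) t = w ^ card A * eB * (\<Prod>y\<in>B. rGamma (s + of_real y))" .
  have eB0: "eB \<noteq> 0" using fin by (simp add: eB_def)
  have "u s * poly (cis_poly A) t = w ^ card A * eA * (\<Prod>x\<in>A. rGamma (1 - of_real x - s)) * (\<Prod>y\<in>B. rGamma (s + of_real y))"
    unfolding u_def 1[symmetric] by (simp only: mult_ac)
  moreover have "v s * poly (cis_poly B) t = w ^ card A * eB * (\<Prod>y\<in>B. rGamma (s + of_real y)) * (\<Prod>x\<in>A. rGamma (1 - of_real x - s))"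
    unfolding v_def 2[symmetric] by (simp only: mult_ac)
  moreover have "kap = eA / eB" by (simp add: kap_def eA_def eB_def)
  ultimately show ?thesis unfolding t_def[symmetric] using eB0 by (simp add: field_simps)
qed

lemma cis_poly_B_nz:
  assumes "good c0" "Re s = c0"
  shows "poly (cis_poly B) (e2pi s) \<noteq> 0"
proof -
  have "e2pi s - cis_pt y \<noteq> 0" if y: "y \<in> B" for y
  proof
    assume "e2pi s - cis_pt y = 0"
    then obtain n :: int where "s = of_int n - of_real y"
      using exp_2pi_i_eq_cis_pt_iff[THEN iffD1] by (metis right_minus_eq)
    hence "c0 + y = of_int n" using assms by auto
    thus False using assms y by (auto simp: good_def)
  qed
  thus ?thesis using fin by (simp add: poly_cis_poly)
qed

lemma vint_cong: "(\<And>s. Re s = c \<Longrightarrow> f s = g s) \<Longrightarrow> vint c T f = vint c T g"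
  unfolding vint_def by (rule contour_integral_eq) (auto dest: closed_segment_vline)

lemma vint_add_cmult:
  assumes "continuous_on {s. Re s = c} f" "continuous_on {s. Re s = c} g"
  shows "vint c T (\<lambda>s. f s + a * g s) = vint c T f + a * vint c T g"
proof -
  have "f contour_integrable_on (linepath (Complex c (-T)) (Complex c T))" "g contour_integrable_on (linepath (Complex c (-T)) (Complex c T))"
    by (intro contour_integrable_continuous_linepath continuous_on_subset[OF assms(1)] continuous_on_subset[OF assms(2)]; auto dest: closed_segment_vline)+
  thus ?thesis unfolding vint_def by (simp add: contour_integral_add contour_integrable_lmul contour_integral_lmul)
qed

lemma kernel_continuous: "good c0 \<Longrightarrow> degree P < card A \<Longrightarrow> continuous_on {s. Re s = c0} (kernel P)"
  using kernel_line vline_kernel.contG by blast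

lemma X_subseq:
  assumes "degree P < card A" "0 \<le> Im \<zeta>" "Im \<zeta> \<le> 2 * pi"
  shows "(\<lambda>M. vint cc (real (M\<^sup>2)) (\<lambda>s. kernel P s * exp (s * \<zeta>))) \<longlonglongrightarrow> X P \<zeta>"
  using LIMSEQ_subseq_LIMSEQ[OF X_tendsto[OF assms] strict_mono_square] by (simp add: o_def)

lemma X_add_smult:
  assumes "degree P < card A" "degree Q < card A" "0 \<le> Im \<zeta>" "Im \<zeta> \<le> 2 * pi"
  shows "X (P + smult a Q) \<zeta> = X P \<zeta> + a * X Q \<zeta>"
proof -
  have "degree (P + smult a Q) < card A" using assms by (intro degree_add_less le_less_trans[OF degree_smult_le]) auto
  hence "(\<lambda>n. vint cc (real n) (\<lambda>s. kernel (P + smult a Q) s * exp (s * \<zeta>))) \<longlonglongrightarrow> X (P + smult a Q) \<zeta>"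
    using assms by (intro X_tendsto)
  moreover have "vint cc (real n) (\<lambda>s. kernel (P + smult a Q) s * exp (s * \<zeta>)) =
     vint cc (real n) (\<lambda>s. kernel P s * exp (s * \<zeta>)) + a * vint cc (real n) (\<lambda>s. kernel Q s * exp (s * \<zeta>))" for n
  proof (subst vint_add_cmult[symmetric])
    show "continuous_on {s. Re s = cc} (\<lambda>s. kernel P s * exp (s * \<zeta>))"
      "continuous_on {s. Re s = cc} (\<lambda>s. kernel Q s * exp (s * \<zeta>))"
      by (intro continuous_intros kernel_continuous good_cc assms)+
    show "vint cc (real n) (\<lambda>s. kernel (P + smult a Q) s * exp (s * \<zeta>)) =
       vint cc (real n) (\<lambda>s. kernel P s * exp (s * \<zeta>) + a * (kernel Q s * exp (s * \<zeta>)))"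
      by (rule vint_cong) (simp add: kernel_def algebra_simps add_divide_distrib)
  qed
  moreover have "(\<lambda>n. vint cc (real n) (\<lambda>s. kernel P s * exp (s * \<zeta>)) + a * vint cc (real n) (\<lambda>s. kernel Q s * exp (s * \<zeta>))) \<longlonglongrightarrow> X P \<zeta> + a * X Q \<zeta>"
    using assms by (intro tendsto_intros X_tendsto)
  ultimately show ?thesis using LIMSEQ_unique by simp
qed

text \<open>Raising \<zeta> by 2 pi i multiplies the integrand by t = \<open>e2pi s\<close>. In t P
  = \<open>mono_step Y P\<close> + l \<open>cis_poly Y\<close> the first summand is again a
  numerator of degree less than r. By the hypothesis on \<open>g\<close> the second one loses the
  denominator \<open>cis_poly B\<close>, and its integral is known to be \<open>L\<close>.\<close>

lemma cross_general:
  assumes P: "degree P < card A" and Y: "Y = A \<or> Y = B"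
  assumes g: "continuous_on {s. Re s = cc} g" "\<And>s. Re s = cc \<Longrightarrow> u s * poly (cis_poly Y) (e2pi s) = g s * poly (cis_poly B) (e2pi s)"
    and lim: "(\<lambda>M. vint cc (real (M\<^sup>2)) (\<lambda>s. g s / s * exp (s * of_real \<xi>))) \<longlonglongrightarrow> L"
  shows "X P (of_real \<xi> + 2 * pi * \<i>) = X (mono_step Y P) (of_real \<xi>) + coeff P (card A - 1) / u 0 * L"
proof -
  define l where "l = coeff P (card A - 1)"
  have dM: "degree (mono_step Y P) < card A" using P Y by (rule degree_mono_step[rotated])
  have eq: "vint cc T (\<lambda>s. kernel P s * exp (s * (of_real \<xi> + 2 * pi * \<i>))) =
      vint cc T (\<lambda>s. kernel (mono_step Y P) s * exp (s * of_real \<xi>)) + l / u 0 * vint cc T (\<lambda>s. g s / s * exp (s * of_real \<xi>))" for T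
  proof (subst vint_add_cmult[symmetric])
    show "continuous_on {s. Re s = cc} (\<lambda>s. kernel (mono_step Y P) s * exp (s * of_real \<xi>))"
      by (intro continuous_intros kernel_continuous good_cc dM)
    show "continuous_on {s. Re s = cc} (\<lambda>s. g s / s * exp (s * of_real \<xi>))"
      using cc by (intro continuous_intros g) auto
    show "vint cc T (\<lambda>s. kernel P s * exp (s * (of_real \<xi> + 2 * pi * \<i>))) =
       vint cc T (\<lambda>s. kernel (mono_step Y P) s * exp (s * of_real \<xi>) + l / u 0 * (g s / s * exp (s * of_real \<xi>)))"
    proof (rule vint_cong)
      fix s assume s: "Re s = cc"
      define t where "t = e2pi s"
      define b where "b = poly (cis_poly B) t"
      have b0: "b \<noteq> 0" unfolding b_def t_def by (rule cis_poly_B_nz[OF good_cc s])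
      have s0: "s \<noteq> 0" using s cc by auto
      have e: "exp (s * (of_real \<xi> + 2 * pi * \<i>)) = t * exp (s * of_real \<xi>)"
        unfolding t_def exp_add[symmetric] by (simp add: algebra_simps)
      have gs: "u s * poly (cis_poly Y) t = g s * b" using g(2)[OF s] by (simp add: t_def b_def)
      have "u s * poly (mono_step Y P) t + l * (u s * poly (cis_poly Y) t) = u s * poly P t * t"
        unfolding poly_mono_step l_def by (simp add: algebra_simps)
      hence "u s * poly P t * t = u s * poly (mono_step Y P) t + l * g s * b" unfolding gs by (simp add: mult.assoc)
      hence "u s * poly P t * t / (u 0 * s * b) = (u s * poly (mono_step Y P) t + l * g s * b) / (u 0 * s * b)" by simp
      also have "\<dots> = u s * poly (mono_step Y P) t / (u 0 * s * b) + l / u 0 * (g s / s)"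
        using b0 s0 u_0 by (simp add: add_divide_distrib)
      finally have "u s * poly P t * t / (u 0 * s * b) * exp (s * of_real \<xi>) = (u s * poly (mono_step Y P) t / (u 0 * s * b) + l / u 0 * (g s / s)) * exp (s * of_real \<xi>)" by simp
      thus "kernel P s * exp (s * (of_real \<xi> + 2 * pi * \<i>)) = kernel (mono_step Y P) s * exp (s * of_real \<xi>) + l / u 0 * (g s / s * exp (s * of_real \<xi>))"
        unfolding kernel_def e t_def[symmetric] b_def[symmetric] by (simp add: algebra_simps)
    qed
  qed
  have "(\<lambda>M. vint cc (real (M\<^sup>2)) (\<lambda>s. kernel P s * exp (s * (of_real \<xi> + 2 * pi * \<i>)))) \<longlonglongrightarrow> X P (of_real \<xi> + 2 * pi * \<i>)"
    using P by (intro X_subseq) auto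
  moreover have "(\<lambda>M. vint cc (real (M\<^sup>2)) (\<lambda>s. kernel P s * exp (s * (of_real \<xi> + 2 * pi * \<i>)))) \<longlonglongrightarrow>
       X (mono_step Y P) (of_real \<xi>) + l / u 0 * L"
    unfolding eq using dM by (intro tendsto_intros lim X_subseq) auto
  ultimately show ?thesis unfolding l_def by (rule LIMSEQ_unique)
qed

text \<open>With \<open>Y = A\<close> reflection turns the extra term into \<open>v\<close>, and
  closing to the left meets no pole. So the normalization at infinity leaves no additive
  constant.\<close>

lemma cross_infinity:
  assumes P: "degree P < card A" and "\<xi> > 0"
  shows "X P (of_real \<xi> + 2 * pi * \<i>) = X (mono_step A P) (of_real \<xi>)"
proof -
  obtain C' where C': "\<And>s. Re s \<le> cc \<Longrightarrow> norm (v s) \<le> C'" using v_bound[OF cc(2)] by blast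
  define C where "C = norm kap * C'"
  have C: "norm (kap * v s) \<le> C" if "Re s \<le> cc" for s
    unfolding C_def norm_mult using C'[OF that] by (rule mult_left_mono) simp
  have hol: "(\<lambda>s. kap * v s) holomorphic_on {s. Re s < 0}" by (intro holomorphic_intros v_holomorphic)
  have "(\<lambda>M. vint cc (real (M\<^sup>2)) (\<lambda>s. kap * v s / s * exp (s * of_real \<xi>))) \<longlonglongrightarrow> 0"
    using hol C cc(2) assms(2) by (rule close_left)
  moreover have "continuous_on {s. Re s = cc} (\<lambda>s. kap * v s)"
    by (intro holomorphic_on_imp_continuous_on holomorphic_on_subset[OF hol]) (use cc in auto)
  ultimately have "X P (of_real \<xi> + 2 * pi * \<i>) = X (mono_step A P) (of_real \<xi>) + coeff P (card A - 1) / u 0 * 0"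
    using P cc by (intro cross_general[where g = "\<lambda>s. kap * v s"] u_reflect) auto
  thus ?thesis by simp
qed

text \<open>With \<open>Y = B\<close> the denominator cancels at once and \<open>u\<close> itself
  remains. Closing to the right picks up the pole of 1 / s at 0, the origin of the additive
  period.\<close>

lemma cross_zero:
  assumes P: "degree P < card A" and "\<xi> < 0"
  shows "X P (of_real \<xi> + 2 * pi * \<i>) = X (mono_step B P) (of_real \<xi>) - 2 * pi * \<i> * coeff P (card A - 1)"
proof -
  obtain C where C: "\<And>s. Re s \<ge> cc \<Longrightarrow> norm (u s) \<le> C"
    using u_bound[OF cc(1)] by blast
  have "(\<lambda>M. vint cc (real (M\<^sup>2)) (\<lambda>s. u s / s * exp (s * of_real \<xi>))) \<longlonglongrightarrow> - (2 * pi * \<i>) * u 0"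
    using u_holomorphic C cc(1,2) assms(2) by (rule close_right)
  moreover have "continuous_on {s. Re s = cc} u"
    by (intro holomorphic_on_imp_continuous_on holomorphic_on_subset[OF u_holomorphic]) (use cc in auto)
  ultimately have "X P (of_real \<xi> + 2 * pi * \<i>) = X (mono_step B P) (of_real \<xi>) + coeff P (card A - 1) / u 0 * (- (2 * pi * \<i>) * u 0)"
    using P cc by (intro cross_general[where g = u]) auto
  thus ?thesis using u_0 by simp
qed

end

section \<open>Behaviour near zero\<close>

context interlacing
begin

text \<open>The kernel of \<open>P0\<close> is \<open>u s / (u 0 * s * (e2pi s - 1))\<close>, with residues at the natural numbers given by
  the coefficients of \<open>f\<close>.\<close>
definition P0 :: "complex poly" where "P0 = cis_poly (B - {1})"

lemma cis_poly_B_eq: "cis_poly B = [:-1, 1:] * P0"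
  unfolding cis_poly_def P0_def using fin one_B by (subst prod.remove[of B 1]) auto

lemma poly_cis_poly_B_eq: "poly (cis_poly B) t = (t - 1) * poly P0 t"
  by (simp add: cis_poly_B_eq algebra_simps)

lemma degree_P0: "degree P0 = card A - 1"
  using fin one_B card_eq by (simp add: P0_def degree_cis_poly)

lemma degree_P0_less: "degree P0 < card A"
  using degree_P0 card_pos by simp

lemma coeff_P0: "coeff P0 (card A - 1) = 1"
  using lead_coeff_cis_poly[of "B - {1}"] degree_P0 by (simp add: P0_def)

text \<open>The first place to the right of 0 where a kernel can have a pole: the zeros of its
  denominator are the points n - y, and the inserted 1 accounts for y = 1.\<close>

definition smax :: real where "smax = Min (insert 1 ((\<lambda>y. 1 - y) ` (B - {1})))"

lemma smax: "0 < smax" "smax \<le> 1" "\<And>y. y \<in> B \<Longrightarrow> y \<noteq> 1 \<Longrightarrow> smax \<le> 1 - y"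
proof -
  have f: "finite (insert 1 ((\<lambda>y. 1 - y) ` (B - {1})))" using fin by simp
  show "smax \<le> 1" "\<And>y. y \<in> B \<Longrightarrow> y \<noteq> 1 \<Longrightarrow> smax \<le> 1 - y"
    unfolding smax_def using f by (intro Min_le; simp)+
  show "0 < smax" unfolding smax_def using f sub by (subst Min_gr_iff) force+
qed

lemma strip_only_pole:
  assumes "- amin < Re s" "Re s < smax" "y \<in> B" "e2pi s = cis_pt y"
  shows "y = 1 \<and> s = 0"
proof -
  obtain n :: int where n: "s = of_int n - of_real y"
    using exp_2pi_i_eq_cis_pt_iff[THEN iffD1, OF assms(4)] by blast
  have Re: "Re s = of_int n - y" by (simp add: n)
  show ?thesis
  proof (cases "y = 1")
    case True
    have "of_int n < (2::real)" "of_int n > (0::real)" using Re assms amin(4) smax(2) True by linarith+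
    hence "0 < n \<and> n < 2" by simp
    hence "n = 1" by presburger
    thus ?thesis using n True by simp
  next
    case False
    have "of_int n < (1::real)" using Re assms smax(3)[OF assms(3) False] by linarith
    moreover have "of_int n > (0::real)" using Re assms amin(5)[OF assms(3)] by linarith
    ultimately have "0 < n \<and> n < 1" by simp
    thus ?thesis by presburger
  qed
qed

text \<open>The kernel freed of its double pole at 0, to which 1 / s and the factor t - 1 of the
  denominator contribute one order each.\<close>

definition kfun :: "complex poly \<Rightarrow> complex \<Rightarrow> complex" where
  "kfun P s = u s / u 0 * poly P (e2pi s) * qfun s / poly P0 (e2pi s)"

lemma kernel_conv_kfun: "kernel P s = kfun P s / s\<^sup>2"
proof (cases "s = 0")
  case False
  thus ?thesis
    unfolding kernel_def kfun_def poly_cis_poly_B_eq by (simp add: qfun_def power2_eq_square divide_simps)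
\<comment> \<open>At 0 both sides are 0, being divisions by zero.\<close>
qed (simp add: kernel_def)

lemma residue_kernel:
  "residue (\<lambda>s. kernel P s * exp (s * \<zeta>)) 0 = deriv (kfun P) 0 + \<zeta> * kfun P 0"
proof -
  define U where "U = {s. - amin < Re s \<and> Re s < smax} \<inter> ball 0 1"
  have "kfun P holomorphic_on U" unfolding kfun_def
  proof (intro holomorphic_intros)
    show "u holomorphic_on U" by (rule holomorphic_on_subset[OF u_holomorphic]) (auto simp: U_def)
    show "qfun holomorphic_on U" by (rule holomorphic_on_subset[OF qfun_holomorphic]) (auto simp: U_def)
    fix s assume s: "s \<in> U"
    show "u 0 \<noteq> 0" by (rule u_0)
    have "e2pi s \<noteq> cis_pt y" if "y \<in> B - {1}" for y
      using strip_only_pole[of s y] that s by (auto simp: U_def)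
    thus "poly P0 (e2pi s) \<noteq> 0" unfolding P0_def using fin by (simp add: poly_cis_poly)
  qed
  moreover have "open U" "0 \<in> U" unfolding U_def using strip_open_connected amin smax by (auto intro!: open_Int)
  ultimately have "residue (\<lambda>s. kfun P s * exp (s * \<zeta>) / s\<^sup>2) 0 = deriv (kfun P) 0 + \<zeta> * kfun P 0"
    by (intro residue_exp_over_square)
  thus ?thesis by (simp add: kernel_conv_kfun)
qed

text \<open>Moving the line across 0 to a positive abscissa splits off the residue, of degree 1 in
  \<zeta>; what remains is an integral with a factor \<open>exp (c1 * Re \<zeta>)\<close>, bounded
  for Re \<zeta> \<le> 0.\<close>

lemma X_shift:
  assumes P: "degree P < card A"
  shows "\<exists>K. \<forall>\<zeta>. 0 \<le> Im \<zeta> \<longrightarrow> Im \<zeta> \<le> 2 * pi \<longrightarrow> Re \<zeta> \<le> 0 \<longrightarrow>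
    norm (X P \<zeta> + 2 * pi * \<i> * (deriv (kfun P) 0 + \<zeta> * kfun P 0)) \<le> K"
proof -
  define c1 where "c1 = smax / 2"
  have c1: "0 < c1" "c1 < smax" "c1 < 1" using smax by (auto simp: c1_def)
  have "good c1"
  proof -
    have "c1 + y \<notin> \<int>" if y: "y \<in> B" for y
    proof
      assume "c1 + y \<in> \<int>"
      then obtain n :: int where n: "c1 + y = of_int n" by (auto elim: Ints_cases)
      show False
      proof (cases "y = 1")
        case True
        hence "of_int n > (1::real)" "of_int n < (2::real)" using n c1 by linarith+
        hence "1 < n \<and> n < 2" by simp
        thus False by presburger
      next
        case False
        hence "c1 + y < 1" "c1 + y > 0" using smax(3)[OF y] c1 sub y by force+
        hence "0 < n \<and> n < 1" unfolding n by simp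
        thus False by presburger
      qed
    qed
    thus ?thesis using c1 amin by (auto simp: good_def)
  qed
  then obtain K \<delta> where "vline_kernel (kernel P) c1 K \<delta>" using kernel_line[OF _ P] by blast
  then interpret k1: vline_kernel "kernel P" c1 K \<delta> .
  obtain C where C: "C \<ge> 0" "\<And>s. Re s \<ge> cc \<Longrightarrow> norm (u s) \<le> C" using u_bound[OF cc(1)] by blast
  obtain K3 where K3: "K3 \<ge> 0" "\<And>s \<zeta>. (\<forall>y\<in>B. 1/3 * (1 + norm (e2pi s)) \<le> norm (e2pi s - cis_pt y)) \<Longrightarrow>
      0 \<le> Im \<zeta> \<Longrightarrow> Im \<zeta> \<le> 2 * pi \<Longrightarrow>
      norm (poly P (e2pi s) / poly (cis_poly B) (e2pi s) * exp (s * \<zeta>)) \<le> K3 * exp (Re s * Re \<zeta>)"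
    using norm_ratio_exp_le[of "1/3", OF _ P] by auto
  show ?thesis
  proof (intro exI[of _ "2 * K / \<delta>"] allI impI)
    fix \<zeta> assume \<zeta>: "0 \<le> Im \<zeta>" "Im \<zeta> \<le> 2 * pi" "Re \<zeta> \<le> 0"
    define g where "g = (\<lambda>s. kernel P s * exp (s * \<zeta>))"
    define R where "R = 2 * pi * \<i> * (deriv (kfun P) 0 + \<zeta> * kfun P 0)"
    define E where "E = exp \<bar>Re \<zeta>\<bar>"
    have bd: "norm (vint cc (real n) g - vint c1 (real n) g + R) \<le> 2 * (c1 - cc) * (C / norm (u 0) * (K3 * E)) / real n" if n: "n > 0" for n
    proof -
      have "norm (vint cc (real n) g - vint c1 (real n) g + 2 * pi * \<i> * (\<Sum>p\<in>{0}. residue g p)) \<le> 2 * (c1 - cc) * (C / norm (u 0) * (K3 * E) / real n)"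
      proof (rule rectangle_residues[where S = "{s. - amin < Re s \<and> Re s < smax}"])
        show "g holomorphic_on {s. - amin < Re s \<and> Re s < smax} - {0}"
          unfolding g_def kernel_def
        proof (intro holomorphic_intros)
          show "u holomorphic_on {s. - amin < Re s \<and> Re s < smax} - {0}"
            by (rule holomorphic_on_subset[OF u_holomorphic]) auto
          fix s assume s: "s \<in> {s. - amin < Re s \<and> Re s < smax} - {0}"
          thus "u 0 * s \<noteq> 0" using u_0 by simp
          have "e2pi s \<noteq> cis_pt y" if "y \<in> B" for y
            using strip_only_pole[of s y] that s by auto
          thus "poly (cis_poly B) (e2pi s) \<noteq> 0" using fin by (simp add: poly_cis_poly)
        qed
        fix s assume s: "cc \<le> Re s" "Re s \<le> c1" "\<bar>Im s\<bar> = real n"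
        have "norm (u s / (u 0 * s)) \<le> C / (norm (u 0) * real n)"
          unfolding norm_divide norm_mult using s C u_0 n abs_Im_le_cmod[of s]
          by (intro frac_le mult_left_mono) auto
        moreover have "norm (poly P (e2pi s) / poly (cis_poly B) (e2pi s) * exp (s * \<zeta>)) \<le> K3 * exp (Re s * Re \<zeta>)"
          using s n \<zeta> by (intro K3 ballI dist_cis_pt_far) auto
        moreover have "K3 * exp (Re s * Re \<zeta>) \<le> K3 * E"
        proof -
          have "\<bar>Re s\<bar> \<le> 1" using s c1 cc by auto
          hence "\<bar>Re s * Re \<zeta>\<bar> \<le> 1 * \<bar>Re \<zeta>\<bar>" unfolding abs_mult by (rule mult_right_mono) simp
          thus ?thesis unfolding E_def using K3 by (intro mult_left_mono) auto
        qed
        ultimately have "norm (u s / (u 0 * s)) * norm (poly P (e2pi s) / poly (cis_poly B) (e2pi s) * exp (s * \<zeta>)) \<le> C / (norm (u 0) * real n) * (K3 * E)"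
          using C(1) by (intro mult_mono) auto
        thus "norm (g s) \<le> C / norm (u 0) * (K3 * E) / real n"
          unfolding g_def kernel_def norm_mult[symmetric] by (simp only: mult.assoc times_divide_eq_left times_divide_eq_right divide_divide_eq_left)
      qed (use n c1 cc amin smax in \<open>auto simp: strip_open_connected in_cbox_complex_iff\<close>)
      thus ?thesis by (simp add: R_def g_def residue_kernel)
    qed
    have "(\<lambda>n. vint cc (real n) g - vint c1 (real n) g + R) \<longlonglongrightarrow> 0"
    proof (rule Lim_null_comparison)
      show "\<forall>\<^sub>F n in sequentially. norm (vint cc (real n) g - vint c1 (real n) g + R) \<le> 2 * (c1 - cc) * (C / norm (u 0) * (K3 * E)) / real n"
        using eventually_gt_at_top[of 0] by eventually_elim (rule bd)
    qed (rule inverse_tail_tendsto)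
    moreover have "(\<lambda>n. vint cc (real n) g - vint c1 (real n) g + R) \<longlonglongrightarrow> X P \<zeta> - k1.full \<zeta> + R"
      unfolding g_def using k1.partial_tendsto[OF \<zeta>(1,2)] X_tendsto[OF P \<zeta>(1,2)] unfolding k1.partial_def by (intro tendsto_intros)
    ultimately have "X P \<zeta> - k1.full \<zeta> + R = 0" by (rule LIMSEQ_unique[symmetric])
    hence "X P \<zeta> + R = k1.full \<zeta>" by (simp add: algebra_simps)
    moreover have "norm (k1.full \<zeta>) \<le> 2 * K / \<delta>"
    proof -
      have "0 \<le> norm (k1.full 0)" by simp
      also have "\<dots> \<le> 2 * K / \<delta>" using k1.norm_full_le[of 0] by simp
      finally have K0: "2 * K / \<delta> \<ge> 0" .
      have "norm (k1.full \<zeta>) \<le> 2 * K / \<delta> * exp (c1 * Re \<zeta>)" by (rule k1.norm_full_le) fact+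
      also have "\<dots> \<le> 2 * K / \<delta> * 1" using K0 c1 \<zeta> by (intro mult_left_mono) (auto simp: mult_nonneg_nonpos)
      finally show ?thesis by simp
    qed
    ultimately show "norm (X P \<zeta> + 2 * pi * \<i> * (deriv (kfun P) 0 + \<zeta> * kfun P 0)) \<le> 2 * K / \<delta>"
      unfolding R_def by simp
  qed
qed

text \<open>In terms of z this is logarithmic growth at 0 and boundedness at 1. It comes from
  \<open>X_bound\<close> to the right of the imaginary axis and from \<open>X_shift\<close> to the
  left.\<close>

lemma X_linear_bound:
  assumes P: "degree P < card A"
  shows "\<exists>K. \<forall>\<zeta>. 0 \<le> Im \<zeta> \<longrightarrow> Im \<zeta> \<le> 2 * pi \<longrightarrow> norm (X P \<zeta>) \<le> K * (1 + norm \<zeta>)"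
proof -
  obtain K1 where K1: "\<And>\<zeta>. 0 \<le> Im \<zeta> \<Longrightarrow> Im \<zeta> \<le> 2 * pi \<Longrightarrow> norm (X P \<zeta>) \<le> K1 * exp (cc * Re \<zeta>)"
    using X_bound[OF P] by blast
  obtain K2 where K2: "\<And>\<zeta>. 0 \<le> Im \<zeta> \<Longrightarrow> Im \<zeta> \<le> 2 * pi \<Longrightarrow> Re \<zeta> \<le> 0 \<Longrightarrow>
    norm (X P \<zeta> + 2 * pi * \<i> * (deriv (kfun P) 0 + \<zeta> * kfun P 0)) \<le> K2"
    using X_shift[OF P] by blast
  define a b where "a = 2 * pi * norm (deriv (kfun P) 0)" and "b = 2 * pi * norm (kfun P 0)"
  have ab: "a \<ge> 0" "b \<ge> 0" by (simp_all add: a_def b_def)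
  have K10: "K1 \<ge> 0" using order_trans[OF norm_ge_zero K1[of 0]] by simp
  have K20: "K2 \<ge> 0" using order_trans[OF norm_ge_zero K2[of 0]] by simp
  show ?thesis
  proof (intro exI[of _ "K1 + K2 + a + b"] allI impI)
    fix \<zeta> assume \<zeta>: "0 \<le> Im \<zeta>" "Im \<zeta> \<le> 2 * pi"
    show "norm (X P \<zeta>) \<le> (K1 + K2 + a + b) * (1 + norm \<zeta>)"
    proof (cases "Re \<zeta> \<ge> 0")
      case True
      have "norm (X P \<zeta>) \<le> K1 * exp (cc * Re \<zeta>)" using K1 \<zeta> by simp
      also have "\<dots> \<le> K1 * 1" using K10 True cc by (intro mult_left_mono) (auto simp: mult_nonpos_nonneg)
      also have "\<dots> \<le> (K1 + K2 + a + b) * (1 + norm \<zeta>)" using K10 K20 ab by (intro mult_mono) auto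
      finally show ?thesis .
    next
      case False
      define R where "R = 2 * pi * \<i> * (deriv (kfun P) 0 + \<zeta> * kfun P 0)"
      have "norm (X P \<zeta>) \<le> norm (X P \<zeta> + R) + norm R" by (metis add_diff_cancel_right' norm_triangle_ineq4)
      also have "norm (X P \<zeta> + R) \<le> K2" using K2 \<zeta> False by (simp add: R_def)
      also have "norm R \<le> a + b * norm \<zeta>"
      proof -
        have "norm R = 2 * pi * norm (deriv (kfun P) 0 + \<zeta> * kfun P 0)" by (simp add: R_def norm_mult)
        also have "\<dots> \<le> 2 * pi * (norm (deriv (kfun P) 0) + norm \<zeta> * norm (kfun P 0))"
          by (intro mult_left_mono order_trans[OF norm_triangle_ineq]) (auto simp: norm_mult)
        finally show ?thesis by (simp add: a_def b_def algebra_simps)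
      qed
      also have "K2 + (a + b * norm \<zeta>) \<le> (K1 + K2 + a + b) * (1 + norm \<zeta>)"
        using K10 K20 ab by (simp add: algebra_simps add_nonneg_nonneg)
      finally show ?thesis by simp
    qed
  qed
qed

text \<open>The line is moved right to the abscissas M + 1/2, half way between two poles. The poles
  at 1, ..., M give the partial sums, the double pole at 0 gives \<zeta> + \<kappa>.\<close>

lemma X_P0_series:
  "\<exists>\<kappa>. \<forall>\<zeta>. Re \<zeta> < 0 \<longrightarrow> 0 \<le> Im \<zeta> \<longrightarrow> Im \<zeta> \<le> 2 * pi \<longrightarrow>
     (\<lambda>M. \<Sum>n=1..M. u (of_nat n) / u 0 / of_nat n * exp (of_nat n * \<zeta>)) \<longlonglongrightarrow> - X P0 \<zeta> - \<zeta> - \<kappa>"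
proof -
  define k where "k = (\<lambda>s. u s / u 0 * qfun s)"
  define \<kappa> where "\<kappa> = 2 * pi * \<i> * deriv k 0"
  obtain C where C: "C \<ge> 0" "\<And>s. Re s \<ge> cc \<Longrightarrow> norm (u s) \<le> C" using u_bound[OF cc(1)] by blast
  have main: "(\<lambda>M. \<Sum>n=1..M. u (of_nat n) / u 0 / of_nat n * exp (of_nat n * \<zeta>)) \<longlonglongrightarrow> - X P0 \<zeta> - \<zeta> - \<kappa>"
    if \<zeta>: "Re \<zeta> < 0" "0 \<le> Im \<zeta>" "Im \<zeta> \<le> 2 * pi" for \<zeta>
  proof -
    define g where "g = (\<lambda>s. u s / (u 0 * s * (e2pi s - 1)) * exp (s * \<zeta>))"
    define E where "E = exp (cc * Re \<zeta>)"
    \<comment> \<open>The factor 3 is the reciprocal of the constant in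
      \<open>dist_cis_pt_far\<close>.\<close>
    define D where "D = 3 * C / norm (u 0)"
    have D0: "D \<ge> 0" using C by (simp add: D_def)
    have gX: "vint cc T (\<lambda>s. kernel P0 s * exp (s * \<zeta>)) = vint cc T g" for T
    proof (rule vint_cong)
      fix s assume "Re s = cc"
      hence "poly (cis_poly B) (e2pi s) \<noteq> 0" by (rule cis_poly_B_nz[OF good_cc])
      thus "kernel P0 s * exp (s * \<zeta>) = g s"
        unfolding kernel_def g_def poly_cis_poly_B_eq by (simp add: divide_simps)
    qed
    have res0: "residue g 0 = deriv k 0 + \<zeta> * k 0"
    proof -
      have "residue (\<lambda>s. k s * exp (s * \<zeta>) / s\<^sup>2) 0 = deriv k 0 + \<zeta> * k 0"
      proof (rule residue_exp_over_square)
        show "open ({s. - amin < Re s} \<inter> ball 0 1)" by (intro open_Int strip_open_connected) auto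
        show "0 \<in> {s. - amin < Re s} \<inter> ball 0 1" using amin by auto
        show "k holomorphic_on {s. - amin < Re s} \<inter> ball 0 1" unfolding k_def
          by (intro holomorphic_intros holomorphic_on_subset[OF u_holomorphic] holomorphic_on_subset[OF qfun_holomorphic] u_0) auto
      qed
      moreover have "(\<lambda>s. k s * exp (s * \<zeta>) / s\<^sup>2) = g"
      proof
        show "k s * exp (s * \<zeta>) / s\<^sup>2 = g s" for s
          by (cases "s = 0") (simp_all add: g_def k_def qfun_def power2_eq_square divide_simps)
      qed
      ultimately show ?thesis by (simp only:)
    qed
    have resn: "residue g (of_nat n) = u (of_nat n) / u 0 / of_nat n * exp (of_nat n * \<zeta>) / (2 * pi * \<i>)" if n: "n \<ge> 1" for n
    proof -
      define h where "h = (\<lambda>s. u s / (u 0 * s) * exp (s * \<zeta>) * qfun (s - of_nat n))"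
      have "residue (\<lambda>s. h s / (s - of_nat n)) (of_nat n) = h (of_nat n)"
      proof (rule residue_simple)
        show "open (ball (of_nat n) 1 :: complex set)" "of_nat n \<in> ball (of_nat n :: complex) 1" by auto
        have Re: "Re s > 0" if "s \<in> ball (of_nat n) 1" for s
          using that abs_Re_le_cmod[of "of_nat n - s"] n by (auto simp: dist_norm)
        have "(qfun \<circ> (\<lambda>s. s - of_nat n)) holomorphic_on ball (of_nat n) 1"
          by (rule holomorphic_on_compose_gen[OF _ qfun_holomorphic])
             (auto intro!: holomorphic_intros simp: dist_norm norm_minus_commute)
        hence "(\<lambda>s. qfun (s - of_nat n)) holomorphic_on ball (of_nat n) 1" by (simp add: o_def)
        moreover have "u holomorphic_on ball (of_nat n) 1"
          by (rule holomorphic_on_subset[OF u_holomorphic]) (use Re amin in force)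
        ultimately show "h holomorphic_on ball (of_nat n) 1"
          unfolding h_def using Re u_0 by (intro holomorphic_intros) force+
      qed
      moreover have "(\<lambda>s. h s / (s - of_nat n)) = g"
      proof
        fix s
        have "exp (2 * pi * \<i> * (s - of_nat n)) = e2pi s"
        proof -
          have "e2pi s = exp (2 * pi * \<i> * (s - of_nat n) + of_int (2 * int n) * pi * \<i>)"
            by (simp add: algebra_simps)
          also have "\<dots> = exp (2 * pi * \<i> * (s - of_nat n)) * exp (of_int (2 * int n) * pi * \<i>)"
            by (rule exp_add)
          also have "exp (of_int (2 * int n) * pi * \<i>) = 1" by (subst exp_eq_1) (auto intro!: exI[of _ "int n"])
          finally show ?thesis by simp
        qed
        moreover have "e2pi s = 1" if "s = of_nat n"
          using that calculation by simp
        ultimately show "h s / (s - of_nat n) = g s"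
          by (cases "s = of_nat n") (simp_all add: h_def g_def qfun_def divide_simps)
      qed
      ultimately show ?thesis by (simp add: h_def qfun_def)
    qed
    have bd: "norm (vint cc (real (M\<^sup>2)) g + 2 * pi * \<i> * (\<Sum>p\<in>of_nat ` {0..M}. residue g p)) \<le>
        2 * 3 * D * E / real M + 2 * D * real M * exp (real M * Re \<zeta>)" if M: "M > 0" for M
    proof -
      define T where "T = real (M\<^sup>2)"
      define b where "b = real M + 1/2"
      have T: "T \<ge> 1" using M by (simp add: T_def)
      have g: "g holomorphic_on {s. - amin < Re s \<and> Re s < real M + 1} - of_nat ` {0..M}" unfolding g_def
      proof (intro holomorphic_intros)
        show "u holomorphic_on {s. - amin < Re s \<and> Re s < real M + 1} - of_nat ` {0..M}"
          by (rule holomorphic_on_subset[OF u_holomorphic]) auto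
        fix s assume s: "s \<in> {s. - amin < Re s \<and> Re s < real M + 1} - of_nat ` {0..M}"
        have "s \<noteq> 0" using s by force
        moreover have "e2pi s \<noteq> 1"
        proof
          assume "e2pi s = 1"
          hence "e2pi s = cis_pt 1" by simp
          then obtain n :: int where "s = of_int n - of_real 1"
            using exp_2pi_i_eq_cis_pt_iff[THEN iffD1] by blast
          hence n: "s = of_int (n - 1)" by simp
          have "-1 < (of_int (n - 1) :: real)" "of_int (n - 1) < (real M + 1)" using s amin(4) unfolding n by auto
          hence "n - 1 \<ge> 0" "nat (n - 1) \<le> M" by linarith+
          hence "s = of_nat (nat (n - 1))" unfolding n by simp
          thus False using s \<open>nat (n - 1) \<le> M\<close> by auto
        qed
        ultimately show "u 0 * s * (e2pi s - 1) \<noteq> 0" using u_0 by simp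
      qed
      have gb: "norm (g s) \<le> D / d * exp (Re s * Re \<zeta>)" if "norm s \<ge> d" "d > 0" "Re s \<ge> cc"
        "1/3 * (1 + norm (e2pi s)) \<le> norm (e2pi s - 1)" for s d
      proof -
        define t where "t = e2pi s"
        have p: "1 + norm t > 0" using norm_ge_zero[of t] by linarith
        have "norm (g s) = norm (u s) * norm (exp (s * \<zeta>)) / (norm (u 0) * norm s * norm (t - 1))"
          by (simp add: g_def t_def norm_divide norm_mult)
        also have "\<dots> \<le> C * (exp (Re s * Re \<zeta>) * (1 + norm t)) / (norm (u 0) * d * (1/3 * (1 + norm t)))"
          using that C(1) C(2)[OF that(3)] p u_0 norm_exp_strip_le[OF \<zeta>(2,3), of s]
          by (intro frac_le mult_mono mult_nonneg_nonneg mult_pos_pos) (auto simp: t_def simp del: norm_exp_eq_Re)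
        also have "\<dots> = D / d * exp (Re s * Re \<zeta>)" using p that(2) u_0 by (simp add: D_def divide_simps)
        finally show ?thesis .
      qed
      have 1: "norm (vint cc T g - vint b T g + 2 * pi * \<i> * (\<Sum>p\<in>of_nat ` {0..M}. residue g p)) \<le> 2 * (b - cc) * (D / T * E)"
      proof (rule rectangle_residues[OF _ _ _ _ _ g])
        show "cbox (Complex cc (- T)) (Complex b T) \<subseteq> {s. - amin < Re s \<and> Re s < real M + 1}"
          using cc by (auto simp: in_cbox_complex_iff b_def)
        fix s assume s: "cc \<le> Re s" "Re s \<le> b" "\<bar>Im s\<bar> = T"
        have "norm (g s) \<le> D / T * exp (Re s * Re \<zeta>)"
          using dist_cis_pt_far[of s 1] abs_Im_le_cmod[of s] s T by (intro gb) simp_all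
        also have "\<dots> \<le> D / T * E" unfolding E_def using s \<zeta> D0 T by (intro mult_left_mono) (auto simp: mult_right_mono_neg)
        finally show "norm (g s) \<le> D / T * E" .
      qed (use cc T in \<open>auto simp: strip_open_connected b_def\<close>)
      \<comment> \<open>At half-integral real part \<open>e2pi s\<close> is a negative number, so
        its distance to 1 is exactly 1 + |t|.\<close>
      have half: "e2pi s = - of_real (norm (e2pi s))" if s: "Re s = b" for s
      proof -
        have "s = of_real b + \<i> * Im s" using s by (simp add: complex_eq_iff)
        hence "2 * pi * \<i> * s = of_real (- 2 * pi * Im s) + (of_int (2 * int M) * pi * \<i> + pi * \<i>)"
          unfolding b_def by (simp add: algebra_simps complex_eq_iff)
        hence "e2pi s = exp (of_real (- 2 * pi * Im s)) * (exp (of_int (2 * int M) * pi * \<i>) * exp (pi * \<i>))"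
          by (simp only: exp_add)
        also have "exp (of_int (2 * int M) * pi * \<i>) = 1" by (subst exp_eq_1) (auto intro!: exI[of _ "int M"])
        also have "exp (of_real (- 2 * pi * Im s)) = complex_of_real (norm (e2pi s))"
          unfolding norm_exp_2pi_i by (rule exp_of_real)
        finally show ?thesis by (simp add: exp_pi_i')
      qed
      have 2: "norm (vint b T g) \<le> 2 * T * (D / M * exp (M * Re \<zeta>))"
      proof (rule norm_vint_le)
        show "continuous_on {s. Re s = b} g"
        proof (intro holomorphic_on_imp_continuous_on holomorphic_on_subset[OF g] subsetI)
          fix s assume s: "s \<in> {s. Re s = b}"
          have "s \<noteq> of_nat k" for k
          proof
            assume "s = of_nat k"
            hence "real (2 * k) = real (2 * M + 1)" using s by (simp add: b_def)
            hence "2 * k = 2 * M + 1" by (simp only: of_nat_eq_iff)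
            thus False by presburger
          qed
          thus "s \<in> {s. - amin < Re s \<and> Re s < real M + 1} - of_nat ` {0..M}"
            using s amin by (auto simp: b_def)
        qed
        fix s assume s: "Re s = b"
        have "norm (g s) \<le> D / M * exp (Re s * Re \<zeta>)"
        proof (intro gb)
          have "norm (e2pi s - 1) = norm (of_real (- norm (e2pi s) - 1) :: complex)"
            by (subst half[OF s]) simp
          also have "\<dots> = 1 + norm (e2pi s)" unfolding norm_of_real
            using norm_ge_zero[of "e2pi s"] by linarith
          finally show "1/3 * (1 + norm (e2pi s)) \<le> norm (e2pi s - 1)"
            by (simp del: norm_exp_eq_Re add: add_nonneg_nonneg)
        qed (use M cc abs_Re_le_cmod[of s] s in \<open>auto simp: b_def\<close>)
        also have "\<dots> \<le> D / M * exp (M * Re \<zeta>)"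
          using s \<zeta> D0 by (intro mult_left_mono) (auto simp: b_def mult_right_mono_neg)
        finally show "norm (g s) \<le> D / M * exp (M * Re \<zeta>)" .
      qed (use T D0 in auto)
      define R where "R = 2 * pi * \<i> * (\<Sum>p\<in>of_nat ` {0..M}. residue g p)"
      have "norm (vint cc T g + R) \<le> norm (vint b T g) + norm (vint cc T g - vint b T g + R)"
        using norm_triangle_ineq[of "vint b T g" "vint cc T g - vint b T g + R"] by simp
      also have "\<dots> \<le> 2 * T * (D / M * exp (M * Re \<zeta>)) + 2 * (b - cc) * (D / T * E)" using 1 2 by (simp add: R_def)
      also have "2 * (b - cc) * (D / T * E) \<le> 2 * (3 * real M) * (D / T * E)"
        using M cc D0 T by (intro mult_right_mono mult_left_mono) (auto simp: E_def b_def)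
      also have "2 * T * (D / M * exp (M * Re \<zeta>)) + 2 * (3 * real M) * (D / T * E) = 2 * 3 * D * E / real M + 2 * D * real M * exp (real M * Re \<zeta>)"
        using M by (simp add: T_def power2_eq_square field_simps)
      finally show ?thesis by (simp add: R_def T_def)
    qed
    have "(\<lambda>M. vint cc (real (M\<^sup>2)) g + 2 * pi * \<i> * (\<Sum>p\<in>of_nat ` {0..M}. residue g p)) \<longlonglongrightarrow> 0"
    proof (rule Lim_null_comparison)
      show "\<forall>\<^sub>F M in sequentially. norm (vint cc (real (M\<^sup>2)) g + 2 * pi * \<i> * (\<Sum>p\<in>of_nat ` {0..M}. residue g p)) \<le>
         2 * 3 * D * E / real M + 2 * D * real M * exp (real M * Re \<zeta>)"
        using eventually_gt_at_top[of 0] by eventually_elim (rule bd)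
      show "(\<lambda>M. 2 * 3 * D * E / real M + 2 * D * real M * exp (real M * Re \<zeta>)) \<longlonglongrightarrow> 0"
        using tendsto_add[OF inverse_tail_tendsto[of "2 * 3 * D * E"] exp_tail_tendsto[OF \<zeta>(1), of "2 * D"]] by simp
    qed
    moreover have "2 * pi * \<i> * (\<Sum>p\<in>of_nat ` {0..M}. residue g p) =
       \<kappa> + \<zeta> + (\<Sum>n=1..M. u (of_nat n) / u 0 / of_nat n * exp (of_nat n * \<zeta>))" for M
    proof -
      have "(\<Sum>p\<in>of_nat ` {0..M}. residue g p) = (\<Sum>n=0..M. residue g (of_nat n))"
        by (subst sum.reindex) (auto intro: inj_onI)
      also have "\<dots> = residue g 0 + (\<Sum>n=1..M. residue g (of_nat n))"
        by (simp add: sum.atLeast_Suc_atMost)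
      also have "(\<Sum>n=1..M. residue g (of_nat n)) = (\<Sum>n=1..M. u (of_nat n) / u 0 / of_nat n * exp (of_nat n * \<zeta>) / (2 * pi * \<i>))"
        by (intro sum.cong refl resn) simp
      also have "\<dots> = (\<Sum>n=1..M. u (of_nat n) / u 0 / of_nat n * exp (of_nat n * \<zeta>)) / (2 * pi * \<i>)"
        by (rule sum_divide_distrib[symmetric])
      finally show ?thesis using u_0
        by (simp add: res0 \<kappa>_def k_def qfun_def algebra_simps)
    qed
    ultimately have "(\<lambda>M. vint cc (real (M\<^sup>2)) g + (\<kappa> + \<zeta> + (\<Sum>n=1..M. u (of_nat n) / u 0 / of_nat n * exp (of_nat n * \<zeta>)))) \<longlonglongrightarrow> 0"
      by simp
    moreover have "(\<lambda>M. vint cc (real (M\<^sup>2)) g) \<longlonglongrightarrow> X P0 \<zeta>"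
      using X_subseq[OF degree_P0_less \<zeta>(2,3)] by (simp add: gX)
    ultimately have "(\<lambda>M. (vint cc (real (M\<^sup>2)) g + (\<kappa> + \<zeta> + (\<Sum>n=1..M. u (of_nat n) / u 0 / of_nat n * exp (of_nat n * \<zeta>))))
         - vint cc (real (M\<^sup>2)) g - (\<kappa> + \<zeta>)) \<longlonglongrightarrow> 0 - X P0 \<zeta> - (\<kappa> + \<zeta>)"
      by (intro tendsto_intros)
    thus ?thesis by (simp add: algebra_simps)
  qed
  thus ?thesis by blast
qed

end

section \<open>Single-valued functions of moderate growth\<close>

text \<open>The numerator of Lagrange interpolation: at \<open>f P\<close> it takes the value \<open>c P\<close> times a product
  not depending on \<open>c\<close>. Its coefficients are symmetric in the index set.\<close>
definition lag_coeff :: "'i set \<Rightarrow> ('i \<Rightarrow> complex) \<Rightarrow> ('i \<Rightarrow> complex) \<Rightarrow> complex poly" where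
  "lag_coeff S c f = (\<Sum>P\<in>S. smult (c P) (\<Prod>Q\<in>S - {P}. [:- f Q, 1:]))"

lemma lag_coeff_cong:
  "(\<And>P. P \<in> S \<Longrightarrow> c P = c' P) \<Longrightarrow> (\<And>P. P \<in> S \<Longrightarrow> f P = f' P) \<Longrightarrow> lag_coeff S c f = lag_coeff S c' f'"
  unfolding lag_coeff_def by (intro sum.cong refl arg_cong2[where f = smult] prod.cong) auto

lemma lag_coeff_reindex:
  assumes "bij_betw \<sigma> S S"
  shows "lag_coeff S (\<lambda>P. c (\<sigma> P)) (\<lambda>P. f (\<sigma> P)) = lag_coeff S c f"
proof -
  have inj: "inj_on \<sigma> S" and img: "\<sigma> ` S = S" using assms by (auto simp: bij_betw_def)
  have "(\<Prod>Q\<in>S - {P}. [:- f (\<sigma> Q), 1:]) = (\<Prod>Q\<in>S - {\<sigma> P}. [:- f Q, 1:])" if "P \<in> S" for P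
  proof -
    have "\<sigma> ` (S - {P}) = S - {\<sigma> P}" using inj img that by (auto simp: inj_on_def)
    thus ?thesis using prod.reindex[OF inj_on_subset[OF inj], of "S - {P}" "\<lambda>Q. [:- f Q, 1:]"] by auto
  qed
  hence "lag_coeff S (\<lambda>P. c (\<sigma> P)) (\<lambda>P. f (\<sigma> P)) = (\<Sum>P\<in>S. smult (c (\<sigma> P)) (\<Prod>Q\<in>S - {\<sigma> P}. [:- f Q, 1:]))"
    unfolding lag_coeff_def by (intro sum.cong refl) simp
  also have "\<dots> = lag_coeff S c f"
    unfolding lag_coeff_def by (rule sum.reindex_bij_betw[OF assms])
  finally show ?thesis .
qed

lemma poly_lag_coeff:
  assumes "finite S" "P \<in> S"
  shows "poly (lag_coeff S c f) (f P) = c P * (\<Prod>Q\<in>S - {P}. f P - f Q)"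
proof -
  have "poly (lag_coeff S c f) (f P) = (\<Sum>P'\<in>S. c P' * (\<Prod>Q\<in>S - {P'}. f P - f Q))"
    by (simp add: lag_coeff_def poly_sum poly_prod)
  also have "\<dots> = (\<Sum>P'\<in>{P}. c P' * (\<Prod>Q\<in>S - {P'}. f P - f Q))"
    using assms by (intro sum.mono_neutral_right) auto
  finally show ?thesis by simp
qed

lemma sum_closed:
  fixes C :: "(complex \<Rightarrow> complex) \<Rightarrow> bool"
  assumes "\<And>c. C (\<lambda>z. c)" "\<And>g h. C g \<Longrightarrow> C h \<Longrightarrow> C (\<lambda>z. g z + h z)"
    and "finite I" "\<And>i. i \<in> I \<Longrightarrow> C (g i)"
  shows "C (\<lambda>z. \<Sum>i\<in>I. g i z)"
  using assms(3,4) by (induction rule: finite_induct) (auto intro!: assms(1,2))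

text \<open>The coefficients are polynomials in the values of \<open>c\<close> and \<open>f\<close>,
  so every class of functions that contains the constants and is closed under sums and products
  contains them. It serves both holomorphy and moderate growth.\<close>

lemma coeff_lag_coeff_closed:
  fixes C :: "(complex \<Rightarrow> complex) \<Rightarrow> bool"
  assumes const: "\<And>c. C (\<lambda>z. c)" and add: "\<And>g h. C g \<Longrightarrow> C h \<Longrightarrow> C (\<lambda>z. g z + h z)"
    and mult: "\<And>g h. C g \<Longrightarrow> C h \<Longrightarrow> C (\<lambda>z. g z * h z)"
    and S: "finite S" and c: "\<And>P. P \<in> S \<Longrightarrow> C (c P)" and f: "\<And>P. P \<in> S \<Longrightarrow> C (f P)"
  shows "C (\<lambda>z. coeff (lag_coeff S (\<lambda>P. c P z) (\<lambda>P. f P z)) k)"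
proof -
  note sumC = sum_closed[where C = C, OF const add]
  have multP: "\<forall>k. C (\<lambda>z. coeff (p z * q z) k)" if "\<forall>k. C (\<lambda>z. coeff (p z) k)" "\<forall>k. C (\<lambda>z. coeff (q z) k)" for p q
    unfolding coeff_mult using that by (auto intro!: sumC mult)
  have prodP: "\<forall>k. C (\<lambda>z. coeff (\<Prod>Q\<in>I. [:- f Q z, 1:]) k)" if "finite I" "I \<subseteq> S" for I
    using that
  proof (induction rule: finite_induct)
    case empty
    thus ?case by (auto intro!: const)
  next
    case (insert x I)
    have "\<forall>k. C (\<lambda>z. coeff [:- f x z, 1:] k)"
    proof
      fix k show "C (\<lambda>z. coeff [:- f x z, 1:] k)"
      proof (cases k)
        case 0
        have "C (\<lambda>z. (-1) * f x z)" using insert.prems by (intro mult const f) auto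
        thus ?thesis using 0 by simp
      next
        case (Suc k')
        thus ?thesis by (simp add: const)
      qed
    qed
    moreover have "\<forall>k. C (\<lambda>z. coeff (\<Prod>Q\<in>I. [:- f Q z, 1:]) k)" using insert by auto
    ultimately have "\<forall>k. C (\<lambda>z. coeff ([:- f x z, 1:] * (\<Prod>Q\<in>I. [:- f Q z, 1:])) k)" by (rule multP)
    thus ?case using insert.hyps by (simp only: prod.insert simp_thms if_False)
  qed
  have "C (\<lambda>z. \<Sum>P\<in>S. c P z * coeff (\<Prod>Q\<in>S - {P}. [:- f Q z, 1:]) k)"
    using S prodP by (intro sumC mult c) auto
  thus ?thesis by (simp add: lag_coeff_def coeff_sum)
qed

section \<open>Cut planes and moderate growth\<close>

definition cut_plane :: "complex set" where "cut_plane = {z. Im z \<noteq> 0 \<or> Re z < 0}"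
text \<open>The two open half-planes, joined through a window \<open>I\<close> of the real
  axis.\<close>

definition cross_plane :: "real set \<Rightarrow> complex set" where "cross_plane I = {z. Im z \<noteq> 0 \<or> Re z \<in> I}"

lemma open_cross_plane: "open I \<Longrightarrow> open (cross_plane I)"
proof -
  assume "open I"
  hence "open (Re -` I)" by (intro open_vimage continuous_intros)
  moreover have "open {z. Im z < 0}" "open {z. Im z > 0}" by (auto intro: open_halfspace_Im_lt open_halfspace_Im_gt)
  moreover have "cross_plane I = Re -` I \<union> {z. Im z < 0} \<union> {z. Im z > 0}"
    by (auto simp: cross_plane_def)
  ultimately show ?thesis by (auto intro: open_Un)
qed

lemma cut_plane_eq: "cut_plane = cross_plane {..<0}"
  by (auto simp: cut_plane_def cross_plane_def)

text \<open>A single gauge for the three singular points infinity, 0 and 1. The leading 1 makes its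
  powers increase with the exponent.\<close>

definition growth :: "complex \<Rightarrow> real" where
  "growth z = 1 + norm z + 1 / norm z + 1 / norm (z - 1)"

lemma growth_ge_1: "growth z \<ge> 1"
  by (simp add: growth_def)

text \<open>Only nonreal points are tested: there a function coincides with its extensions across
  the windows, and the bound reaches real points by continuity.\<close>

definition moderate :: "(complex \<Rightarrow> complex) \<Rightarrow> bool" where
  "moderate h \<longleftrightarrow> (\<exists>C N. \<forall>z. Im z \<noteq> 0 \<longrightarrow> norm (h z) \<le> C * growth z ^ N)"

lemma moderateI: "(\<And>z. Im z \<noteq> 0 \<Longrightarrow> norm (h z) \<le> C * growth z ^ N) \<Longrightarrow> moderate h"
  by (auto simp: moderate_def)

lemma moderateD:
  assumes "moderate h"
  shows "\<exists>C N. C \<ge> 0 \<and> (\<forall>z M. Im z \<noteq> 0 \<longrightarrow> M \<ge> N \<longrightarrow> norm (h z) \<le> C * growth z ^ M)"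
proof -
  obtain C N where *: "\<And>z. Im z \<noteq> 0 \<Longrightarrow> norm (h z) \<le> C * growth z ^ N"
    using assms by (auto simp: moderate_def)
  have "norm (h z) \<le> max C 0 * growth z ^ M" if "Im z \<noteq> 0" "M \<ge> N" for z M
  proof -
    have "norm (h z) \<le> C * growth z ^ N" using * that by simp
    also have "\<dots> \<le> max C 0 * growth z ^ M"
      using growth_ge_1[of z] that by (intro mult_mono power_increasing) auto
    finally show ?thesis .
  qed
  thus ?thesis by (intro exI[of _ "max C 0"] exI[of _ N]) auto
qed

lemma moderate_const: "moderate (\<lambda>z. c)"
  by (rule moderateI[of _ "norm c" 0]) simp

lemma moderate_add:
  assumes "moderate g" "moderate h"
  shows "moderate (\<lambda>z. g z + h z)"
proof -
  obtain C N where 1: "C \<ge> 0" "\<And>z M. Im z \<noteq> 0 \<Longrightarrow> M \<ge> N \<Longrightarrow> norm (g z) \<le> C * growth z ^ M" using moderateD[OF assms(1)] by blast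
  obtain D K where 2: "D \<ge> 0" "\<And>z M. Im z \<noteq> 0 \<Longrightarrow> M \<ge> K \<Longrightarrow> norm (h z) \<le> D * growth z ^ M" using moderateD[OF assms(2)] by blast
  show ?thesis
  proof (rule moderateI)
    fix z assume "Im z \<noteq> 0"
    show "norm (g z + h z) \<le> (C + D) * growth z ^ (N + K)"
      using norm_triangle_mono[OF 1(2)[of z "N + K"] 2(2)[of z "N + K"]] \<open>Im z \<noteq> 0\<close> by (simp add: distrib_right)
  qed
qed

lemma moderate_mult:
  assumes "moderate g" "moderate h"
  shows "moderate (\<lambda>z. g z * h z)"
proof -
  obtain C N where 1: "C \<ge> 0" "\<And>z M. Im z \<noteq> 0 \<Longrightarrow> M \<ge> N \<Longrightarrow> norm (g z) \<le> C * growth z ^ M" using moderateD[OF assms(1)] by blast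
  obtain D K where 2: "D \<ge> 0" "\<And>z M. Im z \<noteq> 0 \<Longrightarrow> M \<ge> K \<Longrightarrow> norm (h z) \<le> D * growth z ^ M" using moderateD[OF assms(2)] by blast
  show ?thesis
  proof (rule moderateI)
    fix z assume z: "Im z \<noteq> 0"
    have "norm (g z * h z) \<le> (C * growth z ^ N) * (D * growth z ^ K)"
      unfolding norm_mult using 1(2)[OF z order_refl] 2(2)[OF z order_refl] order_trans[OF norm_ge_zero 1(2)[OF z order_refl]]
      by (intro mult_mono) auto
    thus "norm (g z * h z) \<le> (C * D) * growth z ^ (N + K)" by (simp add: power_add mult_ac)
  qed
qed

text \<open>Being analytic across both \<open>{0<..<1}\<close> and \<open>{1<..}\<close> with the same values in the two half-planes
  replaces analytic continuation along paths in the twice punctured plane.\<close>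
definition single_valued :: "(complex \<Rightarrow> complex) \<Rightarrow> bool" where
  "single_valued h \<longleftrightarrow> h holomorphic_on cut_plane \<and> moderate h \<and>
     (\<exists>h0. h0 holomorphic_on cross_plane {0<..<1} \<and> (\<forall>z. Im z \<noteq> 0 \<longrightarrow> h0 z = h z)) \<and>
     (\<exists>h1. h1 holomorphic_on cross_plane {1<..} \<and> (\<forall>z. Im z \<noteq> 0 \<longrightarrow> h1 z = h z))"

text \<open>The pieces glue to a function on the plane without 0 and 1; moderate growth makes these
  points at most poles and Liouville's theorem leaves a polynomial. All large exponents
  \<open>M\<close> are allowed so that several functions can share one denominator.\<close>

lemma single_valued_rational:
  assumes "single_valued h"
  shows "\<exists>N. \<forall>M\<ge>N. \<exists>p. \<forall>z\<in>cut_plane. z ^ M * (z - 1) ^ M * h z = poly p z"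
proof -
  obtain h0 h1 where h: "h holomorphic_on cut_plane" "moderate h"
    and h0: "h0 holomorphic_on cross_plane {0<..<1}" "\<And>z. Im z \<noteq> 0 \<Longrightarrow> h0 z = h z"
    and h1: "h1 holomorphic_on cross_plane {1<..}" "\<And>z. Im z \<noteq> 0 \<Longrightarrow> h1 z = h z"
    using assms by (auto simp: single_valued_def)
  obtain C N where C: "C \<ge> 0" "\<And>z M. Im z \<noteq> 0 \<Longrightarrow> M \<ge> N \<Longrightarrow> norm (h z) \<le> C * growth z ^ M"
    using moderateD[OF h(2)] by blast
  \<comment> \<open>The cut plane and the two crossing planes cover everything but 0 and 1, and any
    two of the functions agree off the real axis.\<close>
  define H where "H z = (if z \<in> cut_plane then h z else if Re z > 1 then h1 z else h0 z)" for z
  have op: "open cut_plane" "open (cross_plane {0<..<1})" "open (cross_plane {1<..})"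
    unfolding cut_plane_eq by (intro open_cross_plane; simp)+
  have H: "H holomorphic_on - {0, 1}"
  proof -
    have 1: "H holomorphic_on cut_plane"
      by (rule holomorphic_transform[OF h(1)]) (simp add: H_def)
    have 2: "H holomorphic_on cross_plane {0<..<1}"
      by (rule holomorphic_transform[OF h0(1)]) (auto simp: H_def cut_plane_def cross_plane_def h0(2))
    have 3: "H holomorphic_on cross_plane {1<..}"
      by (rule holomorphic_transform[OF h1(1)]) (auto simp: H_def cut_plane_def cross_plane_def h1(2))
    have "H holomorphic_on cut_plane \<union> cross_plane {0<..<1} \<union> cross_plane {1<..}"
      using 1 2 3 op by (intro holomorphic_on_Un) auto
    moreover have "- {0, 1} \<subseteq> cut_plane \<union> cross_plane {0<..<1} \<union> cross_plane {1<..}"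
      by (auto simp: cut_plane_def cross_plane_def complex_eq_iff)
    ultimately show ?thesis by (rule holomorphic_on_subset)
  qed
  have Hcont: "isCont H z" if "z \<noteq> 0" "z \<noteq> 1" for z
  proof -
    have "open (- {0, 1 :: complex})" by (intro open_Compl finite_imp_closed) auto
    thus ?thesis using holomorphic_on_imp_continuous_on[OF H] that by (simp add: continuous_on_eq_continuous_at)
  qed
  have Hb: "norm (H z) \<le> C * growth z ^ N" if z: "z \<noteq> 0" "z \<noteq> 1" for z
  proof (cases "Im z = 0")
    case False
    thus ?thesis using C(2)[of z N] by (simp add: H_def cut_plane_def)
  next
    case True
    \<comment> \<open>A real point is approached vertically through the upper half-plane, where the
      bound is known.\<close>
    define w where "w n = z + of_real (inverse (real (Suc n))) * \<i>" for n
    have w: "w \<longlonglongrightarrow> z + of_real 0 * \<i>" unfolding w_def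
      by (intro tendsto_intros LIMSEQ_inverse_real_of_nat)
    hence w: "w \<longlonglongrightarrow> z" by simp
    have cg: "isCont growth z" unfolding growth_def using z by (intro continuous_intros) auto
    show ?thesis
    proof (rule LIMSEQ_le)
      show "(\<lambda>n. norm (H (w n))) \<longlonglongrightarrow> norm (H z)"
        by (intro tendsto_norm isCont_tendsto_compose[OF Hcont[OF z] w])
      show "(\<lambda>n. C * growth (w n) ^ N) \<longlonglongrightarrow> C * growth z ^ N"
        by (intro tendsto_intros isCont_tendsto_compose[OF cg w])
      have "Im (w n) \<noteq> 0" for n using True by (simp add: w_def)
      thus "\<exists>n0. \<forall>n\<ge>n0. norm (H (w n)) \<le> C * growth (w n) ^ N"
        using C(2)[of _ N] by (auto simp: H_def cut_plane_def)
    qed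
  qed
  \<comment> \<open>One power beyond the growth exponent makes \<open>Q\<close> tend to 0 at 0 and
    at 1, where its value is 0 too. So both singularities are removable.\<close>
  have main: "\<exists>p. \<forall>z\<in>cut_plane. z ^ M * (z - 1) ^ M * h z = poly p z" if M: "M \<ge> Suc N" for M
  proof -
    define Q where "Q z = z ^ M * (z - 1) ^ M * H z" for z
    have gb: "growth z * (norm z * norm (z - 1)) \<le> 4 * (1 + norm z) ^ 3" if z: "z \<noteq> 0" "z \<noteq> 1" for z
    proof -
      have "growth z * (norm z * norm (z - 1)) = (1 + norm z) * norm z * norm (z - 1) + norm (z - 1) + norm z"
        using z by (simp add: growth_def field_simps)
      also have "\<dots> \<le> (1 + norm z) * norm z * (1 + norm z) + (1 + norm z) + norm z"
        using norm_triangle_ineq4[of z 1] by (intro add_mono mult_left_mono) auto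
      also have "\<dots> \<le> 4 * (1 + norm z) ^ 3"
        by (simp add: power3_eq_cube algebra_simps)
      finally show ?thesis .
    qed
    have Qb: "norm (Q z) \<le> C * (4 * (1 + norm z) ^ 3) ^ N * (norm z * norm (z - 1)) ^ (M - N)" for z
    proof (cases "z = 0 \<or> z = 1")
      case False
      have "norm (Q z) = (norm z * norm (z - 1)) ^ M * norm (H z)"
        by (simp add: Q_def norm_mult norm_power power_mult_distrib)
      also have "\<dots> \<le> (norm z * norm (z - 1)) ^ M * (C * growth z ^ N)"
        using Hb[of z] False by (intro mult_left_mono) auto
      also have "(norm z * norm (z - 1)) ^ M = (norm z * norm (z - 1)) ^ (M - N) * (norm z * norm (z - 1)) ^ N"
        using M by (simp add: power_add[symmetric])
      also have "(norm z * norm (z - 1)) ^ (M - N) * (norm z * norm (z - 1)) ^ N * (C * growth z ^ N) =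
           C * (growth z * (norm z * norm (z - 1))) ^ N * (norm z * norm (z - 1)) ^ (M - N)"
        by (simp add: power_mult_distrib mult_ac)
      also have "\<dots> \<le> C * (4 * (1 + norm z) ^ 3) ^ N * (norm z * norm (z - 1)) ^ (M - N)"
        using gb[of z] False C growth_ge_1[of z] by (intro mult_right_mono mult_left_mono power_mono) auto
      finally show ?thesis .
    next
      case True
      hence "Q z = 0" using M by (auto simp: Q_def power_0_left)
      thus ?thesis using C(1) by simp
    qed
    have Qc: "isCont Q a" if a: "a = 0 \<or> a = 1" for a
    proof -
      have Qa: "Q a = 0" using a M by (auto simp: Q_def)
      have "((\<lambda>z. C * (4 * (1 + norm z) ^ 3) ^ N * (norm z * norm (z - 1)) ^ (M - N)) \<longlongrightarrow>
           C * (4 * (1 + norm a) ^ 3) ^ N * (norm a * norm (a - 1)) ^ (M - N)) (at a)"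
        by (intro tendsto_intros)
      moreover have "C * (4 * (1 + norm a) ^ 3) ^ N * (norm a * norm (a - 1)) ^ (M - N) = 0" using a M by auto
      ultimately have "((\<lambda>z. C * (4 * (1 + norm z) ^ 3) ^ N * (norm z * norm (z - 1)) ^ (M - N)) \<longlongrightarrow> 0) (at a)" by (simp only:)
      hence "(Q \<longlongrightarrow> 0) (at a)" by (rule Lim_null_comparison[OF always_eventually, rotated]) (use Qb in blast)
      thus ?thesis by (simp add: isCont_def Qa)
    qed
    have "Q holomorphic_on - {0, 1}" unfolding Q_def by (intro holomorphic_intros H)
    hence Q1: "Q holomorphic_on UNIV - {0, 1}" by (simp add: Compl_eq_Diff_UNIV)
    have "continuous_on UNIV Q"
    proof (intro continuous_at_imp_continuous_on ballI)
      fix z show "isCont Q z"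
      proof (cases "z = 0 \<or> z = 1")
        case False
        thus ?thesis unfolding Q_def using Hcont by (intro continuous_intros) auto
      qed (rule Qc)
    qed
    hence Qhol: "Q holomorphic_on UNIV" using Q1 by (rule no_isolated_singularity) auto
    define n where "n = 3 * N + 2 * (M - N)"
    define K where "K = C * (4 * 8) ^ N * 2 ^ (M - N)"
    have "norm (Q z) \<le> K * norm z ^ n" if z: "norm z \<ge> 1" for z
    proof -
      have "norm (Q z) \<le> C * (4 * (1 + norm z) ^ 3) ^ N * (norm z * norm (z - 1)) ^ (M - N)" by (rule Qb)
      also have "\<dots> \<le> C * (4 * (2 * norm z) ^ 3) ^ N * (norm z * (2 * norm z)) ^ (M - N)"
        using z C norm_triangle_ineq4[of z 1] by (intro mult_mono mult_left_mono power_mono) auto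
      also have "\<dots> = K * norm z ^ n"
        by (simp add: K_def n_def power_mult_distrib power_add power_mult power2_eq_square power3_eq_cube mult_ac)
      finally show ?thesis .
    qed
    hence Qp: "Q z = (\<Sum>k\<le>n. (deriv ^^ k) Q 0 / fact k * z ^ k)" for z
      by (rule Liouville_polynomial[OF Qhol])
    show ?thesis
    proof (intro exI[of _ "\<Sum>k\<le>n. monom ((deriv ^^ k) Q 0 / fact k) k"] ballI)
      fix z assume "z \<in> cut_plane"
      hence "z ^ M * (z - 1) ^ M * h z = Q z" by (simp add: Q_def H_def)
      thus "z ^ M * (z - 1) ^ M * h z = poly (\<Sum>k\<le>n. monom ((deriv ^^ k) Q 0 / fact k) k) z"
        using Qp[of z] by (simp add: poly_sum poly_monom)
    qed
  qed
  thus ?thesis by blast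
qed

section \<open>Branches on the cut plane\<close>

text \<open>The strip is the logarithm with imaginary part from 0 to 2 pi: just below the positive
  axis it is \<open>Ln z + 2 * pi * \<i>\<close>, just above it \<open>Ln z\<close>. The hypothesis
  \<open>eq\<close> makes the glued function continuous on \<open>I\<close>, and continuity across a
  line suffices for holomorphy.\<close>

lemma holomorphic_glue_strip:
  assumes F: "continuous_on closed_strip F" "F holomorphic_on open_strip"
    and G: "continuous_on closed_strip G" "G holomorphic_on open_strip"
    and I: "open I" "I \<subseteq> {0<..}" and eq: "\<And>x. x \<in> I \<Longrightarrow> F (of_real (ln x) + 2 * pi * \<i>) = G (of_real (ln x))"
  shows "(\<lambda>z. if Im z \<le> 0 then F (Ln z + 2 * pi * \<i>) else G (Ln z)) holomorphic_on cross_plane I"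
proof -
  define h where "h z = (if Im z \<le> 0 then F (Ln z + 2 * pi * \<i>) else G (Ln z))" for z
  have nz: "z \<notin> \<real>\<^sub>\<le>\<^sub>0" if "z \<in> cross_plane I" for z
    using that I by (auto simp: cross_plane_def complex_nonpos_Reals_iff)
  have lnc: "continuous_on T Ln" if "T \<subseteq> cross_plane I" for T
    using that nz by (intro continuous_on_Ln continuous_on_id) auto
  have Im_neg: "Im (Ln z) < 0" "Im (Ln z) > - pi" if "Im z < 0" for z
  proof -
    have z: "z \<noteq> 0" using that by auto
    show "Im (Ln z) > - pi" using z by (rule mpi_less_Im_Ln)
    show "Im (Ln z) < 0" using Im_Ln_pos_le[OF z] Im_Ln_le_pi[OF z] that by linarith
  qed
  have Im_pos: "Im (Ln z) > 0" "Im (Ln z) < pi" if "Im z > 0" for z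
    using Im_Ln_pos_lt_imp[OF that] by auto
  have real: "Ln z = of_real (ln (Re z))" "Re z \<in> I" if "Im z = 0" "z \<in> cross_plane I" for z
  proof -
    show "Re z \<in> I" using that by (simp add: cross_plane_def)
    hence "Re z > 0" using I by auto
    moreover have "z = of_real (Re z)" using that by (simp add: complex_eq_iff)
    ultimately show "Ln z = of_real (ln (Re z))" using Ln_of_real by metis
  qed
  have pp: "pi > 0" by simp
  have "continuous_on (cross_plane I) h" unfolding h_def
  proof (rule continuous_on_cases_le)
    show "continuous_on {z \<in> cross_plane I. Im z \<le> 0} (\<lambda>z. F (Ln z + 2 * pi * \<i>))"
    proof (rule continuous_on_compose2[OF F(1)])
      show "continuous_on {z \<in> cross_plane I. Im z \<le> 0} (\<lambda>z. Ln z + 2 * pi * \<i>)"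
        by (intro continuous_intros lnc) auto
      show "(\<lambda>z. Ln z + 2 * pi * \<i>) ` {z \<in> cross_plane I. Im z \<le> 0} \<subseteq> closed_strip"
      proof safe
        fix z assume z: "z \<in> cross_plane I" "Im z \<le> 0"
        show "0 \<le> Im (Ln z + 2 * pi * \<i>)" "Im (Ln z + 2 * pi * \<i>) \<le> 2 * pi"
          using z real(1)[of z] Im_neg[of z] pp by (cases "Im z = 0"; simp)+
      qed
    qed
    show "continuous_on {z \<in> cross_plane I. 0 \<le> Im z} (\<lambda>z. G (Ln z))"
    proof (rule continuous_on_compose2[OF G(1)])
      show "continuous_on {z \<in> cross_plane I. 0 \<le> Im z} Ln" by (rule lnc) auto
      show "Ln ` {z \<in> cross_plane I. 0 \<le> Im z} \<subseteq> closed_strip"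
      proof safe
        fix z assume z: "z \<in> cross_plane I" "0 \<le> Im z"
        show "0 \<le> Im (Ln z)" "Im (Ln z) \<le> 2 * pi"
          using z real(1)[of z] Im_pos[of z] pp by (cases "Im z = 0"; simp)+
      qed
    qed
    show "F (Ln z + 2 * pi * \<i>) = G (Ln z)" if "z \<in> cross_plane I" "Im z = 0" for z
      using real[OF that(2,1)] eq by simp
  qed (intro continuous_intros)
  moreover have "h holomorphic_on cross_plane I \<inter> {z. \<i> \<bullet> z < 0}"
  proof -
    have "(F \<circ> (\<lambda>z. Ln z + 2 * pi * \<i>)) holomorphic_on {z. Im z < 0}"
    proof (rule holomorphic_on_compose_gen[OF _ F(2)])
      show "(\<lambda>z. Ln z + 2 * pi * \<i>) holomorphic_on {z. Im z < 0}"
        by (intro holomorphic_intros) (auto simp: complex_nonpos_Reals_iff)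
      show "(\<lambda>z. Ln z + 2 * pi * \<i>) ` {z. Im z < 0} \<subseteq> open_strip"
      proof safe
        fix z assume "Im z < 0"
        thus "0 < Im (Ln z + 2 * pi * \<i>)" "Im (Ln z + 2 * pi * \<i>) < 2 * pi" using Im_neg[of z] pp by simp_all
      qed
    qed
    hence "h holomorphic_on {z. Im z < 0}" by (rule holomorphic_transform) (simp add: h_def)
    thus ?thesis by (rule holomorphic_on_subset) (auto simp: inner_complex_def)
  qed
  moreover have "h holomorphic_on cross_plane I \<inter> {z. 0 < \<i> \<bullet> z}"
  proof -
    have "(G \<circ> Ln) holomorphic_on {z. Im z > 0}"
    proof (rule holomorphic_on_compose_gen[OF _ G(2)])
      show "Ln holomorphic_on {z. Im z > 0}"
        by (intro holomorphic_intros) (auto simp: complex_nonpos_Reals_iff)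
      show "Ln ` {z. Im z > 0} \<subseteq> open_strip"
      proof safe
        fix z assume "Im z > 0"
        thus "0 < Im (Ln z)" "Im (Ln z) < 2 * pi" using Im_pos[of z] pp by linarith+
      qed
    qed
    hence "h holomorphic_on {z. Im z > 0}" by (rule holomorphic_transform) (simp add: h_def)
    thus ?thesis by (rule holomorphic_on_subset) (auto simp: inner_complex_def)
  qed
  ultimately have "h holomorphic_on cross_plane I"
    by (rule holomorphic_on_paste_across_line[OF open_cross_plane[OF I(1)] complex_i_not_zero, rotated 2])
  thus ?thesis by (simp add: h_def[abs_def])
qed

text \<open>The branch of the logarithm cut along the nonnegative reals, with imaginary part
  strictly between 0 and 2 pi.\<close>

definition lg :: "complex \<Rightarrow> complex" where "lg z = Ln (- z) + pi * \<i>"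

lemma lg_upper: "Im z > 0 \<Longrightarrow> lg z = Ln z"
  unfolding lg_def by (subst Ln_minus) auto

lemma lg_lower: "Im z < 0 \<Longrightarrow> lg z = Ln z + 2 * pi * \<i>"
  unfolding lg_def by (subst Ln_minus) auto

lemma cut_planeD:
  assumes "z \<in> cut_plane"
  shows "z \<noteq> 0" "- z \<notin> \<real>\<^sub>\<le>\<^sub>0"
  using assms by (auto simp: cut_plane_def complex_nonpos_Reals_iff)

lemma lg_strip:
  assumes "z \<in> cut_plane"
  shows "0 < Im (lg z)" "Im (lg z) < 2 * pi" "exp (lg z) = z" "Re (lg z) = ln (norm z)"
    "norm (lg z) \<le> \<bar>ln (norm z)\<bar> + 2 * pi"
proof -
  note z = cut_planeD[OF assms]
  show im: "0 < Im (lg z)" "Im (lg z) < 2 * pi"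
    using z Im_Ln_less_pi[of "-z"] mpi_less_Im_Ln[of "-z"] by (auto simp: lg_def)
  show "exp (lg z) = z" using z by (simp add: lg_def exp_add exp_pi_i')
  show re: "Re (lg z) = ln (norm z)" using z by (simp add: lg_def)
  show "norm (lg z) \<le> \<bar>ln (norm z)\<bar> + 2 * pi"
    using cmod_le[of "lg z"] im re by simp
qed

lemma lg_holomorphic: "lg holomorphic_on cut_plane"
  unfolding lg_def using cut_planeD by (intro holomorphic_intros) auto

section \<open>Cauchy estimates on discs avoiding the singular points\<close>

lemma norm_le_componentwise: "\<bar>Re a\<bar> \<le> \<bar>Re b\<bar> \<Longrightarrow> \<bar>Im a\<bar> \<le> \<bar>Im b\<bar> \<Longrightarrow> norm a \<le> norm b"
  unfolding cmod_def by (intro real_sqrt_le_mono add_mono) (simp_all add: abs_le_square_iff)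

text \<open>This and the next two lemmas select by Re z a domain that contains a whole Cauchy disc
  about z. A real point outside the window is, coordinate by coordinate, at least as far from z as 0
  or 1, but the radius is at most half that distance.\<close>

lemma cball_subset_cut_plane:
  assumes "Im z \<noteq> 0" "Re z \<le> 0" "\<rho> \<le> norm z / 2"
  shows "cball z \<rho> \<subseteq> cut_plane"
proof
  fix w assume w: "w \<in> cball z \<rho>"
  show "w \<in> cut_plane"
  proof (rule ccontr)
    assume "w \<notin> cut_plane"
    hence "norm z \<le> norm (z - w)" using assms by (intro norm_le_componentwise) (auto simp: cut_plane_def)
    moreover have "norm z > 0" using assms by auto
    ultimately show False using w assms(3) unfolding mem_cball dist_norm by linarith
  qed
qed

lemma cball_subset_cross_1:
  assumes "Im z \<noteq> 0" "Re z \<ge> 1" "\<rho> \<le> norm (z - 1) / 2"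
  shows "cball z \<rho> \<subseteq> cross_plane {1<..}"
proof
  fix w assume w: "w \<in> cball z \<rho>"
  show "w \<in> cross_plane {1<..}"
  proof (rule ccontr)
    assume "w \<notin> cross_plane {1<..}"
    hence "norm (z - 1) \<le> norm (z - w)" using assms by (intro norm_le_componentwise) (auto simp: cross_plane_def)
    moreover have "norm (z - 1) > 0" using assms by auto
    ultimately show False using w assms(3) unfolding mem_cball dist_norm by linarith
  qed
qed

lemma cball_subset_cross_0:
  assumes "Im z \<noteq> 0" "0 \<le> Re z" "Re z \<le> 1" "\<rho> \<le> norm z / 2" "\<rho> \<le> norm (z - 1) / 2"
  shows "cball z \<rho> \<subseteq> cross_plane {0<..<1}"
proof
  fix w assume w: "w \<in> cball z \<rho>"
  show "w \<in> cross_plane {0<..<1}"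
  proof (rule ccontr)
    assume "w \<notin> cross_plane {0<..<1}"
    hence "Im w = 0" "Re w \<le> 0 \<or> Re w \<ge> 1" by (auto simp: cross_plane_def)
    hence "norm z \<le> norm (z - w) \<or> norm (z - 1) \<le> norm (z - w)"
      using assms by (auto intro!: norm_le_componentwise)
    moreover have "norm (z - 1) > 0" "norm z > 0" using assms by auto
    ultimately show False using w assms(4,5) unfolding mem_cball dist_norm by linarith
  qed
qed

lemma abs_ln_le_growth: "z \<noteq> 0 \<Longrightarrow> 1 + \<bar>ln (norm z)\<bar> \<le> growth z"
proof -
  assume z: "z \<noteq> 0"
  have "ln (norm z) \<le> norm z - 1" using z by (intro ln_le_minus_one) simp
  moreover have "- ln (norm z) \<le> 1 / norm z - 1" using z ln_le_minus_one[of "1 / norm z"] by (simp add: ln_div)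
  moreover have "1 / norm z \<ge> 0" "1 / norm (z - 1) \<ge> 0" "norm z \<ge> 0" by simp_all
  ultimately show ?thesis unfolding growth_def by linarith
qed

lemma exp_abs_ln_le_growth: "z \<noteq> 0 \<Longrightarrow> exp \<bar>ln (norm z)\<bar> \<le> growth z"
proof -
  assume z: "z \<noteq> 0"
  have "exp \<bar>ln (norm z)\<bar> = norm z \<or> exp \<bar>ln (norm z)\<bar> = 1 / norm z"
    using z by (cases "ln (norm z) \<ge> 0") (auto simp: exp_minus inverse_eq_divide)
  moreover have "1 / norm z \<ge> 0" "1 / norm (z - 1) \<ge> 0" "norm z \<ge> 0" by simp_all
  ultimately show ?thesis unfolding growth_def by linarith
qed

text \<open>Cauchy's inequality on a circle of half the distance to 0 and 1. Along it ln |w| differs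
  from ln |z| by at most ln 2 < 1. The three powers of \<open>growth\<close> pay for the factor z,
  for the logarithm and for 1 / \<open>\<rho>\<close>.\<close>

lemma norm_z_deriv_le:
  assumes z: "Im z \<noteq> 0" and \<rho>: "\<rho> = min (norm z) (norm (z - 1)) / 2" and D: "open D" "cball z \<rho> \<subseteq> D"
    and G: "G holomorphic_on D" and b: "\<And>w. w \<in> D \<Longrightarrow> norm (G w) \<le> K * (1 + \<bar>ln (norm w)\<bar>)"
  shows "norm (z * deriv G z) \<le> 4 * K * growth z ^ 3"
proof -
  have nz: "z \<noteq> 0" "z \<noteq> 1" using z by auto
  have \<rho>0: "\<rho> > 0" using nz by (simp add: \<rho>)
  have zD: "z \<in> D" using D(2) \<rho>0 by auto
  have K0: "K \<ge> 0"
  proof -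
    have "0 \<le> K * (1 + \<bar>ln (norm z)\<bar>)" using order_trans[OF norm_ge_zero b[OF zD]] .
    moreover have "1 + \<bar>ln (norm z)\<bar> > 0" by linarith
    ultimately show ?thesis by (simp add: zero_le_mult_iff)
  qed
  have "norm ((deriv ^^ 1) G z) \<le> fact 1 * (2 * K * growth z) / \<rho> ^ 1"
  proof (rule Cauchy_inequality[OF _ _ \<rho>0])
    show "G holomorphic_on ball z \<rho>" using G D(2) by (meson ball_subset_cball holomorphic_on_subset)
    show "continuous_on (cball z \<rho>) G" using G D(2) by (meson holomorphic_on_imp_continuous_on continuous_on_subset)
    fix w assume w: "norm (z - w) = \<rho>"
    hence wD: "w \<in> D" using D(2) by (auto simp: dist_norm)
    have r: "\<rho> \<le> norm z / 2" by (simp add: \<rho>)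
    have "norm w \<ge> norm z - \<rho>" "norm w \<le> norm z + \<rho>"
      using w norm_triangle_ineq2[of z w] norm_triangle_ineq2[of w z] by (simp_all add: norm_minus_commute)
    hence w2: "norm z / 2 \<le> norm w" "norm w \<le> 2 * norm z" using r norm_ge_zero[of z] by linarith+
    have wp: "norm w > 0" using w2 nz by (smt (verit) zero_less_norm_iff half_gt_zero)
    have "ln (norm w) \<le> ln (2 * norm z)" using w2 wp nz by (subst ln_le_cancel_iff) auto
    also have "\<dots> = ln 2 + ln (norm z)" using nz by (simp add: ln_mult)
    finally have 1: "ln (norm w) \<le> ln 2 + ln (norm z)" .
    have "ln (norm z / 2) \<le> ln (norm w)" using w2 wp nz by simp
    hence 2: "ln (norm z) - ln 2 \<le> ln (norm w)" using nz by (simp add: ln_div)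
    have "\<bar>ln (norm w)\<bar> \<le> \<bar>ln (norm z)\<bar> + 1" using 1 2 ln_2_less_1 by linarith
    moreover have "1 + \<bar>ln (norm z)\<bar> \<le> growth z" "growth z \<ge> 1" using abs_ln_le_growth[OF nz(1)] growth_ge_1 by auto
    ultimately have "1 + \<bar>ln (norm w)\<bar> \<le> 2 * growth z" by linarith
    hence "K * (1 + \<bar>ln (norm w)\<bar>) \<le> K * (2 * growth z)" using K0 by (rule mult_left_mono)
    thus "norm (G w) \<le> 2 * K * growth z" using b[OF wD] by (simp add: mult_ac)
  qed
  hence 1: "norm (deriv G z) \<le> 2 * K * growth z * (1 / \<rho>)" by simp
  have 2: "1 / \<rho> \<le> 2 * growth z"
  proof (cases "norm z \<le> norm (z - 1)")
    case True
    hence "1 / \<rho> = 2 * (1 / norm z)" by (simp add: \<rho> min_def)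
    thus ?thesis by (simp add: growth_def)
  next
    case False
    hence "1 / \<rho> = 2 * (1 / norm (z - 1))" by (simp add: \<rho> min_def)
    thus ?thesis by (simp add: growth_def)
  qed
  have 3: "norm z \<le> growth z" by (simp add: growth_def)
  have g0: "growth z \<ge> 0" using growth_ge_1[of z] by linarith
  have "norm (z * deriv G z) \<le> growth z * (2 * K * growth z * (1 / \<rho>))"
    unfolding norm_mult using 1 3 g0 by (intro mult_mono) auto
  also have "\<dots> \<le> growth z * (2 * K * growth z * (2 * growth z))"
    using 2 g0 K0 by (intro mult_left_mono) auto
  finally show ?thesis by (simp add: power3_eq_cube mult_ac)
qed

context interlacing
begin

definition xf :: "complex poly \<Rightarrow> complex \<Rightarrow> complex" where "xf P z = X P (lg z)"

lemma xf_holomorphic: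
  assumes "degree P < card A"
  shows "xf P holomorphic_on cut_plane"
proof -
  have "(X P \<circ> lg) holomorphic_on cut_plane"
    by (rule holomorphic_on_compose_gen[OF lg_holomorphic X_holomorphic[OF assms]]) (use lg_strip in auto)
  thus ?thesis by (simp add: xf_def[abs_def] o_def)
qed

lemma log_bound:
  fixes w \<zeta> z :: complex
  assumes "K \<ge> 0" "norm \<zeta> \<le> \<bar>ln (norm z)\<bar> + 2 * pi" "norm w \<le> K * (1 + norm \<zeta>)"
  shows "norm w \<le> K * (1 + 2 * pi) * (1 + \<bar>ln (norm z)\<bar>)"
proof -
  have "1 + norm \<zeta> \<le> (1 + 2 * pi) * (1 + \<bar>ln (norm z)\<bar>)"
  proof -
    have "0 \<le> (2 * pi) * \<bar>ln (norm z)\<bar>" by (intro mult_nonneg_nonneg) auto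
    moreover have "(1 + 2 * pi) * (1 + \<bar>ln (norm z)\<bar>) = 1 + 2 * pi + \<bar>ln (norm z)\<bar> + (2 * pi) * \<bar>ln (norm z)\<bar>"
      by (simp add: algebra_simps)
    ultimately show ?thesis using assms(2) by linarith
  qed
  hence "K * (1 + norm \<zeta>) \<le> K * ((1 + 2 * pi) * (1 + \<bar>ln (norm z)\<bar>))" using assms(1) by (rule mult_left_mono)
  thus ?thesis using assms(3) by (simp add: mult_ac)
qed

lemma X_linear_bound':
  assumes "degree P < card A"
  obtains K where "K \<ge> 0" "\<And>\<zeta>. 0 \<le> Im \<zeta> \<Longrightarrow> Im \<zeta> \<le> 2 * pi \<Longrightarrow> norm (X P \<zeta>) \<le> K * (1 + norm \<zeta>)"
proof -
  obtain K where K: "\<And>\<zeta>. 0 \<le> Im \<zeta> \<Longrightarrow> Im \<zeta> \<le> 2 * pi \<Longrightarrow> norm (X P \<zeta>) \<le> K * (1 + norm \<zeta>)"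
    using X_linear_bound[OF assms] by blast
  moreover have "K \<ge> 0" using order_trans[OF norm_ge_zero K[of 0]] by simp
  ultimately show ?thesis using that by blast
qed

lemma xf_bound:
  assumes "degree P < card A"
  shows "\<exists>K\<ge>0. \<forall>z\<in>cut_plane. norm (xf P z) \<le> K * (1 + \<bar>ln (norm z)\<bar>)"
proof -
  obtain K where K: "K \<ge> 0" "\<And>\<zeta>. 0 \<le> Im \<zeta> \<Longrightarrow> Im \<zeta> \<le> 2 * pi \<Longrightarrow> norm (X P \<zeta>) \<le> K * (1 + norm \<zeta>)"
    using X_linear_bound'[OF assms] by blast
  have "norm (xf P z) \<le> K * (1 + 2 * pi) * (1 + \<bar>ln (norm z)\<bar>)" if "z \<in> cut_plane" for z
    unfolding xf_def using lg_strip[OF that] by (intro log_bound[OF K(1) lg_strip(5)[OF that]] K(2)) auto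
  moreover have "K * (1 + 2 * pi) \<ge> 0" using K(1) by simp
  ultimately show ?thesis by blast
qed

text \<open>The additive constant of \<open>cross_infinity\<close> or \<open>cross_zero\<close>. The
  test \<open>Y = A\<close> separates the two crossings since \<open>A\<close> and \<open>B\<close>
  differ.\<close>

definition shift_const :: "real set \<Rightarrow> complex poly \<Rightarrow> complex" where
  "shift_const Y P = (if Y = A then 0 else - 2 * pi * \<i> * coeff P (card A - 1))"

definition cross_int :: "real set \<Rightarrow> real set" where
  "cross_int Y = (if Y = A then {1<..} else {0<..<1})"

lemma A_neq_B: "A \<noteq> B" using disj nonempty by auto

text \<open>Just below the positive axis \<open>lg\<close> is near the top of the strip, just above
  it near the bottom. So passing upwards through the window is the comparison of \<xi> + 2 pi i with
  \<xi> in the crossing lemmas.\<close>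

lemma cross_extension:
  assumes P: "degree P < card A" and Y: "Y = A \<or> Y = B"
  shows "\<exists>G K. G holomorphic_on cross_plane (cross_int Y) \<and> (\<forall>z. Im z < 0 \<longrightarrow> G z = xf P z) \<and>
    (\<forall>z. Im z > 0 \<longrightarrow> G z = xf (mono_step Y P) z + shift_const Y P) \<and>
    (\<forall>z\<in>cross_plane (cross_int Y). norm (G z) \<le> K * (1 + \<bar>ln (norm z)\<bar>))"
proof -
  define Q \<kappa> I where "Q = mono_step Y P" and "\<kappa> = shift_const Y P" and "I = cross_int Y"
  have Q: "degree Q < card A" unfolding Q_def using Y P by (rule degree_mono_step)
  have I: "open I" "I \<subseteq> {0<..}" using Y by (auto simp: I_def cross_int_def)
  define G where "G z = (if Im z \<le> 0 then X P (Ln z + 2 * pi * \<i>) else X Q (Ln z) + \<kappa>)" for z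
  have eq: "X P (of_real (ln x) + 2 * pi * \<i>) = X Q (of_real (ln x)) + \<kappa>" if x: "x \<in> I" for x
  proof (cases "Y = A")
    case True
    hence "ln x > 0" using x by (simp add: I_def cross_int_def)
    thus ?thesis using cross_infinity[OF P] True by (simp add: Q_def \<kappa>_def shift_const_def)
  next
    case False
    hence "ln x < 0" "Y = B" using x Y by (auto simp: I_def cross_int_def)
    thus ?thesis using cross_zero[OF P] False by (simp add: Q_def \<kappa>_def shift_const_def)
  qed
  have "(\<lambda>z. if Im z \<le> 0 then X P (Ln z + 2 * pi * \<i>) else X Q (Ln z) + \<kappa>) holomorphic_on cross_plane I"
    by (rule holomorphic_glue_strip[where G = "\<lambda>\<zeta>. X Q \<zeta> + \<kappa>"])
       (use X_continuous[OF P] X_continuous[OF Q] X_holomorphic[OF P] X_holomorphic[OF Q] I eq in \<open>auto intro!: continuous_intros holomorphic_intros\<close>)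
  hence hol: "G holomorphic_on cross_plane I" by (simp add: G_def[abs_def])
  obtain K1 where K1: "K1 \<ge> 0" "\<And>\<zeta>. 0 \<le> Im \<zeta> \<Longrightarrow> Im \<zeta> \<le> 2 * pi \<Longrightarrow> norm (X P \<zeta>) \<le> K1 * (1 + norm \<zeta>)"
    using X_linear_bound'[OF P] by blast
  obtain K2 where K2: "K2 \<ge> 0" "\<And>\<zeta>. 0 \<le> Im \<zeta> \<Longrightarrow> Im \<zeta> \<le> 2 * pi \<Longrightarrow> norm (X Q \<zeta>) \<le> K2 * (1 + norm \<zeta>)"
    using X_linear_bound'[OF Q] by blast
  define L where "L = 1 + 2 * pi"
  define K where "K = K1 * L + K2 * L + norm \<kappa>"
  have L0: "L \<ge> 0" by (simp add: L_def)
  have bd: "norm (G z) \<le> K * (1 + \<bar>ln (norm z)\<bar>)" if z: "z \<in> cross_plane I" for z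
  proof -
    have z0: "z \<noteq> 0" using z I by (auto simp: cross_plane_def)
    show ?thesis
    proof (cases "Im z \<le> 0")
      case True
      have im: "Im (Ln z) \<le> 0" "Im (Ln z) > - pi"
      proof -
        show "Im (Ln z) > - pi" using z0 mpi_less_Im_Ln by simp
        show "Im (Ln z) \<le> 0"
        proof (cases "Im z = 0")
          case True
          hence "Re z > 0" "z = of_real (Re z)" using z I by (auto simp: cross_plane_def complex_eq_iff)
          hence "Ln z = of_real (ln (Re z))" using Ln_of_real by metis
          thus ?thesis by simp
        next
          case False
          thus ?thesis using \<open>Im z \<le> 0\<close> Im_Ln_pos_le[OF z0] Im_Ln_le_pi[OF z0] by linarith
        qed
      qed
      have "norm (Ln z + 2 * pi * \<i>) \<le> \<bar>ln (norm z)\<bar> + 2 * pi"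
        using cmod_le[of "Ln z + 2 * pi * \<i>"] im z0 pi_gt_zero by simp
      hence "norm (X P (Ln z + 2 * pi * \<i>)) \<le> K1 * (1 + 2 * pi) * (1 + \<bar>ln (norm z)\<bar>)"
        by (rule log_bound[OF K1(1) _ K1(2)]) (use im pi_gt_zero in auto)
      also have "\<dots> \<le> K * (1 + \<bar>ln (norm z)\<bar>)"
        using K2(1) L0 by (intro mult_right_mono) (auto simp: K_def L_def[symmetric])
      finally show ?thesis using True by (simp add: G_def)
    next
      case False
      have im: "Im (Ln z) \<ge> 0" "Im (Ln z) \<le> pi"
        using False z0 Im_Ln_le_pi[of z] Im_Ln_pos_le[of z] by auto
      have "norm (Ln z) \<le> \<bar>ln (norm z)\<bar> + 2 * pi"
        using cmod_le[of "Ln z"] im z0 by simp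
      hence "norm (X Q (Ln z)) \<le> K2 * (1 + 2 * pi) * (1 + \<bar>ln (norm z)\<bar>)"
        by (rule log_bound[OF K2(1) _ K2(2)]) (use im pi_gt_zero in auto)
      moreover have "norm \<kappa> \<le> norm \<kappa> * (1 + \<bar>ln (norm z)\<bar>)" by (simp add: distrib_left)
      ultimately have "norm (X Q (Ln z) + \<kappa>) \<le> K2 * L * (1 + \<bar>ln (norm z)\<bar>) + norm \<kappa> * (1 + \<bar>ln (norm z)\<bar>)"
        unfolding L_def using norm_triangle_mono by blast
      also have "\<dots> = (K2 * L + norm \<kappa>) * (1 + \<bar>ln (norm z)\<bar>)" by (rule distrib_right[symmetric])
      also have "\<dots> \<le> K * (1 + \<bar>ln (norm z)\<bar>)"
        using K1(1) L0 by (intro mult_right_mono) (auto simp: K_def)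
      finally show ?thesis using False by (simp add: G_def)
    qed
  qed
  show ?thesis
    using hol bd unfolding I_def[symmetric]
    by (intro exI[of _ G] exI[of _ K]) (auto simp: G_def xf_def lg_upper lg_lower Q_def \<kappa>_def)
qed

end

section \<open>Linear independence of the branches\<close>

lemma degree_lag_coeff_less:
  assumes "finite S" "S \<noteq> {}"
  shows "degree (lag_coeff S c f) < card S"
proof -
  have "degree (lag_coeff S c f) \<le> card S - 1"
    unfolding lag_coeff_def
  proof (intro degree_sum_le assms(1) order_trans[OF degree_smult_le])
    fix P assume "P \<in> S"
    thus "degree (\<Prod>Q\<in>S - {P}. [:- f Q, 1:]) \<le> card S - 1"
      using assms by (subst degree_prod_sum_eq) auto
  qed
  thus ?thesis using assms by (simp add: card_gt_0_iff Suc_le_eq le_less_trans)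
qed

lemma finite_bounded_Ints: "finite {c :: complex. c \<in> \<int> \<and> norm c \<le> b}"
proof (rule finite_subset)
  show "{c :: complex. c \<in> \<int> \<and> norm c \<le> b} \<subseteq> of_int ` {- \<lceil>b\<rceil>..\<lceil>b\<rceil>}"
  proof
    fix c :: complex assume "c \<in> {c. c \<in> \<int> \<and> norm c \<le> b}"
    then obtain n :: int where n: "c = of_int n" "norm c \<le> b" by (auto elim: Ints_cases)
    hence "\<bar>of_int n\<bar> \<le> b" by simp
    hence "n \<in> {- \<lceil>b\<rceil>..\<lceil>b\<rceil>}" by auto linarith+
    thus "c \<in> of_int ` {- \<lceil>b\<rceil>..\<lceil>b\<rceil>}" using n by blast
  qed
qed auto

lemma finite_polys_bounded:
  assumes "finite Z"
  shows "finite {P :: complex poly. degree P < r \<and> (\<forall>k<r. coeff P k \<in> Z)}" (is "finite ?S")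
proof (rule finite_imageD)
  define \<Phi> where "\<Phi> P = (\<lambda>k\<in>{..<r}. coeff P k)" for P :: "complex poly"
  show "finite (\<Phi> ` ?S)"
  proof (rule finite_subset)
    show "finite (PiE {..<r} (\<lambda>_. Z))" using assms by (intro finite_PiE) auto
    show "\<Phi> ` ?S \<subseteq> PiE {..<r} (\<lambda>_. Z)" by (auto simp: \<Phi>_def PiE_def extensional_def)
  qed
  show "inj_on \<Phi> ?S"
  proof (rule inj_onI)
    fix P Q assume PQ: "P \<in> ?S" "Q \<in> ?S" "\<Phi> P = \<Phi> Q"
    show "P = Q"
    proof (rule poly_eqI)
      fix k
      show "coeff P k = coeff Q k"
      proof (cases "k < r")
        case True
        thus ?thesis using fun_cong[OF PQ(3), of k] by (simp add: \<Phi>_def)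
      next
        case False
        thus ?thesis using PQ by (simp add: coeff_eq_0)
      qed
    qed
  qed
qed

lemma connected_cross_plane:
  assumes "convex I" "x0 \<in> I"
  shows "connected (cross_plane I)"
proof (rule starlike_imp_connected)
  have "closed_segment (of_real x0) z \<subseteq> cross_plane I" if z: "z \<in> cross_plane I" for z
  proof
    fix w assume "w \<in> closed_segment (of_real x0) z"
    then obtain t where t: "0 \<le> t" "t \<le> 1" "w = (1 - t) *\<^sub>R of_real x0 + t *\<^sub>R z" by (auto simp: in_segment)
    have w: "Im w = t * Im z" "Re w = (1 - t) * x0 + t * Re z" by (simp_all add: t)
    show "w \<in> cross_plane I"
    proof (cases "Im w = 0")
      case True
      hence "t = 0 \<or> Re z \<in> I" using w z by (auto simp: cross_plane_def)
      hence "Re w \<in> I" unfolding w using convexD_alt[OF assms(1,2), of "Re z" t] t assms(2) by auto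
      thus ?thesis by (simp add: cross_plane_def)
    qed (simp add: cross_plane_def)
  qed
  moreover have "of_real x0 \<in> cross_plane I" using assms by (simp add: cross_plane_def)
  ultimately show "starlike (cross_plane I)" unfolding starlike_def by blast
qed

lemma open_cut_plane: "open cut_plane" and connected_cut_plane: "connected cut_plane"
  unfolding cut_plane_eq by (intro open_cross_plane connected_cross_plane[of _ "-1"]; simp)+

text \<open>Holomorphic functions on a connected open set have no zero divisors: the next factor
  cannot vanish on the nonempty open set where the product so far is nonzero.\<close>

lemma prod_not_identically_zero:
  fixes h :: "'i \<Rightarrow> complex \<Rightarrow> complex"
  assumes V: "open V" "connected V" "V \<noteq> {}" and I: "finite I"
    and h: "\<And>i. i \<in> I \<Longrightarrow> h i holomorphic_on V" "\<And>i. i \<in> I \<Longrightarrow> \<exists>z\<in>V. h i z \<noteq> 0"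
  shows "\<exists>z\<in>V. (\<Prod>i\<in>I. h i z) \<noteq> 0"
  using I h
proof (induction I rule: finite_induct)
  case empty
  thus ?case using V by auto
next
  case (insert x I)
  obtain z where z: "z \<in> V" "(\<Prod>i\<in>I. h i z) \<noteq> 0" using insert by auto
  have hol: "(\<lambda>z. \<Prod>i\<in>I. h i z) holomorphic_on V" using insert by (intro holomorphic_intros) auto
  define N where "N = V \<inter> (\<lambda>z. \<Prod>i\<in>I. h i z) -` (- {0})"
  have N: "open N" unfolding N_def
    using holomorphic_on_imp_continuous_on[OF hol] V(1) by (intro continuous_open_preimage) auto
  have "\<exists>w\<in>N. h x w \<noteq> 0"
  proof (rule ccontr)
    assume *: "\<not> (\<exists>w\<in>N. h x w \<noteq> 0)"
    have "h x w = 0" if "w \<in> V" for w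
      by (rule analytic_continuation_open[OF N V(1) _ V(2) _ _ _ _ that, where g = "\<lambda>_. 0"])
         (use z * insert in \<open>auto simp: N_def\<close>)
    thus False using insert.prems(2)[of x] by auto
  qed
  thus ?case using insert.hyps by (auto simp: N_def)
qed

context interlacing
begin

text \<open>At the roots of \<open>cis_poly Y\<close> the step is multiplication by a number of
  modulus 1.\<close>

lemma hnorm_mono_step:
  assumes "Y = A \<or> Y = B"
  shows "hnorm Y (mono_step Y P) = hnorm Y P"
  unfolding hnorm_def
proof (intro sum.cong refl)
  fix x assume x: "x \<in> Y"
  have finY: "finite Y" using assms fin by auto
  have "poly (cis_poly Y) (cis_pt x) = 0" unfolding poly_cis_poly[OF finY] using finY x by (intro prod_zero bexI[of _ x]) auto
  thus "weight x * (norm (poly (mono_step Y P) (cis_pt x)))\<^sup>2 = weight x * (norm (poly P (cis_pt x)))\<^sup>2"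
    by (simp add: poly_mono_step norm_mult)
qed

lemma cis_poly_0_nz: "finite Y \<Longrightarrow> poly (cis_poly Y) 0 \<noteq> 0"
  by (simp add: poly_cis_poly)

lemma mono_step_add_smult: "mono_step Y (P + smult a Q) = mono_step Y P + smult a (mono_step Y Q)"
  by (rule poly_eqI) (simp add: mono_step_def coeff_pCons algebra_simps split: nat.splits)

text \<open>At 0 the shifted polynomial vanishes but \<open>cis_poly Y\<close> does not, so the
  coefficient in front of \<open>cis_poly Y\<close> must be 0.\<close>

lemma mono_step_inj:
  assumes "finite Y" "mono_step Y P = mono_step Y Q"
  shows "P = Q"
proof -
  define D where "D = P + smult (-1) Q"
  have "mono_step Y D = 0" unfolding D_def mono_step_add_smult using assms(2) by simp
  hence eq: "pCons 0 D = smult (coeff D (card A - 1)) (cis_poly Y)" by (simp add: mono_step_def)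
  have "0 = coeff D (card A - 1) * poly (cis_poly Y) 0" using arg_cong[OF eq, of "\<lambda>p. poly p 0"] by simp
  hence "coeff D (card A - 1) = 0" using cis_poly_0_nz[OF assms(1)] by simp
  hence "D = 0" using eq by simp
  thus ?thesis by (simp add: D_def)
qed

lemma deriv_xf_holomorphic: "degree P < card A \<Longrightarrow> deriv (xf P) holomorphic_on cut_plane"
  by (intro holomorphic_deriv xf_holomorphic open_cut_plane)

lemma cross_extension_deriv:
  assumes P: "degree P < card A" and Y: "Y = A \<or> Y = B"
  shows "\<exists>G K. G holomorphic_on cross_plane (cross_int Y) \<and> (\<forall>z. Im z < 0 \<longrightarrow> G z = xf P z \<and> deriv G z = deriv (xf P) z) \<and>
    (\<forall>z. Im z > 0 \<longrightarrow> G z = xf (mono_step Y P) z + shift_const Y P \<and> deriv G z = deriv (xf (mono_step Y P)) z) \<and>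
    (\<forall>z\<in>cross_plane (cross_int Y). norm (G z) \<le> K * (1 + \<bar>ln (norm z)\<bar>))"
proof -
  obtain G K where G: "G holomorphic_on cross_plane (cross_int Y)" "\<And>z. Im z < 0 \<Longrightarrow> G z = xf P z"
    "\<And>z. Im z > 0 \<Longrightarrow> G z = xf (mono_step Y P) z + shift_const Y P"
    "\<forall>z\<in>cross_plane (cross_int Y). norm (G z) \<le> K * (1 + \<bar>ln (norm z)\<bar>)"
    using cross_extension[OF assms] by blast
  have "deriv G z = deriv (xf P) z" if "Im z < 0" for z
  proof (rule deriv_cong_ev)
    have "\<forall>\<^sub>F w in nhds z. w \<in> {w. Im w < 0}" using that by (intro eventually_nhds_in_open open_halfspace_Im_lt) auto
    thus "\<forall>\<^sub>F w in nhds z. G w = xf P w" by eventually_elim (use G in auto)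
  qed simp
  moreover have "deriv G z = deriv (xf (mono_step Y P)) z" if z: "Im z > 0" for z
  proof -
    have "deriv G z = deriv (\<lambda>w. xf (mono_step Y P) w + shift_const Y P) z"
    proof (rule deriv_cong_ev)
      have "\<forall>\<^sub>F w in nhds z. w \<in> {w. Im w > 0}" using z by (intro eventually_nhds_in_open open_halfspace_Im_gt) auto
      thus "\<forall>\<^sub>F w in nhds z. G w = xf (mono_step Y P) w + shift_const Y P" by eventually_elim (use G in auto)
    qed simp
    also have "\<dots> = deriv (xf (mono_step Y P)) z"
    proof -
      have "xf (mono_step Y P) field_differentiable at z"
        using xf_holomorphic[OF degree_mono_step[OF Y P]] open_cut_plane z
        by (intro holomorphic_on_imp_differentiable_at) (auto simp: cut_plane_def)
      thus ?thesis by (simp add: deriv_add)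
    qed
    finally show ?thesis .
  qed
  ultimately show ?thesis using G by blast
qed

text \<open>The linear relations between the branches of f: since z is nonzero on the cut plane, the
  branch of \<open>P\<close> vanishes exactly when this derivative does.\<close>

definition ker_xf :: "complex poly set" where
  "ker_xf = {P. degree P < card A \<and> (\<forall>z\<in>cut_plane. deriv (xf P) z = 0)}"

lemma deriv_xf_add_smult:
  assumes "degree P < card A" "degree Q < card A" "z \<in> cut_plane"
  shows "deriv (xf (P + smult a Q)) z = deriv (xf P) z + a * deriv (xf Q) z"
proof -
  have "deriv (xf (P + smult a Q)) z = deriv (\<lambda>w. xf P w + a * xf Q w) z"
  proof (rule deriv_cong_ev)
    have "\<forall>\<^sub>F w in nhds z. w \<in> cut_plane" using assms by (intro eventually_nhds_in_open open_cut_plane)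
    thus "\<forall>\<^sub>F w in nhds z. xf (P + smult a Q) w = xf P w + a * xf Q w"
    proof eventually_elim
      case (elim w)
      show ?case unfolding xf_def using lg_strip[OF elim] assms by (intro X_add_smult) auto
    qed
  qed simp
  moreover have "xf P field_differentiable at z" "xf Q field_differentiable at z"
    using assms open_cut_plane by (auto intro!: holomorphic_on_imp_differentiable_at[OF xf_holomorphic])
  hence "((\<lambda>w. xf P w + a * xf Q w) has_field_derivative deriv (xf P) z + a * deriv (xf Q) z) (at z)"
    by (intro DERIV_add DERIV_cmult) (simp_all add: field_differentiable_derivI)
  ultimately show ?thesis by (simp add: DERIV_imp_deriv)
qed

lemma ker_xf_add_smult: "P \<in> ker_xf \<Longrightarrow> Q \<in> ker_xf \<Longrightarrow> P + smult a Q \<in> ker_xf"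
  using deriv_xf_add_smult[of P Q _ a]
  by (auto simp: ker_xf_def intro!: degree_add_less le_less_trans[OF degree_smult_le])

lemma ker_xf_0: "0 \<in> ker_xf"
proof -
  have d: "degree (0 :: complex poly) < card A" using card_pos by simp
  \<comment> \<open>Additivity at 0 = 0 + 0 yields d = d + d.\<close>
  have "deriv (xf (0 + smult 1 0)) z = deriv (xf 0) z + 1 * deriv (xf 0) z" if "z \<in> cut_plane" for z
    using that d by (intro deriv_xf_add_smult) auto
  hence "deriv (xf 0) z = 0" if "z \<in> cut_plane" for z using that by fastforce
  thus ?thesis using d by (simp add: ker_xf_def)
qed

lemma ker_xf_smult: "P \<in> ker_xf \<Longrightarrow> smult a P \<in> ker_xf"
  using ker_xf_add_smult[OF ker_xf_0, of P a] by simp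

lemma ker_xf_sum: "finite I \<Longrightarrow> (\<And>i. i \<in> I \<Longrightarrow> g i \<in> ker_xf) \<Longrightarrow> (\<Sum>i\<in>I. g i) \<in> ker_xf"
proof (induction I rule: finite_induct)
  case (insert x I)
  thus ?case using ker_xf_add_smult[of "g x" "\<Sum>i\<in>I. g i" 1] by simp
qed (simp add: ker_xf_0)

text \<open>A zero derivative remains zero when continued through the window, and above the axis the
  continuation is the derivative for \<open>mono_step Y P\<close>.\<close>

lemma ker_xf_mono_step:
  assumes P: "P \<in> ker_xf" and Y: "Y = A \<or> Y = B"
  shows "mono_step Y P \<in> ker_xf"
proof -
  have dP: "degree P < card A" and zero: "\<And>z. z \<in> cut_plane \<Longrightarrow> deriv (xf P) z = 0" using P by (auto simp: ker_xf_def)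
  have dQ: "degree (mono_step Y P) < card A" using Y dP by (rule degree_mono_step)
  obtain G where G: "G holomorphic_on cross_plane (cross_int Y)"
    "\<And>z. Im z < 0 \<Longrightarrow> deriv G z = deriv (xf P) z" "\<And>z. Im z > 0 \<Longrightarrow> deriv G z = deriv (xf (mono_step Y P)) z"
    using cross_extension_deriv[OF dP Y] by blast
  have op: "open (cross_plane (cross_int Y))" "connected (cross_plane (cross_int Y))"
    using connected_cross_plane[of "{1<..}" 2] connected_cross_plane[of "{0<..<1}" "1/2"]
    by (auto simp: cross_int_def intro!: open_cross_plane)
  have neg: "open {z. Im z < 0}" "{z. Im z < 0} \<noteq> {}" "{z. Im z < 0} \<subseteq> cross_plane (cross_int Y)"
    by (auto simp: cross_plane_def intro!: open_halfspace_Im_lt exI[of _ "-\<i>"])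
  have pos: "open {z. Im z > 0}" "{z. Im z > 0} \<noteq> {}" "{z. Im z > 0} \<subseteq> cut_plane"
    by (auto simp: cut_plane_def intro!: open_halfspace_Im_gt exI[of _ "\<i>"])
  have G0: "deriv G z = 0" if "z \<in> cross_plane (cross_int Y)" for z
    by (rule analytic_continuation_open[OF neg(1) op(1) neg(2) op(2) neg(3) _ _ _ that, where g = "\<lambda>_. 0"])
       (use G zero op in \<open>auto intro!: holomorphic_deriv simp: cut_plane_def\<close>)
  have "deriv (xf (mono_step Y P)) z = 0" if "z \<in> cut_plane" for z
  proof (rule analytic_continuation_open[OF pos(1) open_cut_plane pos(2) connected_cut_plane pos(3) _ _ _ that, where g = "\<lambda>_. 0"])
    show "deriv (xf (mono_step Y P)) holomorphic_on cut_plane" by (rule deriv_xf_holomorphic[OF dQ])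
    fix z assume "z \<in> {z. Im z > 0}"
    thus "deriv (xf (mono_step Y P)) z = 0" using G(3)[of z] G0[of z] by (auto simp: cross_plane_def)
  qed auto
  thus ?thesis using dQ by (simp add: ker_xf_def)
qed

section \<open>The power series of f and of its primitive\<close>

definition acoeff :: "nat \<Rightarrow> complex" where "acoeff n = u (of_nat n) / u 0"

lemma acoeff_0 [simp]: "acoeff 0 = 1" using u_0 by (simp add: acoeff_def)

lemma summable_acoeff:
  assumes "norm z < 1"
  shows "summable (\<lambda>n. acoeff n * z ^ n)" "summable (\<lambda>n. acoeff n / of_nat n * z ^ n)"
proof -
  obtain C where C: "\<And>s. Re s \<ge> cc \<Longrightarrow> norm (u s) \<le> C" using u_bound[OF cc(1)] by blast
  have b: "norm (acoeff n) \<le> C / norm (u 0)" for n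
    using C[of "of_nat n"] cc u_0 by (simp add: acoeff_def norm_divide divide_right_mono)
  have C0: "C / norm (u 0) \<ge> 0" using order_trans[OF norm_ge_zero b] .
  have s: "summable (\<lambda>n. C / norm (u 0) * norm z ^ n)"
    using assms by (intro summable_mult summable_geometric) simp
  show "summable (\<lambda>n. acoeff n * z ^ n)"
    by (rule summable_comparison_test'[OF s, of 0], unfold norm_mult norm_power, intro mult_right_mono b) simp
  show "summable (\<lambda>n. acoeff n / of_nat n * z ^ n)"
  proof (rule summable_comparison_test'[OF s, of 0])
    fix n :: nat
    have "norm (acoeff n / of_nat n) \<le> norm (acoeff n)"
      by (cases "n = 0") (auto simp: norm_divide divide_le_eq mult_le_cancel_left1)
    hence "norm (acoeff n / of_nat n) \<le> C / norm (u 0)" using b[of n] by linarith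
    thus "norm (acoeff n / of_nat n * z ^ n) \<le> C / norm (u 0) * norm z ^ n"
      unfolding norm_mult norm_power by (intro mult_right_mono) auto
  qed
qed

definition fser :: "complex \<Rightarrow> complex" where "fser z = (\<Sum>n. acoeff n * z ^ n)"
text \<open>The term with \<open>n = 0\<close> vanishes because of \<open>1 / 0 = 0\<close>.\<close>
definition gser :: "complex \<Rightarrow> complex" where "gser z = (\<Sum>n. acoeff n / of_nat n * z ^ n)"

lemma fser_0 [simp]: "fser 0 = 1"
  unfolding fser_def by (subst suminf_finite[of "{0}"]) auto

lemma gser_0 [simp]: "gser 0 = 0"
  unfolding gser_def by (subst suminf_finite[of "{0}"]) auto

lemma gser_deriv:
  assumes "norm z < 1"
  shows "\<exists>D. (gser has_field_derivative D) (at z) \<and> z * D = fser z - 1"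
proof -
  obtain K where K: "norm z < K" "K < 1" using assms dense by blast
  have K0: "K > 0" using K norm_ge_zero[of z] by linarith
  define D where "D = (\<Sum>n. diffs (\<lambda>n. acoeff n / of_nat n) n * z ^ n)"
  have "(gser has_field_derivative D) (at z)" unfolding gser_def D_def
    by (rule termdiffs_strong[of _ "of_real K", OF summable_acoeff(2)]) (use K K0 in auto)
  moreover have "z * D = fser z - 1"
  proof -
    have D: "D = (\<Sum>n. acoeff (Suc n) * z ^ n)" unfolding D_def
      by (intro suminf_cong) (simp add: diffs_def del: of_nat_Suc)
    have s: "summable (\<lambda>n. acoeff n * z ^ n)" using assms by (rule summable_acoeff)
    show ?thesis
    proof (cases "z = 0")
      case False
      have "fser z = (\<Sum>n. acoeff (Suc n) * z ^ Suc n) + acoeff 0 * z ^ 0"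
        unfolding fser_def using suminf_split_head[OF s] by (simp add: algebra_simps)
      moreover have "(\<Sum>n. acoeff (Suc n) * z ^ Suc n) = z * (\<Sum>n. acoeff (Suc n) * z ^ n)"
      proof -
        have "summable (\<lambda>n. acoeff (Suc n) * z ^ Suc n)" using s by (subst summable_Suc_iff)
        hence "summable (\<lambda>n. (1 / z) * (acoeff (Suc n) * z ^ Suc n))" by (rule summable_mult)
        hence "summable (\<lambda>n. acoeff (Suc n) * z ^ n)" using False by simp
        thus ?thesis by (subst suminf_mult[symmetric]) (auto simp: mult_ac)
      qed
      ultimately show ?thesis using D by simp
    qed simp
  qed
  ultimately show ?thesis by blast
qed

lemma xf_P0_series:
  "\<exists>\<kappa>. \<forall>z\<in>cut_plane \<inter> ball 0 1. xf P0 z = - lg z - \<kappa> - gser z"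
proof -
  obtain \<kappa> where \<kappa>: "\<And>\<zeta>. Re \<zeta> < 0 \<Longrightarrow> 0 \<le> Im \<zeta> \<Longrightarrow> Im \<zeta> \<le> 2 * pi \<Longrightarrow>
     (\<lambda>M. \<Sum>n=1..M. u (of_nat n) / u 0 / of_nat n * exp (of_nat n * \<zeta>)) \<longlonglongrightarrow> - X P0 \<zeta> - \<zeta> - \<kappa>"
    using X_P0_series by blast
  have "xf P0 z = - lg z - \<kappa> - gser z" if z: "z \<in> cut_plane \<inter> ball 0 1" for z
  proof -
    have zc: "z \<in> cut_plane" "norm z < 1" "z \<noteq> 0" using z cut_planeD(1) by auto
    have "(\<lambda>M. \<Sum>n=1..M. acoeff n / of_nat n * exp (of_nat n * lg z)) \<longlonglongrightarrow> - X P0 (lg z) - lg z - \<kappa>"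
      unfolding acoeff_def using lg_strip[OF zc(1)] zc by (intro \<kappa>) auto
    moreover have "(\<Sum>n=1..M. acoeff n / of_nat n * exp (of_nat n * lg z)) = (\<Sum>n<Suc M. acoeff n / of_nat n * z ^ n)" for M
    proof -
      have "(\<Sum>n<Suc M. acoeff n / of_nat n * z ^ n) = (\<Sum>n=1..M. acoeff n / of_nat n * z ^ n)"
        by (intro sum.mono_neutral_right) (auto simp: not_le)
      thus ?thesis using lg_strip(3)[OF zc(1)] by (simp add: exp_of_nat_mult)
    qed
    moreover have "(\<lambda>M. \<Sum>n<Suc M. acoeff n / of_nat n * z ^ n) \<longlonglongrightarrow> gser z"
      unfolding gser_def using summable_LIMSEQ[OF summable_acoeff(2)[OF zc(2)]] by (rule LIMSEQ_Suc)
    ultimately have e: "gser z = - X P0 (lg z) - lg z - \<kappa>" by (intro LIMSEQ_unique) simp_all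
    show ?thesis unfolding e xf_def by simp
  qed
  thus ?thesis by blast
qed

text \<open>z d/dz is the derivative with respect to log z. The sign undoes that of
  \<open>X\<close>, so that \<open>P0\<close> yields the given series.\<close>

definition ff :: "complex poly \<Rightarrow> complex \<Rightarrow> complex" where "ff P z = - (z * deriv (xf P) z)"

lemma ff_P0:
  assumes "z \<in> cut_plane \<inter> ball 0 1"
  shows "ff P0 z = fser z"
proof -
  obtain \<kappa> where \<kappa>: "\<And>z. z \<in> cut_plane \<inter> ball 0 1 \<Longrightarrow> xf P0 z = - lg z - \<kappa> - gser z"
    using xf_P0_series by blast
  have zc: "z \<in> cut_plane" "norm z < 1" "z \<noteq> 0" using assms cut_planeD(1) by auto
  obtain D where D: "(gser has_field_derivative D) (at z)" "z * D = fser z - 1" using gser_deriv[OF zc(2)] by blast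
  have "(lg has_field_derivative 1 / z) (at z)"
    using DERIV_add[OF DERIV_chain2[OF has_field_derivative_Ln[OF cut_planeD(2)[OF zc(1)]] DERIV_minus[OF DERIV_ident]] DERIV_const[of "pi * \<i>"]]
    by (simp add: lg_def[abs_def] inverse_eq_divide)
  hence "((\<lambda>z. - lg z - \<kappa> - gser z) has_field_derivative - (1 / z) - 0 - D) (at z)"
    by (intro derivative_intros D)
  moreover have "\<forall>\<^sub>F w in nhds z. xf P0 w = - lg w - \<kappa> - gser w"
  proof -
    have "\<forall>\<^sub>F w in nhds z. w \<in> cut_plane \<inter> ball 0 1"
      using assms by (intro eventually_nhds_in_open open_Int open_cut_plane) auto
    thus ?thesis by eventually_elim (rule \<kappa>)
  qed
  hence "deriv (xf P0) z = deriv (\<lambda>z. - lg z - \<kappa> - gser z) z" by (rule deriv_cong_ev) simp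
  ultimately have "deriv (xf P0) z = - (1 / z) - D" by (simp add: DERIV_imp_deriv)
  hence "z * deriv (xf P0) z = - 1 - z * D" using zc by (simp add: right_diff_distrib)
  thus ?thesis using D(2) by (simp add: ff_def)
qed

text \<open>The point 0 is outside the cut plane, so \<open>fser 0 = 1\<close> is contradicted by a
  limit along the negative reals.\<close>

lemma P0_not_ker: "P0 \<notin> ker_xf"
proof
  assume "P0 \<in> ker_xf"
  hence *: "fser z = 0" if "z \<in> cut_plane \<inter> ball 0 1" for z
    using ff_P0[OF that] that by (auto simp: ff_def ker_xf_def)
  have "isCont fser 0" unfolding fser_def
    by (rule DERIV_isCont, rule termdiffs_strong[of _ "1/2", OF summable_acoeff(1)]) auto
  define w :: "nat \<Rightarrow> complex" where "w n = - of_real (inverse (real (Suc (Suc n))))" for n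
  have "w \<longlonglongrightarrow> - of_real 0" unfolding w_def
    by (intro tendsto_minus tendsto_of_real LIMSEQ_Suc[OF LIMSEQ_inverse_real_of_nat])
  hence "w \<longlonglongrightarrow> 0" by simp
  hence "(\<lambda>n. fser (w n)) \<longlonglongrightarrow> fser 0" by (rule isCont_tendsto_compose[OF \<open>isCont fser 0\<close>])
  moreover have "fser (w n) = 0" for n
  proof (rule *)
    have "inverse (real (Suc (Suc n))) < 1" "inverse (real (Suc (Suc n))) > 0" by (simp_all add: field_simps)
    thus "w n \<in> cut_plane \<inter> ball 0 1"
      unfolding cut_plane_def w_def by (simp del: of_nat_Suc of_real_inverse)
  qed
  ultimately have "(\<lambda>n::nat. 0 :: complex) \<longlonglongrightarrow> 1" by simp
  thus False by (simp add: LIMSEQ_const_iff)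
qed

text \<open>The kernel is an ideal for multiplication modulo both characteristic polynomials, which
  are coprime; a generator of minimal degree divides both.\<close>
lemma ker_xf_trivial:
  assumes "P \<in> ker_xf"
  shows "P = 0"
proof (rule ccontr)
  assume "P \<noteq> 0"
  define d where "d = (LEAST d. \<exists>P\<in>ker_xf. P \<noteq> 0 \<and> degree P = d)"
  have ex: "\<exists>d. \<exists>P\<in>ker_xf. P \<noteq> 0 \<and> degree P = d" using assms \<open>P \<noteq> 0\<close> by blast
  obtain P1 where P1: "P1 \<in> ker_xf" "P1 \<noteq> 0" "degree P1 = d"
    using LeastI_ex[OF ex] unfolding d_def[symmetric] by blast
  have min: "d \<le> degree Q" if "Q \<in> ker_xf" "Q \<noteq> 0" for Q
    unfolding d_def using that by (intro Least_le) blast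
  define r where "r = card A"
  have dr: "d < r" using P1 by (auto simp: ker_xf_def r_def)
  define M where "M = smult (1 / lead_coeff P1) P1"
  have M: "M \<in> ker_xf" "lead_coeff M = 1" "degree M = d" "M \<noteq> 0"
    using P1 by (auto simp: M_def ker_xf_smult)
  \<comment> \<open>As long as the degree before the step is below \<open>r - 1\<close>, nothing is
    reduced and the step is plain multiplication by t.\<close>
  have shift: "monom 1 j * M \<in> ker_xf" if "j \<le> r - 1 - d" for j
    using that
  proof (induction j)
    case (Suc j)
    have "degree (monom 1 j * M) = j + d" using M by (simp add: degree_mult_eq degree_monom_eq)
    hence "coeff (monom 1 j * M) (r - 1) = 0" using Suc.prems by (intro coeff_eq_0) simp
    hence "mono_step A (monom 1 j * M) = pCons 0 (monom 1 j * M)" by (simp add: mono_step_def r_def)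
    also have "\<dots> = monom 1 (Suc j) * M" by (simp add: monom_Suc)
    finally show ?case using ker_xf_mono_step[of "monom 1 j * M" A] Suc by simp
  qed (use M in simp)
  have mult: "q * M \<in> ker_xf" if "degree q \<le> r - 1 - d" for q
  proof -
    have "q * M = (\<Sum>i\<le>degree q. monom (coeff q i) i) * M" by (simp add: poly_as_sum_of_monoms)
    also have "\<dots> = (\<Sum>i\<le>degree q. smult (coeff q i) (monom 1 i * M))"
      by (simp add: sum_distrib_right smult_monom flip: mult_smult_left)
    also have "\<dots> \<in> ker_xf" using that by (intro ker_xf_sum ker_xf_smult shift) auto
    finally show ?thesis .
  qed
  have dvd: "M dvd W" if W: "W \<in> ker_xf" for W
  proof -
    have "degree (W div M) \<le> r - 1 - d"
    proof (cases "W div M = 0")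
      case False
      have "degree (W mod M) < r" using degree_mod_less[OF M(4), of W] M(3) dr by auto
      moreover have "degree W < r" using W by (simp add: ker_xf_def r_def)
      ultimately have "degree (W - W mod M) < r" by (intro degree_diff_less)
      also have "W - W mod M = (W div M) * M" by (simp add: minus_mod_eq_div_mult)
      also have "degree \<dots> = degree (W div M) + d" using False M by (simp add: degree_mult_eq)
      finally show ?thesis by simp
    qed simp
    hence "(W div M) * M \<in> ker_xf" by (rule mult)
    hence "W + smult (-1) ((W div M) * M) \<in> ker_xf" using W by (rule ker_xf_add_smult[rotated])
    moreover have "W + smult (-1) ((W div M) * M) = W mod M"
      using div_mult_mod_eq[of W M] by (simp add: algebra_simps)
    ultimately have "W mod M \<in> ker_xf" by simp
    hence "W mod M = 0" using min[of "W mod M"] degree_mod_less[OF M(4), of W] M(3) by force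
    thus ?thesis by auto
  qed
  have dvdY: "M dvd cis_poly Y" if Y: "Y = A \<or> Y = B" for Y
  proof -
    \<comment> \<open>The multiple of \<open>M\<close> that is monic of degree exactly
      \<open>r - 1\<close>: the next step subtracts \<open>cis_poly Y\<close> once, so
      \<open>M\<close> divides that polynomial.\<close>
    define R where "R = monom 1 (r - 1 - d) * M"
    have R: "R \<in> ker_xf" unfolding R_def by (rule shift) simp
    have "degree R = r - 1" using M dr by (simp add: R_def degree_mult_eq degree_monom_eq)
    moreover have "lead_coeff R = 1" using M by (simp add: R_def lead_coeff_mult degree_monom_eq)
    ultimately have "coeff R (r - 1) = 1" by simp
    hence "mono_step Y R = pCons 0 R - cis_poly Y" by (simp add: mono_step_def r_def)
    hence "cis_poly Y = pCons 0 R - mono_step Y R" by simp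
    moreover have "M dvd mono_step Y R" using ker_xf_mono_step[OF R Y] by (rule dvd)
    moreover have "M dvd pCons 0 R"
    proof -
      have "pCons 0 R = monom 1 (Suc (r - 1 - d)) * M" by (simp add: R_def monom_Suc)
      thus ?thesis by simp
    qed
    ultimately show ?thesis by (simp add: dvd_diff)
  qed
  have "d = 0"
  proof (rule ccontr)
    assume "d \<noteq> 0"
    hence "\<not> (\<exists>a l. a \<noteq> 0 \<and> l = 0 \<and> M = pCons a l)" using M(3) by auto
    then obtain \<alpha> where \<alpha>: "poly M \<alpha> = 0" using fundamental_theorem_of_algebra_alt by blast
    have root: "\<exists>x\<in>Y. \<alpha> = cis_pt x" if Y: "Y = A \<or> Y = B" for Y
    proof -
      have "poly (cis_poly Y) \<alpha> = 0" using dvdY[OF Y] \<alpha> by (auto elim!: dvdE)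
      moreover have "finite Y" using Y fin by auto
      ultimately show ?thesis by (auto simp: poly_cis_poly)
    qed
    obtain x y where xy: "x \<in> A" "y \<in> B" "cis_pt x = cis_pt y" using root[of A] root[of B] by auto
    have "x = y" using inj_on_cis_pt xy sub unfolding inj_on_def by blast
    thus False using xy disj by auto
  qed
  \<comment> \<open>With the generator 1 the kernel would contain every polynomial of degree less
    than r.\<close>
  have "P0 \<in> ker_xf"
  proof -
    obtain c where "M = [:c:]" using M(3) \<open>d = 0\<close> degree_eq_zeroE by metis
    hence "M = 1" using M(2) by (simp add: one_pCons)
    thus ?thesis using mult[of P0] degree_P0 \<open>d = 0\<close> by (simp add: r_def)
  qed
  thus False using P0_not_ker by contradiction
qed

lemma ff_distinct:
  assumes "degree P < card A" "degree Q < card A" "P \<noteq> Q"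
  shows "\<exists>z\<in>cut_plane. ff P z - ff Q z \<noteq> 0"
proof (rule ccontr)
  assume "\<not> ?thesis"
  hence eq: "deriv (xf P) z = deriv (xf Q) z" if "z \<in> cut_plane" for z
    using that cut_planeD(1)[OF that] by (auto simp: ff_def)
  have "P + smult (-1) Q \<in> ker_xf"
    unfolding ker_xf_def using assms eq deriv_xf_add_smult[OF assms(1,2), of _ "-1"]
    by (auto intro!: degree_diff_less)
  hence "P + smult (-1) Q = 0" by (rule ker_xf_trivial)
  thus False using assms(3) by simp
qed

end

section \<open>The relation over the complex numbers\<close>

lemma (in interlacing) ff_bound_region:
  assumes P: "degree P < card A" and z: "Im z \<noteq> 0" and Y: "Y = A \<or> Y = B"
    and G: "G holomorphic_on cross_plane (cross_int Y)" "deriv G z = deriv (xf P) z"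
      "\<And>w. w \<in> cross_plane (cross_int Y) \<Longrightarrow> norm (G w) \<le> K * (1 + \<bar>ln (norm w)\<bar>)"
    and reg: "if Y = A then 1 \<le> Re z else 0 \<le> Re z \<and> Re z \<le> 1"
  shows "norm (ff P z) \<le> 4 * K * growth z ^ 3"
proof -
  define \<rho> where "\<rho> = min (norm z) (norm (z - 1)) / 2"
  have "cball z \<rho> \<subseteq> cross_plane (cross_int Y)"
    using reg Y A_neq_B z cball_subset_cross_1[of z \<rho>] cball_subset_cross_0[of z \<rho>]
    by (auto simp: cross_int_def \<rho>_def split: if_splits)
  hence "norm (z * deriv G z) \<le> 4 * K * growth z ^ 3"
    using G by (intro norm_z_deriv_le[OF z \<rho>_def, where D = "cross_plane (cross_int Y)"] open_cross_plane)
       (auto simp: cross_int_def)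
  thus ?thesis by (simp add: ff_def G(2))
qed

locale interlacing_int = interlacing +
  assumes int_A: "\<And>k. coeff (cis_poly A) k \<in> \<int>" and int_B: "\<And>k. coeff (cis_poly B) k \<in> \<int>"
begin

text \<open>Integral vectors on a sphere of the invariant form; this plays the role of the orbit of \<open>P0\<close> under
  the monodromy group.\<close>
definition S :: "complex poly set" where
  "S = {P. degree P < card A \<and> (\<forall>k. coeff P k \<in> \<int>) \<and> hnorm A P = hnorm A P0}"

lemma S_degree: "P \<in> S \<Longrightarrow> degree P < card A" by (simp add: S_def)

text \<open>Dividing \<open>cis_poly B\<close> by the monic factor t - 1 keeps the coefficients
  integral, by recursion on the index.\<close>

lemma P0_in_S: "P0 \<in> S"
proof -
  have "coeff P0 k \<in> \<int>" for k
  proof (induction k)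
    case 0
    have "coeff (cis_poly B) 0 = - coeff P0 0" by (simp add: cis_poly_B_eq)
    thus ?case using int_B[of 0] by (metis Ints_minus minus_minus)
  next
    case (Suc k)
    have "coeff (cis_poly B) (Suc k) = coeff P0 k - coeff P0 (Suc k)" by (simp add: cis_poly_B_eq)
    hence "coeff P0 (Suc k) = coeff P0 k - coeff (cis_poly B) (Suc k)" by simp
    thus ?case using Suc int_B[of "Suc k"] by (metis Ints_diff)
  qed
  thus ?thesis using degree_P0_less by (simp add: S_def)
qed

text \<open>The step for \<open>A\<close> preserves the norm written over \<open>A\<close>, the step
  for \<open>B\<close> the one written over \<open>B\<close>, and by \<open>hnorm_eq\<close> these
  are the same norm.\<close>

lemma mono_step_in_S:
  assumes P: "P \<in> S" and Y: "Y = A \<or> Y = B"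
  shows "mono_step Y P \<in> S"
proof -
  have d: "degree P < card A" "degree (mono_step Y P) < card A"
    using P Y degree_mono_step by (auto simp: S_def)
  have "coeff (mono_step Y P) k \<in> \<int>" for k
  proof -
    have "coeff (pCons 0 P) k \<in> \<int>" using P by (cases k) (auto simp: S_def)
    moreover have "coeff (cis_poly Y) k \<in> \<int>" using Y int_A int_B by auto
    moreover have "coeff P (card A - 1) \<in> \<int>" using P by (simp add: S_def)
    ultimately show ?thesis by (simp add: mono_step_def)
  qed
  moreover have "hnorm A (mono_step Y P) = hnorm A P"
    using Y
  proof
    assume "Y = B"
    thus ?thesis using hnorm_eq[OF d(1)] hnorm_eq[OF d(2)] hnorm_mono_step[of B P] by simp
  qed (simp add: hnorm_mono_step)
  ultimately show ?thesis using P d by (simp add: S_def)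
qed

text \<open>Positive weights bound the values at the roots of \<open>cis_poly A\<close>; Lagrange
  interpolation then bounds the coefficients, which are integers.\<close>

lemma finite_S: "finite S"
proof -
  define N where "N = hnorm A P0"
  define c where "c x = (\<Prod>y\<in>A - {x}. cis_pt x - cis_pt y)" for x
  define R where "R x = sqrt (N / weight x)" for x
  define b where "b k = (\<Sum>x\<in>A. R x / norm (c x) * norm (coeff (\<Prod>y\<in>A - {x}. [:- cis_pt y, 1:]) k))" for k
  define bb where "bb = (\<Sum>k<card A. b k)"
  have inj: "inj_on cis_pt A" using inj_on_cis_pt sub by (auto intro: inj_on_subset)
  have c0: "c x \<noteq> 0" if "x \<in> A" for x
    using that inj fin by (auto simp: c_def inj_on_def)
  have N0: "N \<ge> 0" unfolding N_def hnorm_def using weight_pos by (intro sum_nonneg mult_nonneg_nonneg) (auto intro: less_imp_le)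
  have R0: "R x \<ge> 0" if "x \<in> A" for x using weight_pos[of x] that N0 by (simp add: R_def)
  have b0: "b k \<ge> 0" for k unfolding b_def by (intro sum_nonneg mult_nonneg_nonneg divide_nonneg_nonneg R0) auto
  have "norm (coeff P k) \<le> bb" if P: "P \<in> S" and k: "k < card A" for P k
  proof -
    have val: "norm (poly P (cis_pt x)) \<le> R x" if x: "x \<in> A" for x
    proof -
      have "weight x * (norm (poly P (cis_pt x)))\<^sup>2 \<le> hnorm A P"
        unfolding hnorm_def using x fin weight_pos
        by (intro member_le_sum) (auto intro!: mult_nonneg_nonneg intro: less_imp_le)
      hence "(norm (poly P (cis_pt x)))\<^sup>2 \<le> N / weight x"
        using P weight_pos[of x] x by (simp add: S_def N_def field_simps)
      thus ?thesis unfolding R_def by (rule real_le_rsqrt)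
    qed
    define L where "L = lag_coeff A (\<lambda>x. poly P (cis_pt x) / c x) cis_pt"
    have "P = L"
    proof (rule poly_eqI_degree)
      show "card (cis_pt ` A) > degree P" using P by (simp add: card_image[OF inj] S_def)
      show "card (cis_pt ` A) > degree L" unfolding L_def
        using degree_lag_coeff_less[OF fin(1) nonempty(1)] by (simp add: card_image[OF inj])
      fix t assume "t \<in> cis_pt ` A"
      then obtain x where x: "x \<in> A" "t = cis_pt x" by auto
      thus "poly P t = poly L t"
        using poly_lag_coeff[OF fin(1) x(1), of "\<lambda>x. poly P (cis_pt x) / c x" cis_pt] c0[OF x(1)]
        by (simp add: L_def c_def)
    qed
    hence "coeff P k = coeff L k" by (rule arg_cong)
    also have "\<dots> = (\<Sum>x\<in>A. poly P (cis_pt x) / c x * coeff (\<Prod>y\<in>A - {x}. [:- cis_pt y, 1:]) k)"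
      by (simp add: L_def lag_coeff_def coeff_sum)
    also have "norm \<dots> \<le> b k" unfolding b_def
      by (rule sum_norm_le) (auto simp: norm_mult norm_divide intro!: mult_right_mono divide_right_mono val)
    also have "b k \<le> bb" unfolding bb_def using k b0 by (intro member_le_sum) auto
    finally show ?thesis .
  qed
  hence "S \<subseteq> {P. degree P < card A \<and> (\<forall>k<card A. coeff P k \<in> {c. c \<in> \<int> \<and> norm c \<le> bb})}"
    by (auto simp: S_def)
  thus ?thesis by (rule finite_subset) (intro finite_polys_bounded finite_bounded_Ints)
qed

lemma mono_step_bij:
  assumes Y: "Y = A \<or> Y = B"
  shows "bij_betw (mono_step Y) S S"
proof -
  have "inj_on (mono_step Y) S" using mono_step_inj[of Y] Y fin by (auto simp: inj_on_def)
  moreover have "mono_step Y ` S \<subseteq> S" using mono_step_in_S Y by auto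
  ultimately show ?thesis using endo_inj_surj[OF finite_S] by (auto simp: bij_betw_def)
qed

text \<open>For Re z \<le> 0, 0 \<le> Re z \<le> 1 and 1 \<le> Re z a Cauchy disc fits into the cut
  plane, the plane open at (0, 1) and the plane open at (1, \<infinity>) respectively.\<close>

lemma ff_moderate:
  assumes "P \<in> S"
  shows "moderate (ff P)"
proof -
  have dP: "degree P < card A" using assms S_degree by simp
  obtain K0 where K0: "\<And>w. w \<in> cut_plane \<Longrightarrow> norm (xf P w) \<le> K0 * (1 + \<bar>ln (norm w)\<bar>)"
    using xf_bound[OF dP] by blast
  have half: "\<exists>K. \<forall>z. Im z \<noteq> 0 \<longrightarrow> (if Y = A then 1 \<le> Re z else 0 \<le> Re z \<and> Re z \<le> 1) \<longrightarrow> norm (ff P z) \<le> 4 * K * growth z ^ 3"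
    if Y: "Y = A \<or> Y = B" for Y
  proof -
    \<comment> \<open>The extension of \<open>P\<close> itself agrees with the branch of
      \<open>P\<close> only below the axis. Above the axis a preimage under the step provides an
      extension with the right derivative.\<close>
    have "P \<in> mono_step Y ` S" using mono_step_bij[OF Y] assms by (simp add: bij_betw_def)
    then obtain P' where P': "P' \<in> S" "mono_step Y P' = P" by blast
    obtain G K where G: "G holomorphic_on cross_plane (cross_int Y)" "\<And>z. Im z < 0 \<Longrightarrow> deriv G z = deriv (xf P) z"
      "\<And>w. w \<in> cross_plane (cross_int Y) \<Longrightarrow> norm (G w) \<le> K * (1 + \<bar>ln (norm w)\<bar>)"
      using cross_extension_deriv[OF dP Y] by blast
    obtain G' K' where G': "G' holomorphic_on cross_plane (cross_int Y)" "\<And>z. Im z > 0 \<Longrightarrow> deriv G' z = deriv (xf P) z"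
      "\<And>w. w \<in> cross_plane (cross_int Y) \<Longrightarrow> norm (G' w) \<le> K' * (1 + \<bar>ln (norm w)\<bar>)"
      using cross_extension_deriv[OF S_degree[OF P'(1)] Y] unfolding P'(2) by blast
    show ?thesis
    proof (intro exI[of _ "max K K'"] allI impI)
      fix z assume z: "Im z \<noteq> 0" "if Y = A then 1 \<le> Re z else 0 \<le> Re z \<and> Re z \<le> 1"
      have g: "growth z ^ 3 \<ge> 0" using growth_ge_1[of z] by simp
      show "norm (ff P z) \<le> 4 * max K K' * growth z ^ 3"
      proof (cases "Im z < 0")
        case True
        have "norm (ff P z) \<le> 4 * K * growth z ^ 3"
          using True by (intro ff_bound_region[OF dP z(1) Y G(1) G(2) G(3) z(2)])
        also have "\<dots> \<le> 4 * max K K' * growth z ^ 3" using g by (intro mult_right_mono) auto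
        finally show ?thesis .
      next
        case False
        hence "Im z > 0" using z by simp
        hence "norm (ff P z) \<le> 4 * K' * growth z ^ 3"
          by (intro ff_bound_region[OF dP z(1) Y G'(1) G'(2) G'(3) z(2)])
        also have "\<dots> \<le> 4 * max K K' * growth z ^ 3" using g by (intro mult_right_mono) auto
        finally show ?thesis .
      qed
    qed
  qed
  obtain KA where KA: "\<And>z. Im z \<noteq> 0 \<Longrightarrow> 1 \<le> Re z \<Longrightarrow> norm (ff P z) \<le> 4 * KA * growth z ^ 3"
    using half[of A] by auto
  obtain KB where KB: "\<And>z. Im z \<noteq> 0 \<Longrightarrow> 0 \<le> Re z \<Longrightarrow> Re z \<le> 1 \<Longrightarrow> norm (ff P z) \<le> 4 * KB * growth z ^ 3"
    using half[of B] A_neq_B by auto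
  show ?thesis
  proof (rule moderateI)
    fix z assume z: "Im z \<noteq> 0"
    define K where "K = max K0 (max KA KB)"
    have g: "growth z ^ 3 \<ge> 0" using growth_ge_1[of z] by simp
    have le: "4 * K' * growth z ^ 3 \<le> 4 * K * growth z ^ 3" if "K' \<le> K" for K'
      using that g by (intro mult_right_mono) auto
    show "norm (ff P z) \<le> 4 * K * growth z ^ 3"
    proof (cases "Re z \<le> 0")
      case True
      define \<rho> where "\<rho> = min (norm z) (norm (z - 1)) / 2"
      have "norm (z * deriv (xf P) z) \<le> 4 * K0 * growth z ^ 3"
        using K0 by (intro norm_z_deriv_le[OF z \<rho>_def open_cut_plane _ xf_holomorphic[OF dP]] cball_subset_cut_plane[OF z True])
          (auto simp: \<rho>_def)
      thus ?thesis using le[of K0] by (simp add: ff_def K_def)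
    next
      case False
      show ?thesis
      proof (cases "Re z \<le> 1")
        case True
        thus ?thesis using KB[OF z] False le[of KB] by (auto simp: K_def intro: order_trans)
      next
        case False
        thus ?thesis using KA[OF z] le[of KA] by (auto simp: K_def intro: order_trans)
      qed
    qed
  qed
qed

text \<open>The exponential of a quantity of logarithmic growth grows at most like a power.\<close>

lemma exp_type_moderate:
  assumes "P \<in> S" and gb: "\<And>w. norm (g w) \<le> exp (norm w)"
  shows "moderate (\<lambda>z. g (xf P z))"
proof -
  obtain K where K: "K \<ge> 0" "\<And>w. w \<in> cut_plane \<Longrightarrow> norm (xf P w) \<le> K * (1 + \<bar>ln (norm w)\<bar>)"
    using xf_bound[OF S_degree[OF assms(1)]] by blast
  define n where "n = nat \<lceil>K\<rceil>"
  have n: "K \<le> real n" by (simp add: n_def real_nat_ceiling_ge)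
  show ?thesis
  proof (rule moderateI)
    fix z assume z: "Im z \<noteq> 0"
    hence z0: "z \<noteq> 0" by auto
    have "norm (g (xf P z)) \<le> exp (norm (xf P z))" by (rule gb)
    also have "\<dots> \<le> exp (real n * (1 + \<bar>ln (norm z)\<bar>))"
    proof (subst exp_le_cancel_iff)
      have "norm (xf P z) \<le> K * (1 + \<bar>ln (norm z)\<bar>)" using z by (intro K) (simp add: cut_plane_def)
      also have "\<dots> \<le> real n * (1 + \<bar>ln (norm z)\<bar>)" using n by (intro mult_right_mono) auto
      finally show "norm (xf P z) \<le> real n * (1 + \<bar>ln (norm z)\<bar>)" .
    qed
    also have "\<dots> = exp (real n) * exp \<bar>ln (norm z)\<bar> ^ n"
      by (simp add: distrib_left exp_add exp_of_nat_mult)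
    also have "\<dots> \<le> exp (real n) * growth z ^ n"
      by (intro mult_left_mono power_mono exp_abs_ln_le_growth[OF z0]) auto
    finally show "norm (g (xf P z)) \<le> exp (real n) * growth z ^ n" .
  qed
qed

text \<open>Crossing a window permutes \<open>S\<close> by \<open>mono_step\<close> and adds
  integral multiples of 2 pi i to the primitives. Symmetry absorbs the permutation, the period of
  \<open>g\<close> the constants.\<close>

lemma symmetric_single_valued:
  assumes ghol: "g holomorphic_on UNIV" and gper: "\<And>w n. g (w + 2 * pi * \<i> * of_int n) = g w"
    and gb: "\<And>w. norm (g w) \<le> exp (norm w)"
  shows "single_valued (\<lambda>z. coeff (lag_coeff S (\<lambda>P. g (xf P z)) (\<lambda>P. ff P z)) k)"
proof -
  define h where "h z = coeff (lag_coeff S (\<lambda>P. g (xf P z)) (\<lambda>P. ff P z)) k" for z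
  have gcomp: "(\<lambda>z. g (G z)) holomorphic_on D" if "G holomorphic_on D" for G D
    using holomorphic_on_compose_gen[OF that ghol] by (simp add: o_def)
  have hol_closed: "(\<lambda>z. coeff (lag_coeff S (\<lambda>P. c P z) (\<lambda>P. f P z)) k) holomorphic_on D"
    if "\<And>P. P \<in> S \<Longrightarrow> c P holomorphic_on D" "\<And>P. P \<in> S \<Longrightarrow> f P holomorphic_on D" for c f D
    by (rule coeff_lag_coeff_closed[where C = "\<lambda>h. h holomorphic_on D"])
       (use that finite_S in \<open>auto intro!: holomorphic_intros\<close>)
  have 1: "h holomorphic_on cut_plane" unfolding h_def
  proof (rule hol_closed)
    fix P assume P: "P \<in> S"
    show "(\<lambda>z. g (xf P z)) holomorphic_on cut_plane" by (rule gcomp[OF xf_holomorphic[OF S_degree[OF P]]])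
    show "ff P holomorphic_on cut_plane" unfolding ff_def[abs_def]
      by (intro holomorphic_intros deriv_xf_holomorphic S_degree P)
  qed
  have 2: "moderate h" unfolding h_def
    by (rule coeff_lag_coeff_closed[where C = moderate])
       (use finite_S in \<open>auto intro!: moderate_const moderate_add moderate_mult ff_moderate exp_type_moderate gb\<close>)
  have 3: "\<exists>h'. h' holomorphic_on cross_plane (cross_int Y) \<and> (\<forall>z. Im z \<noteq> 0 \<longrightarrow> h' z = h z)" if Y: "Y = A \<or> Y = B" for Y
  proof -
    have "\<forall>P\<in>S. \<exists>G. G holomorphic_on cross_plane (cross_int Y) \<and> (\<forall>z. Im z < 0 \<longrightarrow> G z = xf P z \<and> deriv G z = deriv (xf P) z) \<and>
      (\<forall>z. Im z > 0 \<longrightarrow> G z = xf (mono_step Y P) z + shift_const Y P \<and> deriv G z = deriv (xf (mono_step Y P)) z)"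
      using cross_extension_deriv[OF S_degree Y] by blast
    then obtain G where G: "\<And>P. P \<in> S \<Longrightarrow> G P holomorphic_on cross_plane (cross_int Y)"
      "\<And>P z. P \<in> S \<Longrightarrow> Im z < 0 \<Longrightarrow> G P z = xf P z" "\<And>P z. P \<in> S \<Longrightarrow> Im z < 0 \<Longrightarrow> deriv (G P) z = deriv (xf P) z"
      "\<And>P z. P \<in> S \<Longrightarrow> Im z > 0 \<Longrightarrow> G P z = xf (mono_step Y P) z + shift_const Y P"
      "\<And>P z. P \<in> S \<Longrightarrow> Im z > 0 \<Longrightarrow> deriv (G P) z = deriv (xf (mono_step Y P)) z"
      unfolding bchoice_iff by blast
    define h' where "h' z = coeff (lag_coeff S (\<lambda>P. g (G P z)) (\<lambda>P. - (z * deriv (G P) z))) k" for z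
    have op: "open (cross_plane (cross_int Y))" by (auto simp: cross_int_def intro!: open_cross_plane)
    have "h' holomorphic_on cross_plane (cross_int Y)" unfolding h'_def
      by (rule hol_closed) (auto intro!: gcomp holomorphic_intros holomorphic_deriv op G(1))
    moreover have "h' z = h z" if z: "Im z \<noteq> 0" for z
    proof (cases "Im z < 0")
      case True
      thus ?thesis unfolding h'_def h_def ff_def
        by (intro arg_cong2[where f = coeff] lag_coeff_cong) (auto simp: G)
    next
      case False
      hence z: "Im z > 0" using z by simp
      have gG: "g (G P z) = g (xf (mono_step Y P) z)" if P: "P \<in> S" for P
      proof -
        obtain n :: int where "coeff P (card A - 1) = of_int n" using P by (auto simp: S_def elim: Ints_cases)
        hence "\<exists>m :: int. shift_const Y P = 2 * pi * \<i> * of_int m"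
          unfolding shift_const_def by (intro exI[of _ "if Y = A then 0 else - n"]) auto
        then obtain m :: int where "shift_const Y P = 2 * pi * \<i> * of_int m" by blast
        thus ?thesis using G(4)[OF P z] gper by simp
      qed
      have "h' z = coeff (lag_coeff S (\<lambda>P. g (xf (mono_step Y P) z)) (\<lambda>P. ff (mono_step Y P) z)) k"
        unfolding h'_def ff_def using gG G(5)[OF _ z]
        by (intro arg_cong2[where f = coeff] lag_coeff_cong) auto
      also have "\<dots> = h z" unfolding h_def
        using lag_coeff_reindex[OF mono_step_bij[OF Y], of "\<lambda>P. g (xf P z)" "\<lambda>P. ff P z"] by simp
      finally show ?thesis .
    qed
    ultimately show ?thesis by blast
  qed
  have "single_valued h" unfolding single_valued_def
    using 1 2 3[of A] 3[of B] A_neq_B by (auto simp: cross_int_def)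
  thus ?thesis by (simp add: h_def[abs_def])
qed

text \<open>A common exponent for all coefficients; it may be enlarged further, so that two choices
  of \<open>g\<close> get the same denominator.\<close>

lemma symmetric_rational:
  assumes "g holomorphic_on UNIV" "\<And>w n. g (w + 2 * pi * \<i> * of_int n) = g w" "\<And>w. norm (g w) \<le> exp (norm w)"
  shows "\<exists>N. \<forall>M\<ge>N. \<exists>p. \<forall>k<card S. \<forall>z\<in>cut_plane.
     z ^ M * (z - 1) ^ M * coeff (lag_coeff S (\<lambda>P. g (xf P z)) (\<lambda>P. ff P z)) k = poly (p k) z"
proof -
  have "\<forall>k. \<exists>N. \<forall>M\<ge>N. \<exists>p. \<forall>z\<in>cut_plane.
     z ^ M * (z - 1) ^ M * coeff (lag_coeff S (\<lambda>P. g (xf P z)) (\<lambda>P. ff P z)) k = poly p z"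
    using single_valued_rational[OF symmetric_single_valued[OF assms]] by blast
  then obtain N where N: "\<And>k M. M \<ge> N k \<Longrightarrow> \<exists>p. \<forall>z\<in>cut_plane.
     z ^ M * (z - 1) ^ M * coeff (lag_coeff S (\<lambda>P. g (xf P z)) (\<lambda>P. ff P z)) k = poly p z"
    by metis
  show ?thesis
  proof (intro exI[of _ "\<Sum>k<card S. N k"] allI impI)
    fix M assume M: "M \<ge> (\<Sum>k<card S. N k)"
    have "\<forall>k. \<exists>p. k < card S \<longrightarrow> (\<forall>z\<in>cut_plane.
      z ^ M * (z - 1) ^ M * coeff (lag_coeff S (\<lambda>P. g (xf P z)) (\<lambda>P. ff P z)) k = poly p z)"
    proof
      fix k
      have "N k \<le> (\<Sum>k<card S. N k)" if "k < card S" using that by (intro member_le_sum) auto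
      thus "\<exists>p. k < card S \<longrightarrow> (\<forall>z\<in>cut_plane.
        z ^ M * (z - 1) ^ M * coeff (lag_coeff S (\<lambda>P. g (xf P z)) (\<lambda>P. ff P z)) k = poly p z)"
        using N[of k M] M by (cases "k < card S") auto
    qed
    then obtain p where "\<forall>k. k < card S \<longrightarrow> (\<forall>z\<in>cut_plane.
      z ^ M * (z - 1) ^ M * coeff (lag_coeff S (\<lambda>P. g (xf P z)) (\<lambda>P. ff P z)) k = poly (p k) z)" by metis
    thus "\<exists>p. \<forall>k<card S. \<forall>z\<in>cut_plane.
     z ^ M * (z - 1) ^ M * coeff (lag_coeff S (\<lambda>P. g (xf P z)) (\<lambda>P. ff P z)) k = poly (p k) z" by blast
  qed
qed

text \<open>Two Lagrange numerators are compared, with values exp (- xf P) and with values 1; the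
  latter is the derivative of the product of all y - ff P. At y = \<open>ff P0\<close> both carry
  the factor \<open>W\<close>, so their quotient is exp (- xf P0), which is a constant times z exp
  (gser z).\<close>

theorem complex_identity:
  "\<exists>n (p :: nat \<Rightarrow> complex poly) q.
     (\<exists>z\<in>ball 0 1. (\<Sum>k<n. poly (q k) z * fser z ^ k) \<noteq> 0) \<and>
     (\<forall>z\<in>cut_plane \<inter> ball 0 1. z * exp (gser z) * (\<Sum>k<n. poly (q k) z * fser z ^ k) = (\<Sum>k<n. poly (p k) z * fser z ^ k))"
proof -
  obtain \<kappa> where \<kappa>: "\<And>z. z \<in> cut_plane \<inter> ball 0 1 \<Longrightarrow> xf P0 z = - lg z - \<kappa> - gser z"
    using xf_P0_series by blast
  have e1: "(\<lambda>w. exp (- w)) holomorphic_on UNIV" "norm (exp (- w)) \<le> exp (norm w)" for w :: complex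
    using abs_Re_le_cmod[of w] by (auto intro!: holomorphic_intros simp: norm_exp_eq_Re)
  have e2: "exp (- (w + 2 * pi * \<i> * of_int n)) = exp (- w)" for w n
  proof -
    have "exp (- (w + 2 * pi * \<i> * of_int n)) = exp (- w) * exp (of_int (2 * (- n)) * pi * \<i>)"
      unfolding exp_add[symmetric] by (simp add: algebra_simps)
    also have "exp (of_int (2 * (- n)) * pi * \<i>) = 1" by (subst exp_eq_1) (auto intro!: exI[of _ "- n"])
    finally show ?thesis by simp
  qed
  obtain N1 where N1: "\<And>M. M \<ge> N1 \<Longrightarrow> \<exists>p. \<forall>k<card S. \<forall>z\<in>cut_plane.
     z ^ M * (z - 1) ^ M * coeff (lag_coeff S (\<lambda>P. exp (- xf P z)) (\<lambda>P. ff P z)) k = poly (p k) z"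
    using symmetric_rational[of "\<lambda>w. exp (- w)", OF e1(1) e2 e1(2)] by blast
  obtain N2 where N2: "\<And>M. M \<ge> N2 \<Longrightarrow> \<exists>q. \<forall>k<card S. \<forall>z\<in>cut_plane.
     z ^ M * (z - 1) ^ M * coeff (lag_coeff S (\<lambda>P. 1) (\<lambda>P. ff P z)) k = poly (q k) z"
    using symmetric_rational[of "\<lambda>w. 1"] by auto
  define M where "M = N1 + N2"
  obtain p where p: "\<And>k z. k < card S \<Longrightarrow> z \<in> cut_plane \<Longrightarrow>
     z ^ M * (z - 1) ^ M * coeff (lag_coeff S (\<lambda>P. exp (- xf P z)) (\<lambda>P. ff P z)) k = poly (p k) z"
    using N1[of M] by (auto simp: M_def)
  obtain q where q: "\<And>k z. k < card S \<Longrightarrow> z \<in> cut_plane \<Longrightarrow>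
     z ^ M * (z - 1) ^ M * coeff (lag_coeff S (\<lambda>P. 1) (\<lambda>P. ff P z)) k = poly (q k) z"
    using N2[of M] by (auto simp: M_def)
  have S_ne: "S \<noteq> {}" using P0_in_S by auto
  have poly_sum: "poly L y = (\<Sum>k<card S. coeff L k * y ^ k)" if "degree L < card S" for L :: "complex poly" and y
    unfolding poly_altdef using that by (intro sum.mono_neutral_left) (auto simp: coeff_eq_0)
  define W where "W z = (\<Prod>Q\<in>S - {P0}. ff P0 z - ff Q z)" for z
  have eval: "z ^ M * (z - 1) ^ M * (c P0 * W z) = (\<Sum>k<card S. poly (r k) z * ff P0 z ^ k)"
    if "\<And>k. k < card S \<Longrightarrow> z ^ M * (z - 1) ^ M * coeff (lag_coeff S c (\<lambda>P. ff P z)) k = poly (r k) z" for z c r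
  proof -
    have "c P0 * W z = poly (lag_coeff S c (\<lambda>P. ff P z)) (ff P0 z)"
      using poly_lag_coeff[OF finite_S P0_in_S, of c "\<lambda>P. ff P z"] by (simp add: W_def)
    also have "\<dots> = (\<Sum>k<card S. coeff (lag_coeff S c (\<lambda>P. ff P z)) k * ff P0 z ^ k)"
      by (rule poly_sum[OF degree_lag_coeff_less[OF finite_S S_ne]])
    finally have "z ^ M * (z - 1) ^ M * (c P0 * W z) = (\<Sum>k<card S. z ^ M * (z - 1) ^ M * coeff (lag_coeff S c (\<lambda>P. ff P z)) k * ff P0 z ^ k)"
      by (simp add: sum_distrib_left mult.assoc)
    also have "\<dots> = (\<Sum>k<card S. poly (r k) z * ff P0 z ^ k)"
      by (intro sum.cong refl arg_cong2[where f = "(*)"] that) auto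
    finally show ?thesis .
  qed
  have q': "z ^ M * (z - 1) ^ M * W z = (\<Sum>k<card S. poly (q k) z * fser z ^ k)" if "z \<in> cut_plane \<inter> ball 0 1" for z
    using eval[of z "\<lambda>_. 1" q] q[of _ z] that ff_P0[OF that] by simp
  have p': "z ^ M * (z - 1) ^ M * (exp (- xf P0 z) * W z) = (\<Sum>k<card S. poly (p k) z * fser z ^ k)" if "z \<in> cut_plane \<inter> ball 0 1" for z
    using eval[of z "\<lambda>P. exp (- xf P z)" p] p[of _ z] that ff_P0[OF that] by simp
  \<comment> \<open>Distinct branches give a point somewhere in the cut plane; the identity theorem
    brings one into the unit disc, where the series are available.\<close>
  have "\<exists>z\<in>cut_plane \<inter> ball 0 1. W z \<noteq> 0"
  proof (rule ccontr)
    assume *: "\<not> ?thesis"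
    have ffhol: "ff Q holomorphic_on cut_plane" if "Q \<in> S" for Q
      unfolding ff_def[abs_def] using that by (intro holomorphic_intros deriv_xf_holomorphic S_degree)
    have ne: "-1/2 \<in> cut_plane \<inter> ball 0 (1::real)" by (simp add: cut_plane_def)
    obtain z where z: "z \<in> cut_plane" "W z \<noteq> 0"
    proof -
      have "\<exists>z\<in>cut_plane. (\<Prod>Q\<in>S - {P0}. ff P0 z - ff Q z) \<noteq> 0"
        using ff_distinct S_degree P0_in_S finite_S ne
        by (intro prod_not_identically_zero open_cut_plane connected_cut_plane) (auto intro!: holomorphic_intros ffhol)
      thus ?thesis using that by (auto simp: W_def)
    qed
    have "W holomorphic_on cut_plane" unfolding W_def by (intro holomorphic_intros ffhol P0_in_S) auto
    hence "W z = 0" using * ne z(1)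
      by (intro analytic_continuation_open[of "cut_plane \<inter> ball 0 1" cut_plane W "\<lambda>_. 0" z] open_cut_plane connected_cut_plane open_Int) auto
    thus False using z(2) by simp
  qed
  then obtain z0 where z0: "z0 \<in> cut_plane \<inter> ball 0 1" "W z0 \<noteq> 0" by blast
  show ?thesis
  \<comment> \<open>The factor exp (- \<kappa>) removes the constant of integration at infinity and
    leaves z exp (gser z), whose Taylor coefficients are rational.\<close>
  proof (rule exI[of _ "card S"], rule exI[of _ "\<lambda>k. smult (exp (- \<kappa>)) (p k)"], rule exI[of _ q], rule conjI)
    have "z0 \<noteq> 0" "z0 \<noteq> 1" using z0 cut_planeD(1) by auto
    hence "(\<Sum>k<card S. poly (q k) z0 * fser z0 ^ k) \<noteq> 0"
      using z0(2) unfolding q'[OF z0(1), symmetric] by simp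
    thus "\<exists>z\<in>ball 0 1. (\<Sum>k<card S. poly (q k) z * fser z ^ k) \<noteq> 0"
      using z0(1) by blast
    show "\<forall>z\<in>cut_plane \<inter> ball 0 1. z * exp (gser z) * (\<Sum>k<card S. poly (q k) z * fser z ^ k) = (\<Sum>k<card S. poly (smult (exp (- \<kappa>)) (p k)) z * fser z ^ k)"
    proof
      fix z assume z: "z \<in> cut_plane \<inter> ball 0 1"
      have "- xf P0 z = lg z + \<kappa> + gser z" unfolding \<kappa>[OF z] by simp
      hence "exp (- xf P0 z) = z * exp \<kappa> * exp (gser z)" using lg_strip(3)[of z] z by (simp add: exp_add)
      hence "exp (- \<kappa>) * exp (- xf P0 z) = z * exp (gser z)" by (simp add: exp_minus)
      hence "z * exp (gser z) * (z ^ M * (z - 1) ^ M * W z) = exp (- \<kappa>) * (z ^ M * (z - 1) ^ M * (exp (- xf P0 z) * W z))"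
        by (metis (no_types, lifting) mult.assoc mult.left_commute)
      thus "z * exp (gser z) * (\<Sum>k<card S. poly (q k) z * fser z ^ k) = (\<Sum>k<card S. poly (smult (exp (- \<kappa>)) (p k)) z * fser z ^ k)"
        unfolding q'[OF z] p'[OF z] by (simp add: sum_distrib_left mult.assoc)
    qed
  qed
qed

end

section \<open>Descent to the rationals\<close>

lemma map_poly_of_int_mult: "map_poly of_int (p * q) = (map_poly of_int p * map_poly of_int q :: rat poly)"
  by (rule poly_eqI) (simp add: coeff_map_poly coeff_mult)

lemma map_poly_of_rat_mult: "map_poly of_rat (p * q) = (map_poly of_rat p * map_poly of_rat q :: complex poly)"
  by (rule poly_eqI) (simp add: coeff_map_poly coeff_mult of_rat_sum of_rat_mult)

lemma rat_poly_common_denom: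
  fixes p :: "rat poly"
  shows "\<exists>d (a :: int poly). d > 0 \<and> smult (of_int d) p = map_poly of_int a"
proof -
  define d where "d = (\<Prod>i\<le>degree p. snd (quotient_of (coeff p i)))"
  have d0: "d > 0" unfolding d_def by (intro prod_pos) (auto simp: quotient_of_denom_pos')
  have int: "of_int d * coeff p k \<in> \<int>" for k
  proof (cases "k \<le> degree p")
    case True
    define q where "q = quotient_of (coeff p k)"
    have "coeff p k = of_int (fst q) / of_int (snd q)" "snd q > 0"
      using quotient_of_div[of "coeff p k" "fst q" "snd q"] by (auto simp: q_def quotient_of_denom_pos')
    moreover have "d = snd q * (\<Prod>i\<in>{..degree p} - {k}. snd (quotient_of (coeff p i)))"
      unfolding d_def q_def using True by (subst prod.remove[of _ k]) auto
    ultimately have "of_int d * coeff p k = of_int (fst q * (\<Prod>i\<in>{..degree p} - {k}. snd (quotient_of (coeff p i))))"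
      by simp
    thus ?thesis by (metis Ints_of_int)
  qed (simp add: coeff_eq_0)
  define a where "a = map_poly (\<lambda>c. \<lfloor>of_int d * c\<rfloor>) p"
  have "smult (of_int d) p = map_poly of_int a"
    by (rule poly_eqI) (use int in \<open>auto simp: a_def coeff_map_poly elim!: Ints_cases\<close>)
  thus ?thesis using d0 by blast
qed

lemma content_eq_1_of_monic:
  fixes p :: "int poly"
  assumes "lead_coeff p = 1"
  shows "content p = 1"
proof -
  have "content p dvd 1" using content_dvd_coeff[of p "degree p"] assms by simp
  thus ?thesis by (metis is_unit_normalize normalize_content)
qed

text \<open>Gauss's lemma. After clearing denominators the contents divide the leading coefficients
  \<open>d1\<close> and \<open>d2\<close>, and their product is \<open>d1 * d2\<close>; so both
  divisibilities are equalities and \<open>d1\<close> divides every coefficient of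
  \<open>a\<close>.\<close>

lemma monic_rat_factor_int:
  fixes p q :: "rat poly" and g :: "int poly"
  assumes monic: "lead_coeff p = 1" "lead_coeff g = 1" and eq: "p * q = map_poly of_int g"
  shows "coeff p k \<in> \<int>"
proof -
  obtain d1 a where d1: "d1 > 0" "smult (of_int d1) p = map_poly of_int a" using rat_poly_common_denom by blast
  obtain d2 b where d2: "d2 > 0" "smult (of_int d2) q = map_poly of_int b" using rat_poly_common_denom by blast
  have "map_poly of_int (a * b) = (map_poly of_int (smult (d1 * d2) g) :: rat poly)"
    unfolding map_poly_of_int_mult d1(2)[symmetric] d2(2)[symmetric]
    by (rule poly_eqI) (simp add: eq coeff_map_poly mult_ac)
  hence "of_int (coeff (a * b) k) = (of_int (coeff (smult (d1 * d2) g) k) :: rat)" for k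
    by (metis coeff_map_poly of_int_0)
  hence "coeff (a * b) k = coeff (smult (d1 * d2) g) k" for k by (simp only: of_int_eq_iff)
  hence ab: "a * b = smult (d1 * d2) g" by (rule poly_eqI)
  have "content (a * b) = content (smult (d1 * d2) g)" by (simp add: ab)
  hence cont: "content a * content b = d1 * d2"
    using d1 d2 content_eq_1_of_monic[OF monic(2)] by (simp add: content_mult abs_mult)
  have la: "lead_coeff a = d1"
  proof -
    have "of_int (coeff a (degree p)) = coeff (smult (of_int d1) p) (degree p)" unfolding d1(2) by (simp add: coeff_map_poly)
    hence "of_int (coeff a (degree p)) = (of_int d1 :: rat)" using monic by simp
    hence "coeff a (degree p) = d1" by simp
    moreover have "degree a = degree p"
    proof -
      have "degree a = degree (map_poly of_int a :: rat poly)" by (simp add: degree_map_poly)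
      also have "\<dots> = degree (smult (of_int d1) p)" by (simp only: d1(2))
      also have "\<dots> = degree p" using d1(1) by simp
      finally show ?thesis .
    qed
    ultimately show ?thesis by simp
  qed
  have "lead_coeff (a * b) = d1 * d2" unfolding ab using monic d1 d2 by simp
  hence lb: "lead_coeff b = d2" using la d1 by (simp add: lead_coeff_mult)
  have "content a dvd d1" "content b dvd d2"
    using content_dvd_coeff[of a "degree a"] content_dvd_coeff[of b "degree b"] la lb by auto
  hence "content a \<le> d1" "content b \<le> d2" using d1 d2 by (auto intro: zdvd_imp_le)
  moreover have "content a \<ge> 0" "content b \<ge> 0" by (metis abs_ge_zero normalize_content normalize_int_def)+
  ultimately have "content a = d1" using cont d1 d2
    by (smt (verit, best) mult_left_mono mult_strict_right_mono)
  hence "d1 dvd coeff a k" using content_dvd_coeff by metis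
  then obtain c where c: "coeff a k = d1 * c" by blast
  have "of_int d1 * coeff p k = of_int (coeff a k)"
    using arg_cong[OF d1(2), of "\<lambda>p. coeff p k"] by (simp add: coeff_map_poly)
  hence "coeff p k = of_int c" using c d1 by simp
  thus ?thesis by simp
qed

lemma prod_roots_dvd:
  fixes p :: "complex poly"
  assumes "finite C" "\<And>c. c \<in> C \<Longrightarrow> poly p c = 0"
  shows "(\<Prod>c\<in>C. [:- c, 1:]) dvd p"
  using assms
proof (induction C rule: finite_induct)
  case (insert c C)
  then obtain q where q: "p = (\<Prod>c\<in>C. [:- c, 1:]) * q" by (auto elim!: dvdE)
  have "poly p c = 0" using insert by auto
  moreover have "poly (\<Prod>c\<in>C. [:- c, 1:]) c \<noteq> 0" using insert.hyps by (auto simp: poly_prod)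
  ultimately have "poly q c = 0" by (simp add: q)
  then obtain q' where q': "q = [:- c, 1:] * q'" by (auto simp: poly_eq_0_iff_dvd elim: dvdE)
  have "p = (\<Prod>c\<in>insert c C. [:- c, 1:]) * q'"
    unfolding q q' prod.insert[OF insert.hyps] by (simp only: mult_ac)
  thus ?case by (rule dvdI)
qed auto

text \<open>Balancedness speaks of rational coefficients only. For rational exponents the roots are
  distinct roots of unity, so the polynomial is a monic factor of some t^M - 1 and Gauss's lemma
  applies.\<close>

lemma cis_poly_int:
  assumes fin: "finite Y" and sub: "Y \<subseteq> {0<..1}" and rat: "Y \<subseteq> \<rat>"
    and coeffs: "\<And>k. coeff (cis_poly Y) k \<in> \<rat>"
  shows "coeff (cis_poly Y) k \<in> \<int>"
proof -
  have "\<forall>y\<in>Y. \<exists>m::nat. m > 0 \<and> real m * y \<in> \<int>"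
  proof
    fix y assume "y \<in> Y"
    hence "y \<in> \<rat>" using rat by blast
    then obtain m n :: int where "n > 0" "y = of_int m / of_int n" by (auto elim: Rats_cases')
    hence "real (nat n) * y = of_int m" "nat n > 0" by auto
    thus "\<exists>m::nat. m > 0 \<and> real m * y \<in> \<int>" by (metis Ints_of_int)
  qed
  then obtain m where m: "\<And>y. y \<in> Y \<Longrightarrow> m y > 0 \<and> real (m y) * y \<in> \<int>" by metis
  define M where "M = (\<Prod>y\<in>Y. m y)"
  have M0: "M > 0" unfolding M_def using m by (intro prod_pos) auto
  have root: "cis_pt y ^ M = 1" if y: "y \<in> Y" for y
  proof -
    have "M = m y * (\<Prod>y\<in>Y - {y}. m y)" unfolding M_def using fin y by (rule prod.remove)
    hence "real M * y = of_nat (\<Prod>y\<in>Y - {y}. m y) * (real (m y) * y)" by simp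
    also have "\<dots> \<in> \<int>" by (rule Ints_mult[OF Ints_of_nat conjunct2[OF m[OF y]]])
    finally obtain n :: int where n: "real M * y = of_int n" by (auto elim: Ints_cases)
    have "cis_pt y ^ M = exp (of_nat M * (- (2 * pi * \<i> * of_real y)))" by (simp only: cis_pt_def exp_of_nat_mult)
    also have "of_nat M * (- (2 * pi * \<i> * of_real y)) = - (2 * pi * \<i> * of_real (real M * y))" by simp
    also have "\<dots> = of_int (2 * (- n)) * pi * \<i>" unfolding n by simp
    also have "exp \<dots> = 1" by (subst exp_eq_1) (auto intro!: exI[of _ "- n"])
    finally show ?thesis .
  qed
  define g :: "int poly" where "g = monom 1 M - 1"
  have "g = monom 1 M + [:-1:]" by (simp add: g_def one_pCons)
  hence deg_g: "degree g = M" using M0 by (simp add: degree_add_eq_left degree_monom_eq)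
  have lg: "lead_coeff g = 1" unfolding deg_g unfolding g_def using M0 by simp
  define gc :: "complex poly" where "gc = map_poly of_int g"
  have gc: "gc = monom 1 M - 1" unfolding gc_def g_def by (rule poly_eqI) (simp add: coeff_map_poly)
  have inj: "inj_on cis_pt Y" using inj_on_cis_pt sub by (rule inj_on_subset)
  have "cis_poly Y = (\<Prod>c\<in>cis_pt ` Y. [:- c, 1:])" by (simp add: cis_poly_def prod.reindex[OF inj])
  hence "cis_poly Y dvd gc"
    using prod_roots_dvd[of "cis_pt ` Y" gc] fin root by (auto simp: gc poly_monom)
  then obtain Q where Q: "gc = cis_poly Y * Q" by (auto elim: dvdE)
  define h where "h c = (SOME r::rat. complex_of_rat r = c)" for c
  have h: "of_rat (h c) = c" if "c \<in> \<rat>" for c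
  proof -
    obtain r where "c = of_rat r" using \<open>c \<in> \<rat>\<close> by (rule Rats_cases)
    hence "\<exists>r. complex_of_rat r = c" by blast
    thus ?thesis unfolding h_def by (rule someI_ex)
  qed
  have h0: "h 0 = 0" using h[of 0] by simp
  define p where "p = map_poly h (cis_poly Y)"
  have p: "map_poly of_rat p = cis_poly Y"
    by (rule poly_eqI) (use h coeffs h0 in \<open>simp add: p_def coeff_map_poly\<close>)
  have lp: "lead_coeff p = 1"
  proof -
    have "degree p = degree (cis_poly Y)" unfolding p[symmetric] by (simp add: degree_map_poly)
    hence "of_rat (lead_coeff p) = (1 :: complex)" using lead_coeff_cis_poly[of Y] unfolding p[symmetric] by (simp add: coeff_map_poly)
    thus ?thesis by simp
  qed
  define gr :: "rat poly" where "gr = map_poly of_int g"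
  have gr: "map_poly of_rat gr = gc" unfolding gr_def gc_def by (rule poly_eqI) (simp add: coeff_map_poly)
  \<comment> \<open>Divisibility is known over the complex numbers. The rational remainder is also a
    complex remainder, divisible by \<open>cis_poly Y\<close> and of smaller degree, hence
    zero.\<close>
  have "p * (gr div p) = gr"
  proof -
    have p0: "p \<noteq> 0" using lp by auto
    define R where "R = map_poly complex_of_rat (gr mod p)"
    have "gc = cis_poly Y * map_poly of_rat (gr div p) + R"
    proof -
      have c: "coeff (p * (gr div p)) n + coeff (gr mod p) n = coeff gr n" for n
        by (metis coeff_add mult_div_mod_eq)
      have "map_poly complex_of_rat gr = map_poly of_rat (p * (gr div p)) + R"
        unfolding R_def by (rule poly_eqI) (simp only: coeff_add coeff_map_poly of_rat_0 of_rat_add[symmetric] c)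
      thus ?thesis by (simp add: gr map_poly_of_rat_mult p)
    qed
    hence "cis_poly Y dvd R" using Q by (metis dvd_add_right_iff dvd_triv_left)
    moreover have "degree R < degree (cis_poly Y) \<or> R = 0"
      using degree_mod_less[OF p0, of gr] unfolding R_def p[symmetric] by (auto simp: degree_map_poly)
    ultimately have "R = 0" by (meson dvd_imp_degree_le not_le)
    hence "of_rat (coeff (gr mod p) k) = (0 :: complex)" for k unfolding R_def by (metis coeff_0 coeff_map_poly of_rat_0)
    hence "gr mod p = 0" by (intro poly_eqI) simp
    thus ?thesis by (metis add.right_neutral mult.commute div_mult_mod_eq)
  qed
  hence "coeff p k \<in> \<int>" unfolding gr_def by (rule monic_rat_factor_int[OF lp lg])
  then obtain n :: int where "coeff p k = of_int n" by (auto elim: Ints_cases)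
  hence "coeff (cis_poly Y) k = of_int n" unfolding p[symmetric] by (simp add: coeff_map_poly)
  thus ?thesis by simp
qed

section \<open>From complex to rational relations\<close>

definition rat_fps :: "complex fps \<Rightarrow> bool" where "rat_fps F \<longleftrightarrow> (\<forall>n. fps_nth F n \<in> \<rat>)"

lemma rat_fps_mult: "rat_fps F \<Longrightarrow> rat_fps G \<Longrightarrow> rat_fps (F * G)"
  by (auto simp: rat_fps_def fps_mult_nth intro!: Rats_sum Rats_mult)

lemma rat_fps_power: "rat_fps F \<Longrightarrow> rat_fps (F ^ n)"
proof (induction n)
  case 0
  show ?case by (simp add: rat_fps_def)
qed (simp add: rat_fps_mult)

lemma rat_fps_compose: "rat_fps F \<Longrightarrow> rat_fps G \<Longrightarrow> rat_fps (F oo G)"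
  using rat_fps_power[of G] by (auto simp: rat_fps_def fps_compose_nth intro!: Rats_sum Rats_mult)

text \<open>The independent set {v} is extended to a basis of the complex numbers over the
  rationals.\<close>

lemma ex_rat_functional:
  fixes v :: complex
  assumes "v \<noteq> 0"
  shows "\<exists>l :: complex \<Rightarrow> rat. (\<forall>x y. l (x + y) = l x + l y) \<and> (\<forall>r x. l (of_rat r * x) = r * l x) \<and> l v = 1"
proof -
  interpret vector_space_pair "\<lambda>(r::rat) (x::complex). of_rat r * x" "\<lambda>(r::rat) (x::rat). r * x"
    by unfold_locales (auto simp: algebra_simps of_rat_add of_rat_mult)
  have "vs1.independent {v}" using assms by (simp add: vs1.dependent_single)
  then obtain l where l: "Vector_Spaces.linear (\<lambda>(r::rat) (x::complex). of_rat r * x) (\<lambda>(r::rat) (x::rat). r * x) l" "l v = 1"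
    using linear_independent_extend[of "{v}" "\<lambda>_. 1"] by auto
  interpret l: Vector_Spaces.linear "\<lambda>(r::rat) (x::complex). of_rat r * x" "\<lambda>(r::rat) (x::rat). r * x" l by fact
  show ?thesis using l.add l.scale l(2) by (intro exI[of _ l]) auto
qed

lemma eval2_sum_monom:
  fixes r :: "nat \<Rightarrow> rat poly" and z y :: complex
  shows "poly (map_poly (\<lambda>q. poly (map_poly of_rat q) z) (\<Sum>k<n. monom (r k) k)) y = (\<Sum>k<n. poly (map_poly of_rat (r k)) z * y ^ k)"
proof -
  define P where "P = (\<Sum>k<n. monom (r k) k)"
  define e where "e q = poly (map_poly of_rat q) z" for q
  have e0: "e 0 = 0" by (simp add: e_def)
  have cP: "coeff P i = (if i < n then r i else 0)" for i
    by (simp add: P_def coeff_sum)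
  have "map_poly e P = (\<Sum>k<n. monom (e (r k)) k)"
    by (rule poly_eqI) (simp add: coeff_map_poly[of e, OF e0] cP coeff_sum e0)
  hence "poly (map_poly e P) y = (\<Sum>k<n. e (r k) * y ^ k)" by (simp add: poly_sum poly_monom)
  thus ?thesis by (simp add: P_def e_def[abs_def])
qed

text \<open>A linear functional over the rationals, applied to the coefficients, turns a complex relation
  between power series with rational coefficients into a rational one.\<close>
lemma rational_relation:
  fixes f F :: "complex \<Rightarrow> complex" and p q :: "nat \<Rightarrow> complex poly"
  assumes hol: "f holomorphic_on ball 0 1" "F holomorphic_on ball 0 1"
    and fps: "f has_fps_expansion Tf" "F has_fps_expansion TF" "rat_fps Tf" "rat_fps TF"
    and ne: "\<exists>z\<in>ball 0 1. (\<Sum>k<n. poly (q k) z * f z ^ k) \<noteq> 0"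
    and eq: "\<And>z. z \<in> ball 0 1 \<Longrightarrow> F z * (\<Sum>k<n. poly (q k) z * f z ^ k) = (\<Sum>k<n. poly (p k) z * f z ^ k)"
  shows "\<exists>p' q' :: nat \<Rightarrow> rat poly. (\<exists>z\<in>ball 0 1. (\<Sum>k<n. poly (map_poly of_rat (q' k)) z * f z ^ k) \<noteq> 0) \<and>
    (\<forall>z\<in>ball 0 1. F z * (\<Sum>k<n. poly (map_poly of_rat (q' k)) z * f z ^ k) = (\<Sum>k<n. poly (map_poly of_rat (p' k)) z * f z ^ k))"
proof -
  define \<Phi> where "\<Phi> r z = (\<Sum>k<n. poly (r k) z * f z ^ k)" for r :: "nat \<Rightarrow> complex poly" and z
  define T where "T r = (\<Sum>k<n. fps_of_poly (r k) * Tf ^ k)" for r :: "nat \<Rightarrow> complex poly"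
  have poly_exp: "poly P has_fps_expansion fps_of_poly P" for P :: "complex poly"
    by (simp add: has_fps_expansion_def)
  have \<Phi>T: "\<Phi> r has_fps_expansion T r" for r
    unfolding \<Phi>_def T_def by (intro fps_expansion_intros fps poly_exp)
  have \<Phi>hol: "\<Phi> r holomorphic_on ball 0 1" for r
    unfolding \<Phi>_def by (intro holomorphic_intros hol)
  have zero: "h z = 0" if "h holomorphic_on ball 0 1" "h has_fps_expansion 0" "z \<in> ball 0 1" for h z
  proof -
    have "eventually (\<lambda>z. h z = 0) (nhds 0)" using that(2) by (auto simp: has_fps_expansion_def eval_fps_def elim: eventually_mono)
    then obtain U where U: "open U" "0 \<in> U" "\<And>z. z \<in> U \<Longrightarrow> h z = 0" by (auto simp: eventually_nhds)
    show ?thesis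
      by (rule analytic_continuation_open[of "U \<inter> ball 0 1" "ball 0 1" h "\<lambda>_. 0"]) (use U that in auto)
  qed
  have "T q \<noteq> 0"
  proof
    assume "T q = 0"
    hence "\<Phi> q z = 0" if "z \<in> ball 0 1" for z using zero[OF \<Phi>hol _ that] \<Phi>T[of q] by simp
    thus False using ne by (auto simp: \<Phi>_def)
  qed
  \<comment> \<open>The functional takes the value 1 at this coefficient, which keeps the new
    denominator from vanishing.\<close>
  then obtain i where i: "fps_nth (T q) i \<noteq> 0" by (auto simp: fps_eq_iff)
  obtain l :: "complex \<Rightarrow> rat" where l: "\<And>x y. l (x + y) = l x + l y" "\<And>r x. l (of_rat r * x) = r * l x"
    "l (fps_nth (T q) i) = 1" using ex_rat_functional[OF i] by blast
  have l0: "l 0 = 0" using l(2)[of 0 0] by simp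
  have lsum: "l (\<Sum>i\<in>I. g i) = (\<Sum>i\<in>I. l (g i))" if "finite I" for I :: "nat set" and g
    using that by (induction I rule: finite_induct) (simp_all add: l l0)
  have lrat: "complex_of_rat (l (x * c)) = of_rat (l x) * c" if "c \<in> \<rat>" for x c
  proof -
    obtain r where "c = of_rat r" using \<open>c \<in> \<rat>\<close> by (rule Rats_cases)
    thus ?thesis using l(2)[of r x] by (simp add: mult.commute of_rat_mult)
  qed
  define L where "L G = Abs_fps (\<lambda>n. complex_of_rat (l (fps_nth G n)))" for G :: "complex fps"
  have L_add: "L (G + H) = L G + L H" for G H by (simp add: L_def fps_eq_iff l of_rat_add)
  have L_0: "L 0 = 0" by (simp add: L_def fps_eq_iff l0)
  \<comment> \<open>Rational factors pass through the functional. The powers of f and the series of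
    F are rational, so only the coefficients of the polynomials change.\<close>
  have L_mult: "L (G * R) = L G * R" if "rat_fps R" for G R
    using that by (simp add: L_def fps_eq_iff fps_mult_nth lsum of_rat_sum lrat rat_fps_def)
  have L_sum: "L (\<Sum>k\<in>I. g k) = (\<Sum>k\<in>I. L (g k))" if "finite I" for I :: "nat set" and g
    using that by (induction I rule: finite_induct) (simp_all add: L_add L_0)
  define lp where "lp r k = map_poly l (r k)" for r :: "nat \<Rightarrow> complex poly" and k
  have L_poly: "L (fps_of_poly (r k)) = fps_of_poly (map_poly of_rat (lp r k))" for r k
    by (simp add: L_def lp_def fps_eq_iff coeff_map_poly l0)
  have L_T: "L (T r) = T (\<lambda>k. map_poly of_rat (lp r k))" for r
    unfolding T_def by (simp add: L_sum L_mult rat_fps_power fps L_poly)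
  have T_eq: "T q * TF = T p"
  proof -
    have "(\<lambda>z. \<Phi> q z * F z) has_fps_expansion T q * TF" by (intro fps_expansion_intros \<Phi>T fps)
    hence "(\<lambda>z. \<Phi> q z * F z - \<Phi> p z) has_fps_expansion T q * TF - T p" by (intro fps_expansion_intros \<Phi>T fps)
    moreover have "(\<lambda>z. \<Phi> q z * F z - \<Phi> p z) has_fps_expansion 0"
    proof -
      have "eventually (\<lambda>z. z \<in> ball 0 1) (nhds (0::complex))" by (intro eventually_nhds_in_open) auto
      hence "eventually (\<lambda>z. 0 = \<Phi> q z * F z - \<Phi> p z) (nhds 0)"
        by eventually_elim (use eq in \<open>simp add: \<Phi>_def mult.commute\<close>)
      moreover have "(\<lambda>z. 0) has_fps_expansion (0 :: complex fps)" by (rule fps_expansion_intros)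
      ultimately show ?thesis by (rule has_fps_expansion_cong[THEN iffD1, OF _ refl])
    qed
    ultimately have "T q * TF - T p = 0" by (meson fps_expansion_unique_complex)
    thus ?thesis by simp
  qed
  define q' p' where "q' = (\<lambda>k. map_poly complex_of_rat (lp q k))" and "p' = (\<lambda>k. map_poly complex_of_rat (lp p k))"
  have T': "T q' * TF - T p' = 0"
    using arg_cong[OF T_eq, of L] L_mult[OF fps(4), of "T q"] L_T[of q] L_T[of p] by (simp add: q'_def p'_def)
  have "(\<lambda>z. \<Phi> q' z * F z - \<Phi> p' z) has_fps_expansion T q' * TF - T p'" by (intro fps_expansion_intros \<Phi>T fps)
  hence rel: "\<Phi> q' z * F z - \<Phi> p' z = 0" if "z \<in> ball 0 1" for z
    using that unfolding T' by (intro zero) (auto intro!: holomorphic_intros \<Phi>hol hol)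
  have "\<exists>z\<in>ball 0 1. \<Phi> q' z \<noteq> 0"
  proof (rule ccontr)
    assume *: "\<not> ?thesis"
    have "eventually (\<lambda>z. z \<in> ball 0 1) (nhds (0::complex))" by (intro eventually_nhds_in_open) auto
    hence "eventually (\<lambda>z. 0 = \<Phi> q' z) (nhds 0)" by eventually_elim (use * in auto)
    moreover have "(\<lambda>z. 0) has_fps_expansion (0 :: complex fps)" by (rule fps_expansion_intros)
    ultimately have "\<Phi> q' has_fps_expansion 0" by (rule has_fps_expansion_cong[THEN iffD1, OF _ refl])
    hence "T q' = 0" using \<Phi>T[of q'] by (meson fps_expansion_unique_complex)
    hence "L (T q) = 0" unfolding L_T q'_def .
    hence "fps_nth (L (T q)) i = 0" by simp
    thus False using l(3) by (simp add: L_def)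
  qed
  thus ?thesis using rel
    by (intro exI[of _ "lp p"] exI[of _ "lp q"]) (auto simp: \<Phi>_def q'_def p'_def mult.commute)
qed

section \<open>The hypergeometric function\<close>

context interlacing
begin

lemma fser_holomorphic: "fser holomorphic_on ball 0 1" and gser_holomorphic: "gser holomorphic_on ball 0 1"
proof -
  have sums: "(\<lambda>n. acoeff n * (z - 0) ^ n) sums fser z" "(\<lambda>n. acoeff n / of_nat n * (z - 0) ^ n) sums gser z"
    if "z \<in> ball 0 1" for z
    using that summable_acoeff[of z] by (auto simp: fser_def gser_def summable_sums)
  show "fser holomorphic_on ball 0 1" "gser holomorphic_on ball 0 1"
    by (rule power_series_holomorphic[OF sums(1)], assumption) (rule power_series_holomorphic[OF sums(2)])
qed

lemma fser_fps: "fser has_fps_expansion Abs_fps acoeff"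
  and gser_fps: "gser has_fps_expansion Abs_fps (\<lambda>n. acoeff n / of_nat n)"
proof -
  have ev: "eventually (\<lambda>z. z \<in> ball 0 1) (nhds (0::complex))" by (intro eventually_nhds_in_open) auto
  show "fser has_fps_expansion Abs_fps acoeff"
    by (rule has_fps_expansionI, rule eventually_mono[OF ev])
       (use summable_acoeff(1) in \<open>auto simp: fser_def summable_sums\<close>)
  show "gser has_fps_expansion Abs_fps (\<lambda>n. acoeff n / of_nat n)"
    by (rule has_fps_expansionI, rule eventually_mono[OF ev])
       (use summable_acoeff(2) in \<open>auto simp: gser_def summable_sums\<close>)
qed

lemma contour_integral_fser:
  assumes z: "z \<in> ball 0 1" "z \<noteq> 0"
  shows "contour_integral (linepath 0 z) (\<lambda>w. (fser w - 1) / w) = gser z"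
proof -
  obtain D0 where D0: "(gser has_field_derivative D0) (at 0)" using gser_deriv[of 0] by auto
  \<comment> \<open>The continuous integrand. The given one takes the value 0 at w = 0, a division
    by zero, and differs from \<open>h\<close> on the segment at most there.\<close>
  define h where "h w = (if w = 0 then D0 else (fser w - 1) / w)" for w
  have der: "(gser has_field_derivative h w) (at w within ball 0 1)" if "w \<in> ball 0 1" for w
  proof (cases "w = 0")
    case True
    thus ?thesis using D0 by (auto simp: h_def intro: has_field_derivative_at_within)
  next
    case False
    obtain D where "(gser has_field_derivative D) (at w)" "w * D = fser w - 1"
      using gser_deriv[of w] \<open>w \<in> ball 0 1\<close> by auto
    moreover from this have "D = h w" using False by (simp add: h_def field_simps)
    ultimately show ?thesis by (auto intro: has_field_derivative_at_within)
  qed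
  have "path_image (linepath 0 z) \<subseteq> ball 0 1"
    using z by (simp add: closed_segment_subset)
  hence "(h has_contour_integral (gser (pathfinish (linepath 0 z)) - gser (pathstart (linepath 0 z)))) (linepath 0 z)"
    by (intro contour_integral_primitive[OF der]) auto
  hence "(h has_contour_integral gser z) (linepath 0 z)" by simp
  hence "((\<lambda>w. (fser w - 1) / w) has_contour_integral gser z) (linepath 0 z)"
    unfolding has_contour_integral_def
    by (rule has_integral_spike_finite[of "{0}", rotated 2]) (use z in \<open>auto simp: h_def linepath_def\<close>)
  thus ?thesis by (rule contour_integral_unique)
qed

end

lemma of_real_of_rat: "complex_of_real (real_of_rat q) = of_rat q"
  by (cases q) (simp add: of_rat_rat)

lemma prod_nth_eq_prod_set: "distinct xs \<Longrightarrow> (\<Prod>j<length xs. f (xs ! j)) = (\<Prod>x\<in>set xs. f x)"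
  using prod.reindex_bij_betw[OF bij_betw_nth[of xs "{..<length xs}" "set xs"], of f] by auto

text \<open>For the numerator parameters balancedness is stated with the roots exp (2 pi i a),
  whereas \<open>cis_pt\<close> uses their conjugates. Rational coefficients are fixed by
  conjugation.\<close>

lemma coeff_prod_linear_cnj:
  "finite X \<Longrightarrow> coeff (\<Prod>x\<in>X. [:- cnj (g x), 1:]) k = cnj (coeff (\<Prod>x\<in>X. [:- g x, 1:]) k)"
  by (induction X arbitrary: k rule: finite_induct) (auto simp: coeff_pCons split: nat.splits)

lemma interlacing_of_params:
  assumes hp: "hyp_params a b" and bal: "balanced a b" and ti: "totally_interlaced a b"
  shows "interlacing_int (real_of_rat ` set a) (real_of_rat ` set b)"
proof -
  have da: "distinct a" and db: "distinct b" using ti by (auto simp: totally_interlaced_def separated_by_def)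
  have inj: "inj_on real_of_rat X" for X by (auto simp: inj_on_def)
  have range: "real_of_rat ` set a \<subseteq> {0<..1}" "real_of_rat ` set b \<subseteq> {0<..1}"
    using hp by (auto simp: hyp_params_def)
  have rat: "real_of_rat ` set xs \<subseteq> \<rat>" for xs by auto
  have sep: "\<exists>y\<in>real_of_rat ` set ys. x < y \<and> y < x'"
    if "separated_by xs ys" "x \<in> real_of_rat ` set xs" "x' \<in> real_of_rat ` set xs" "x < x'" for xs ys x x'
    using that by (fastforce simp: separated_by_def in_arc_def of_rat_less)
  show ?thesis
  proof unfold_locales
    show "finite (real_of_rat ` set a)" "finite (real_of_rat ` set b)" by auto
    show "card (real_of_rat ` set a) = card (real_of_rat ` set b)"
      using hp da db by (simp add: card_image[OF inj] distinct_card hyp_params_def)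
    show "real_of_rat ` set a \<inter> real_of_rat ` set b = {}" using hp by (auto simp: hyp_params_def)
    show "real_of_rat ` set a \<subseteq> {0<..1}" "real_of_rat ` set b \<subseteq> {0<..1}" by (rule range)+
    have "1 \<in> set b" using hp last_in_set[of b] by (auto simp: hyp_params_def)
    thus "1 \<in> real_of_rat ` set b" by force
    show "\<exists>y\<in>real_of_rat ` set b. x < y \<and> y < x'" if "x \<in> real_of_rat ` set a" "x' \<in> real_of_rat ` set a" "x < x'" for x x'
      using sep that ti by (auto simp: totally_interlaced_def)
    show "\<exists>y\<in>real_of_rat ` set a. x < y \<and> y < x'" if "x \<in> real_of_rat ` set b" "x' \<in> real_of_rat ` set b" "x < x'" for x x'
      using sep that ti by (auto simp: totally_interlaced_def)
    have cA: "cis_poly (real_of_rat ` set a) = (\<Prod>x\<in>set a. [:- cnj (exp (2 * pi * \<i> * of_rat x)), 1:])"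
      unfolding cis_poly_def by (subst prod.reindex[OF inj]) (simp add: cis_pt_def exp_cnj of_real_of_rat flip: of_real_of_rat)
    have cB: "cis_poly (real_of_rat ` set b) = (\<Prod>x\<in>set b. [:- exp (- 2 * pi * \<i> * of_rat x), 1:])"
      unfolding cis_poly_def by (subst prod.reindex[OF inj]) (simp add: cis_pt_def of_real_of_rat)
    have "coeff (cis_poly (real_of_rat ` set a)) k \<in> \<rat>" for k
    proof -
      have "coeff (\<Prod>x\<in>set a. [:- exp (2 * pi * \<i> * of_rat x), 1:]) k \<in> \<rat>"
        using bal by (simp add: balanced_def rat_poly_def prod.distinct_set_conv_list[OF da])
      thus ?thesis unfolding cA by (auto simp: coeff_prod_linear_cnj elim!: Rats_cases')
    qed
    thus "coeff (cis_poly (real_of_rat ` set a)) k \<in> \<int>" for k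
      by (intro cis_poly_int range rat) auto
    have "coeff (cis_poly (real_of_rat ` set b)) k \<in> \<rat>" for k
      unfolding cB using bal by (simp add: balanced_def rat_poly_def prod.distinct_set_conv_list[OF db])
    thus "coeff (cis_poly (real_of_rat ` set b)) k \<in> \<int>" for k
      by (intro cis_poly_int range rat) auto
  qed
qed

theorem theorem6p1:
  fixes a b :: "rat list"
  assumes "hyp_params a b"
    and "balanced a b"
    and "totally_interlaced a b"
  shows "\<exists>c::complex. c \<noteq> 0 \<and>
           (\<exists>P Q :: rat poly poly.
              (\<exists>z\<in>ball 0 1. eval2 Q z (hyp_f a b z) \<noteq> 0) \<and>
              (\<forall>z\<in>ball 0 1. hyp_F a b c z * eval2 Q z (hyp_f a b z) = eval2 P z (hyp_f a b z)))"
proof -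
  define A B where "A = real_of_rat ` set a" and "B = real_of_rat ` set b"
  interpret interlacing_int A B unfolding A_def B_def using assms by (rule interlacing_of_params)
  have da: "distinct a" "distinct b" and len: "length a = length b"
    using assms by (auto simp: totally_interlaced_def separated_by_def hyp_params_def)
  have inj: "inj_on real_of_rat X" for X by (auto simp: inj_on_def)
  have ac: "acoeff n = hyp_coeff a b n" for n
  proof -
    have "hyp_coeff a b n = (\<Prod>j<length a. pochhammer (of_rat (a ! j)) n) / (\<Prod>j<length b. pochhammer (of_rat (b ! j)) n)"
      by (simp add: hyp_coeff_def prod_dividef len)
    also have "\<dots> = (\<Prod>x\<in>set a. pochhammer (of_rat x) n) / (\<Prod>y\<in>set b. pochhammer (of_rat y) n)"
      unfolding prod_nth_eq_prod_set[OF da(1), of "\<lambda>x. pochhammer (of_rat x) n"] prod_nth_eq_prod_set[OF da(2), of "\<lambda>x. pochhammer (of_rat x) n"] ..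
    also have "\<dots> = acoeff n"
      unfolding acoeff_def u_nat unfolding A_def B_def prod.reindex[OF inj] by (simp add: of_real_of_rat)
    finally show ?thesis ..
  qed
  have acr: "acoeff n \<in> \<rat>" for n
  proof -
    have "pochhammer (of_rat q :: complex) n = of_rat (pochhammer q n)" for q
      by (simp add: pochhammer_prod of_rat_prod of_rat_add)
    hence "hyp_coeff a b n = of_rat (\<Prod>j<length a. pochhammer (a ! j) n / pochhammer (b ! j) n)"
      by (simp add: hyp_coeff_def of_rat_prod of_rat_divide)
    thus ?thesis unfolding ac by simp
  qed
  have f: "hyp_f a b = fser" by (rule ext) (simp add: hyp_f_def fser_def ac)
  define F where "F z = z * exp (gser z)" for z
  \<comment> \<open>At z = 0 both sides vanish through the factor z.\<close>
  have F: "hyp_F a b 1 z = F z" if "z \<in> ball 0 1" for z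
    using contour_integral_fser[OF that] by (cases "z = 0") (simp_all add: hyp_F_def F_def f)
  have Fhol: "F holomorphic_on ball 0 1" unfolding F_def by (intro holomorphic_intros gser_holomorphic)
  define TF where "TF = fps_X * (fps_exp 1 oo Abs_fps (\<lambda>n. acoeff n / of_nat n))"
  \<comment> \<open>The inner series may be substituted because its constant term, a quotient by
    zero, is 0.\<close>
  have "(exp \<circ> gser) has_fps_expansion fps_compose (fps_exp 1) (Abs_fps (\<lambda>n. acoeff n / of_nat n))"
    by (rule has_fps_expansion_compose[OF has_fps_expansion_exp1 gser_fps]) simp
  hence TF: "F has_fps_expansion TF" unfolding F_def TF_def
    by (intro fps_expansion_intros) (simp add: o_def)
  have rfact: "fact m \<in> (\<rat> :: complex set)" for m by (metis Rats_of_nat of_nat_fact)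
  have rTF: "rat_fps TF" unfolding TF_def
    by (intro rat_fps_mult rat_fps_compose) (auto simp: rat_fps_def fps_X_def acr rfact intro!: Rats_divide)
  obtain n p q where pq: "\<exists>z\<in>ball 0 1. (\<Sum>k<n. poly (q k) z * fser z ^ k) \<noteq> 0"
    "\<And>z. z \<in> cut_plane \<inter> ball 0 1 \<Longrightarrow> F z * (\<Sum>k<n. poly (q k) z * fser z ^ k) = (\<Sum>k<n. poly (p k) z * fser z ^ k)"
    using complex_identity unfolding F_def by blast
  have ne: "-1/2 \<in> cut_plane \<inter> ball 0 1" by (simp add: cut_plane_def)
  \<comment> \<open>Both sides are holomorphic on the whole disc, so the identity extends across the
    cut.\<close>
  have rel: "F z * (\<Sum>k<n. poly (q k) z * fser z ^ k) = (\<Sum>k<n. poly (p k) z * fser z ^ k)" if "z \<in> ball 0 1" for z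
    by (rule analytic_continuation_open[of "cut_plane \<inter> ball 0 1" "ball 0 1"])
       (use ne pq(2) that in \<open>auto intro!: holomorphic_intros Fhol fser_holomorphic open_Int open_cut_plane\<close>)
  obtain p' q' :: "nat \<Rightarrow> rat poly" where pq':
    "\<exists>z\<in>ball 0 1. (\<Sum>k<n. poly (map_poly of_rat (q' k)) z * fser z ^ k) \<noteq> 0"
    "\<forall>z\<in>ball 0 1. F z * (\<Sum>k<n. poly (map_poly of_rat (q' k)) z * fser z ^ k) = (\<Sum>k<n. poly (map_poly of_rat (p' k)) z * fser z ^ k)"
    using rational_relation[OF fser_holomorphic Fhol fser_fps TF _ rTF pq(1) rel] acr by (auto simp: rat_fps_def)
  have ev: "eval2 (\<Sum>k<n. monom (r k) k) z y = (\<Sum>k<n. poly (map_poly of_rat (r k)) z * y ^ k)" for r z y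
    unfolding eval2_def by (rule eval2_sum_monom)
  show ?thesis
    by (rule exI[of _ 1], rule conjI, simp, rule exI[of _ "\<Sum>k<n. monom (p' k) k"], rule exI[of _ "\<Sum>k<n. monom (q' k) k"])
       (use pq' F in \<open>simp add: ev f\<close>)
qed

end
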